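(* Let $(M,F)$ be a connected compact Finsler surface of genus at least one without conjugate points, with nonflat geodesic spray $S$, and let $(H,S,V,\mathcal{C})$ be its Berwald frame. If $V(\rho)=-\mathcal{I}\,\rho$, then $(M,F)$ is Riemannian.
   Context: $M$ is a $2$-dimensional smooth manifold, $\mathcal{T}M$ its tangent bundle with the zero section removed, with induced coordinates $(x^i,y^i)$; $J=\frac{\partial}{\partial y^i}\otimes dx^i$ is the almost-tangent structure and $\mathcal{C}=y^i\frac{\partial}{\partial y^i}$ the Liouville vector field. $F:TM\to\mathbb{R}$ is a Finsler function: smooth and positive on $\mathcal{T}M$, zero exactly on the zero section, positively $1$-homogeneous in $y$, with $g_{ij}=\frac12\frac{\partial^2F^2}{\partial y^i\partial y^j}$ of maximal rank on $\mathcal{T}M$. $S=y^i\frac{\partial}{\partial x^i}-2G^i\frac{\partial}{\partial y^i}$ is its geodesic spray, and "horizontal" refers to the image of the projector $h=\frac12(Id+[J,S])$ (Frölicher–Nijenhuis bracket). With $G^i_j=\partial G^i/\partial y^j$, the Jacobi endomorphism is $\Phi=\big(2\frac{\partial G^i}{\partial x^j}-S(G^i_j)-G^i_kG^k_j\big)\frac{\partial}{\partial y^i}\otimes dx^j$; in dimension $2$ one has $\Phi=K(F^2J-F\,d_JF\otimes\mathcal{C})$, where $K\in C^\infty(\mathcal{T}M)$ is the flag curvature; the Ricci scalar is $\rho=KF^2$. $S$ is nonflat: $K$ vanishes nowhere on $\mathcal{T}M$. Berwald frame: $H$ is a horizontal vector field on $\mathcal{T}M$ with $[\mathcal{C},H]=H$,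 $d_JF(H)=0$, $V:=JH$, normalized so that $[S,H]=\rho V$, $[V,S]=H$, $[H,V]=S+\mathcal{I}H+\mathcal{J}V$ with $\mathcal{J}=S(\mathcal{I})$. Here $\mathcal{I}$ is the main (Cartan) scalar and $\mathcal{J}$ the Landsberg scalar. $H,S,V$ annihilate $F$. $(M,F)$ is Riemannian when $F^2$ is a quadratic form in $y$, equivalently $\mathcal{I}=0$. Conjugate points: a unit-speed geodesic $\eta$ satisfies $\eta''=S\circ\eta'$. A Jacobi field along $\eta$ is a vector field $Y$ along $\eta$ with $D_{\eta'}D_{\eta'}Y+R(Y,\eta')\eta'=0$, where $D$ is covariant differentiation for the Chern–Rund connection with reference vector $\eta'$ and $R(u,v)v=K(v)\,[g_v(v,v)u-g_v(u,v)v]$. Points $p,q$ are conjugate along $\eta$ if there is a nonzero Jacobi field along $\eta$ vanishing at $p$ and $q$; $(M,F)$ is without conjugate points if no geodesic has conjugate points. *)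

theory Defs
  imports "HOL-Analysis.Analysis"
begin

section \<open>Smooth maps between open subsets of normed spaces\<close>

primrec C_on :: "nat \<Rightarrow> 'a::real_normed_vector set \<Rightarrow> ('a \<Rightarrow> 'b::real_normed_vector) \<Rightarrow> bool" where
  "C_on 0 U f \<longleftrightarrow> continuous_on U f"
| "C_on (Suc k) U f \<longleftrightarrow> (\<forall>x\<in>U. f differentiable (at x)) \<and>
     (\<forall>v. C_on k U (\<lambda>x. frechet_derivative f (at x) v))"

definition smooth_on :: "'a::real_normed_vector set \<Rightarrow> ('a \<Rightarrow> 'b::real_normed_vector) \<Rightarrow> bool" where
  "smooth_on U f \<longleftrightarrow> (\<forall>k. C_on k U f)"


section \<open>Smooth surfaces\<close>

text \<open>A chart is its domain together with its coordinate map (irrelevant outside the domain).\<close>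

type_synonym 'a chart = "'a set \<times> ('a \<Rightarrow> real^2)"

text \<open>Induced coordinates \<open>(x, y)\<close> on the tangent bundle.\<close>

type_synonym coords = "(real^2) \<times> (real^2)"

definition is_chart :: "'a topology \<Rightarrow> 'a chart \<Rightarrow> bool" where
  "is_chart X c \<longleftrightarrow> openin X (fst c) \<and> open (snd c ` fst c) \<and>
     homeomorphic_map (subtopology X (fst c)) (top_of_set (snd c ` fst c)) (snd c)"

definition transition :: "'a chart \<Rightarrow> 'a chart \<Rightarrow> real^2 \<Rightarrow> real^2" where
  "transition c d = snd d \<circ> inv_into (fst c) (snd c)"

definition overlap :: "'a chart \<Rightarrow> 'a chart \<Rightarrow> (real^2) set" where
  "overlap c d = snd c ` (fst c \<inter> fst d)"

text \<open>The smooth structure is given by an atlas \<open>A\<close>, not assumed maximal.\<close>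

definition smooth_surface :: "'a topology \<Rightarrow> 'a chart set \<Rightarrow> bool" where
  "smooth_surface X A \<longleftrightarrow> Hausdorff_space X \<and> second_countable X \<and>
     (\<forall>c\<in>A. is_chart X c) \<and> (\<Union>c\<in>A. fst c) = topspace X \<and>
     (\<forall>c\<in>A. \<forall>d\<in>A. smooth_on (overlap c d) (transition c d))"

text \<open>
  The genus of a connected surface: the maximal number of pairwise disjoint simple closed
  curves along which the surface can be cut without becoming disconnected.
\<close>

definition genus :: "'a topology \<Rightarrow> enat" where
  "genus X = (SUP \<C> \<in> {\<C>. finite \<C> \<and> disjoint \<C> \<and>
       (\<forall>C\<in>\<C>. C \<subseteq> topspace X \<and>
          subtopology X C homeomorphic_space top_of_set (sphere (0::real^2) 1)) \<and>
       connectedin X (topspace X - \<Union>\<C>)}. enat (card \<C>))"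


section \<open>The tangent bundle\<close>

text \<open>
  A tangent vector at \<open>p\<close> is the family of its components in the charts around \<open>p\<close>, which
  are related by the differentials of the transition maps; the components in all other charts
  are set to \<open>0\<close>.
\<close>

definition tangent_space :: "'a chart set \<Rightarrow> 'a \<Rightarrow> ('a chart \<Rightarrow> real^2) set" where
  "tangent_space A p = {v.
     (\<forall>c\<in>A. \<forall>d\<in>A. p \<in> fst c \<inter> fst d \<longrightarrow>
        v d = frechet_derivative (transition c d) (at (snd c p)) (v c)) \<and>
     (\<forall>c. \<not> (c \<in> A \<and> p \<in> fst c) \<longrightarrow> v c = 0)}"

type_synonym 'a tvec = "'a \<times> ('a chart \<Rightarrow> real^2)"

definition tangent_bundle :: "'a topology \<Rightarrow> 'a chart set \<Rightarrow> 'a tvec set" where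
  "tangent_bundle X A = (SIGMA p:topspace X. tangent_space A p)"

definition slit_bundle :: "'a topology \<Rightarrow> 'a chart set \<Rightarrow> 'a tvec set" where
  "slit_bundle X A = {\<xi> \<in> tangent_bundle X A. snd \<xi> \<noteq> (\<lambda>_. 0)}"

text \<open>The range of the induced coordinates on the slit tangent bundle, and the tangent vector
  with given induced coordinates.\<close>

definition slit_dom :: "'a chart \<Rightarrow> (coords) set" where
  "slit_dom c = (snd c ` fst c) \<times> (- {0})"

definition tvec :: "'a chart set \<Rightarrow> 'a chart \<Rightarrow> coords \<Rightarrow> 'a tvec" where
  "tvec A c = (\<lambda>(x, y). let p = inv_into (fst c) (snd c) x in
     (p, \<lambda>d. if d \<in> A \<and> p \<in> fst d then frechet_derivative (transition c d) (at x) y else 0))"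

definition tangent_transition ::
    "'a chart \<Rightarrow> 'a chart \<Rightarrow> coords \<Rightarrow> coords" where
  "tangent_transition c d =
     (\<lambda>(x, y). (transition c d x, frechet_derivative (transition c d) (at x) y))"

definition smooth_fun :: "'a chart set \<Rightarrow> ('a tvec \<Rightarrow> real) \<Rightarrow> bool" where
  "smooth_fun A f \<longleftrightarrow> (\<forall>c\<in>A. smooth_on (slit_dom c) (\<lambda>z. f (tvec A c z)))"


section \<open>Vector fields on the slit tangent bundle\<close>

text \<open>
  A vector field is given by its components in the induced charts: \<open>Z c (x, y) = (a, b)\<close>
  stands for \<open>a\<^sup>i \<partial>/\<partial>x\<^sup>i + b\<^sup>i \<partial>/\<partial>y\<^sup>i\<close> at the point with coordinates \<open>(x, y)\<close>. Only the values
  on \<open>slit_dom c\<close> with \<open>c\<close> in the atlas matter.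
\<close>

type_synonym 'a vfield = "'a chart \<Rightarrow> coords \<Rightarrow> coords"

definition vector_field :: "'a chart set \<Rightarrow> 'a vfield \<Rightarrow> bool" where
  "vector_field A Z \<longleftrightarrow>
     (\<forall>c\<in>A. smooth_on (slit_dom c) (Z c)) \<and>
     (\<forall>c\<in>A. \<forall>d\<in>A. \<forall>z \<in> overlap c d \<times> (- {0}).
        Z d (tangent_transition c d z) =
        frechet_derivative (tangent_transition c d) (at z) (Z c z))"

text \<open>\<open>Z(f)\<close>, in the chart induced by \<open>c\<close>.\<close>

definition lie :: "'a chart set \<Rightarrow> 'a vfield \<Rightarrow> ('a tvec \<Rightarrow> real) \<Rightarrow> 'a chart \<Rightarrow> coords \<Rightarrow> real" where
  "lie A Z f c z = frechet_derivative (\<lambda>w. f (tvec A c w)) (at z) (Z c z)"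

definition bracket :: "'a vfield \<Rightarrow> 'a vfield \<Rightarrow> 'a vfield" where
  "bracket Y Z c z =
     frechet_derivative (Z c) (at z) (Y c z) - frechet_derivative (Y c) (at z) (Z c z)"

definition almost_tangent :: "'a vfield \<Rightarrow> 'a vfield" where
  "almost_tangent Z c z = (0, fst (Z c z))"

definition liouville :: "'a vfield" where
  "liouville c z = (0, snd z)"

text \<open>The Froelicher-Nijenhuis bracket \<open>[J, S]\<close>, as an endomorphism of vector fields:
  \<open>[J, S](Z) = [J Z, S] - J [Z, S]\<close>.\<close>

definition fn_bracket :: "'a vfield \<Rightarrow> 'a vfield \<Rightarrow> 'a vfield" where
  "fn_bracket S Z c z =
     bracket (almost_tangent Z) S c z - almost_tangent (bracket Z S) c z"

definition horizontal_projector :: "'a vfield \<Rightarrow> 'a vfield \<Rightarrow> 'a vfield" where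
  "horizontal_projector S Z c z = (1/2) *\<^sub>R (Z c z + fn_bracket S Z c z)"

definition horizontal :: "'a chart set \<Rightarrow> 'a vfield \<Rightarrow> 'a vfield \<Rightarrow> bool" where
  "horizontal A S Y \<longleftrightarrow> (\<exists>Z. vector_field A Z \<and>
     (\<forall>c\<in>A. \<forall>z\<in>slit_dom c. Y c z = horizontal_projector S Z c z))"


section \<open>Finsler functions and their geodesic sprays\<close>

text \<open>\<open>\<partial>/\<partial>x\<^sup>j\<close> and \<open>\<partial>/\<partial>y\<^sup>j\<close> in induced coordinates.\<close>

definition dx :: "2 \<Rightarrow> (coords \<Rightarrow> real) \<Rightarrow> coords \<Rightarrow> real" where
  "dx j f z = frechet_derivative f (at z) (axis j 1, 0)"

definition dy :: "2 \<Rightarrow> (coords \<Rightarrow> real) \<Rightarrow> coords \<Rightarrow> real" where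
  "dy j f z = frechet_derivative f (at z) (0, axis j 1)"

definition F2 :: "'a chart set \<Rightarrow> ('a tvec \<Rightarrow> real) \<Rightarrow> 'a chart \<Rightarrow> coords \<Rightarrow> real" where
  "F2 A F c z = (F (tvec A c z))\<^sup>2"

definition metric :: "'a chart set \<Rightarrow> ('a tvec \<Rightarrow> real) \<Rightarrow> 'a chart \<Rightarrow> coords \<Rightarrow> real^2^2" where
  "metric A F c z = (\<chi> i j. (1/2) * dy i (dy j (F2 A F c)) z)"

definition finsler :: "'a topology \<Rightarrow> 'a chart set \<Rightarrow> ('a tvec \<Rightarrow> real) \<Rightarrow> bool" where
  "finsler X A F \<longleftrightarrow>
     smooth_fun A F \<and>
     (\<forall>\<xi>\<in>slit_bundle X A. F \<xi> > 0) \<and>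
     (\<forall>p\<in>topspace X. F (p, \<lambda>_. 0) = 0) \<and>
     (\<forall>(p, v)\<in>tangent_bundle X A. \<forall>t>0. F (p, \<lambda>c. t *\<^sub>R v c) = t * F (p, v)) \<and>
     (\<forall>c\<in>A. \<forall>z\<in>slit_dom c. rank (metric A F c z) = 2)"

text \<open>
  The geodesic spray is the one whose integral curves solve the Euler-Lagrange equations of
  \<open>F\<^sup>2\<close>, i.e. \<open>S(\<partial>F\<^sup>2/\<partial>y\<^sup>l) = \<partial>F\<^sup>2/\<partial>x\<^sup>l\<close>; solved for the coefficients,
  \<open>G\<^sup>i = 1/4 g\<^sup>i\<^sup>l (y\<^sup>k \<partial>\<^sup>2F\<^sup>2/\<partial>x\<^sup>k\<partial>y\<^sup>l - \<partial>F\<^sup>2/\<partial>x\<^sup>l)\<close>.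
\<close>

definition spray_coeff ::
    "'a chart set \<Rightarrow> ('a tvec \<Rightarrow> real) \<Rightarrow> 'a chart \<Rightarrow> coords \<Rightarrow> real^2" where
  "spray_coeff A F c z = (1/4) *\<^sub>R (matrix_inv (metric A F c z) *v
     (\<chi> l. (\<Sum>k\<in>UNIV. snd z $ k * dx k (dy l (F2 A F c)) z) - dx l (F2 A F c) z))"

definition geodesic_spray :: "'a chart set \<Rightarrow> ('a tvec \<Rightarrow> real) \<Rightarrow> 'a vfield" where
  "geodesic_spray A F c z = (snd z, (- 2) *\<^sub>R spray_coeff A F c z)"

definition nonlinear_conn ::
    "'a chart set \<Rightarrow> ('a tvec \<Rightarrow> real) \<Rightarrow> 'a chart \<Rightarrow> 2 \<Rightarrow> 2 \<Rightarrow> coords \<Rightarrow> real" where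
  "nonlinear_conn A F c i j = dy j (\<lambda>w. spray_coeff A F c w $ i)"

definition jacobi_endo ::
    "'a chart set \<Rightarrow> ('a tvec \<Rightarrow> real) \<Rightarrow> 'a chart \<Rightarrow> 2 \<Rightarrow> 2 \<Rightarrow> coords \<Rightarrow> real" where
  "jacobi_endo A F c i j z =
     2 * dx j (\<lambda>w. spray_coeff A F c w $ i) z
     - frechet_derivative (nonlinear_conn A F c i j) (at z) (geodesic_spray A F c z)
     - (\<Sum>k\<in>UNIV. nonlinear_conn A F c i k z * nonlinear_conn A F c k j z)"

text \<open>\<open>\<Phi> = K (F\<^sup>2 J - F d\<^sub>JF \<otimes> \<C>)\<close>; this determines \<open>K\<close> uniquely on the slit tangent bundle.\<close>

definition flag_curvature :: "'a chart set \<Rightarrow> ('a tvec \<Rightarrow> real) \<Rightarrow> ('a tvec \<Rightarrow> real) \<Rightarrow> bool" where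
  "flag_curvature A F K \<longleftrightarrow> smooth_fun A K \<and>
     (\<forall>c\<in>A. \<forall>z\<in>slit_dom c. \<forall>i j. jacobi_endo A F c i j z =
        K (tvec A c z) * ((F (tvec A c z))\<^sup>2 * (if i = j then 1 else 0)
          - F (tvec A c z) * dy j (\<lambda>w. F (tvec A c w)) z * snd z $ i))"

definition ricci_scalar :: "('a tvec \<Rightarrow> real) \<Rightarrow> ('a tvec \<Rightarrow> real) \<Rightarrow> 'a tvec \<Rightarrow> real" where
  "ricci_scalar F K \<xi> = K \<xi> * (F \<xi>)\<^sup>2"

definition nonflat :: "'a topology \<Rightarrow> 'a chart set \<Rightarrow> ('a tvec \<Rightarrow> real) \<Rightarrow> bool" where
  "nonflat X A K \<longleftrightarrow> (\<forall>\<xi>\<in>slit_bundle X A. K \<xi> \<noteq> 0)"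

definition riemannian :: "'a chart set \<Rightarrow> ('a tvec \<Rightarrow> real) \<Rightarrow> bool" where
  "riemannian A F \<longleftrightarrow> (\<forall>c\<in>A. \<forall>x\<in>snd c ` fst c.
     \<exists>a :: real^2^2. transpose a = a \<and> (\<forall>y. (F (tvec A c (x, y)))\<^sup>2 = y \<bullet> (a *v y)))"


section \<open>Berwald frame\<close>

text \<open>
  \<open>H\<close> generates the Berwald frame \<open>(H, S, V, \<C>)\<close>, where \<open>V = J H\<close>, and \<open>I\<close> is the main scalar;
  the Landsberg scalar is \<open>S(I)\<close>. The condition \<open>d\<^sub>JF(H) = 0\<close> reads \<open>(J H)(F) = 0\<close>.
\<close>

definition berwald_frame ::
    "'a chart set \<Rightarrow> ('a tvec \<Rightarrow> real) \<Rightarrow> ('a tvec \<Rightarrow> real) \<Rightarrow> 'a vfield \<Rightarrow> ('a tvec \<Rightarrow> real) \<Rightarrow> bool" where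
  "berwald_frame A F K H I \<longleftrightarrow>
     (let S = geodesic_spray A F; V = almost_tangent H in
       vector_field A H \<and> smooth_fun A I \<and> horizontal A S H \<and>
       (\<forall>c\<in>A. \<forall>z\<in>slit_dom c.
          bracket liouville H c z = H c z \<and>
          lie A (almost_tangent H) F c z = 0 \<and>
          bracket S H c z = ricci_scalar F K (tvec A c z) *\<^sub>R V c z \<and>
          bracket V S c z = H c z \<and>
          bracket H V c z =
            S c z + I (tvec A c z) *\<^sub>R H c z + lie A S I c z *\<^sub>R V c z))"


section \<open>Geodesics, Jacobi fields and conjugate points\<close>

text \<open>Induced coordinates of the velocity of the curve \<open>\<eta>\<close> at time \<open>t\<close>.\<close>

definition velocity :: "'a chart \<Rightarrow> (real \<Rightarrow> 'a) \<Rightarrow> real \<Rightarrow> coords" where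
  "velocity c \<eta> t = (snd c (\<eta> t), vector_derivative (\<lambda>s. snd c (\<eta> s)) (at t))"

text \<open>Geodesics are parametrised on open intervals \<open>T\<close>; differentiability of \<open>\<eta>\<close> in charts is part
  of \<open>\<eta>'' = S \<circ> \<eta>'\<close>.\<close>

definition unit_geodesic ::
    "'a topology \<Rightarrow> 'a chart set \<Rightarrow> ('a tvec \<Rightarrow> real) \<Rightarrow> real set \<Rightarrow> (real \<Rightarrow> 'a) \<Rightarrow> bool" where
  "unit_geodesic X A F T \<eta> \<longleftrightarrow>
     open T \<and> is_interval T \<and> continuous_map (top_of_set T) X \<eta> \<and>
     (\<forall>c\<in>A. \<forall>t\<in>T. \<eta> t \<in> fst c \<longrightarrow>
        (velocity c \<eta> has_vector_derivative geodesic_spray A F c (velocity c \<eta> t)) (at t) \<and>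
        F (tvec A c (velocity c \<eta> t)) = 1)"

text \<open>Coefficients \<open>\<Gamma>\<^sup>i\<^sub>j\<^sub>k\<close> of the Chern-Rund connection:
  \<open>1/2 g\<^sup>i\<^sup>l (\<delta>\<^sub>j g\<^sub>l\<^sub>k + \<delta>\<^sub>k g\<^sub>j\<^sub>l - \<delta>\<^sub>l g\<^sub>j\<^sub>k)\<close> with \<open>\<delta>\<^sub>j = \<partial>/\<partial>x\<^sup>j - G\<^sup>k\<^sub>j \<partial>/\<partial>y\<^sup>k\<close>.\<close>

definition hderiv ::
    "'a chart set \<Rightarrow> ('a tvec \<Rightarrow> real) \<Rightarrow> 'a chart \<Rightarrow> 2 \<Rightarrow> (coords \<Rightarrow> real) \<Rightarrow> coords \<Rightarrow> real" where
  "hderiv A F c j f z = dx j f z - (\<Sum>k\<in>UNIV. nonlinear_conn A F c k j z * dy k f z)"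

definition chern_rund ::
    "'a chart set \<Rightarrow> ('a tvec \<Rightarrow> real) \<Rightarrow> 'a chart \<Rightarrow> 2 \<Rightarrow> 2 \<Rightarrow> 2 \<Rightarrow> coords \<Rightarrow> real" where
  "chern_rund A F c i j k z = (1/2) * (\<Sum>l\<in>UNIV. matrix_inv (metric A F c z) $ i $ l *
     (hderiv A F c j (\<lambda>w. metric A F c w $ l $ k) z
      + hderiv A F c k (\<lambda>w. metric A F c w $ j $ l) z
      - hderiv A F c l (\<lambda>w. metric A F c w $ j $ k) z))"

definition field_along ::
    "'a chart set \<Rightarrow> real set \<Rightarrow> (real \<Rightarrow> 'a) \<Rightarrow> (real \<Rightarrow> 'a chart \<Rightarrow> real^2) \<Rightarrow> bool" where
  "field_along A T \<eta> Y \<longleftrightarrow> (\<forall>t\<in>T. Y t \<in> tangent_space A (\<eta> t)) \<and>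
     (\<forall>c\<in>A. smooth_on {t\<in>T. \<eta> t \<in> fst c} (\<lambda>t. Y t c))"

text \<open>\<open>D\<^bsub>\<eta>'\<^esub> Y\<close> with reference vector \<open>\<eta>'\<close>, in chart \<open>c\<close>.\<close>

definition covariant_deriv ::
    "'a chart set \<Rightarrow> ('a tvec \<Rightarrow> real) \<Rightarrow> (real \<Rightarrow> 'a) \<Rightarrow> (real \<Rightarrow> 'a chart \<Rightarrow> real^2) \<Rightarrow>
     real \<Rightarrow> 'a chart \<Rightarrow> real^2" where
  "covariant_deriv A F \<eta> Y t c = vector_derivative (\<lambda>s. Y s c) (at t) +
     (\<chi> i. \<Sum>j\<in>UNIV. \<Sum>k\<in>UNIV.
        chern_rund A F c i j k (velocity c \<eta> t) * snd (velocity c \<eta> t) $ j * Y t c $ k)"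

definition curvature_term ::
    "'a chart set \<Rightarrow> ('a tvec \<Rightarrow> real) \<Rightarrow> ('a tvec \<Rightarrow> real) \<Rightarrow> 'a chart \<Rightarrow> coords \<Rightarrow> real^2 \<Rightarrow> real^2" where
  "curvature_term A F K c z u = (let g = metric A F c z; v = snd z in
     K (tvec A c z) *\<^sub>R ((v \<bullet> (g *v v)) *\<^sub>R u - (u \<bullet> (g *v v)) *\<^sub>R v))"

definition jacobi_field ::
    "'a chart set \<Rightarrow> ('a tvec \<Rightarrow> real) \<Rightarrow> ('a tvec \<Rightarrow> real) \<Rightarrow> real set \<Rightarrow> (real \<Rightarrow> 'a) \<Rightarrow>
     (real \<Rightarrow> 'a chart \<Rightarrow> real^2) \<Rightarrow> bool" where
  "jacobi_field A F K T \<eta> Y \<longleftrightarrow> field_along A T \<eta> Y \<and>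
     (\<forall>c\<in>A. \<forall>t\<in>T. \<eta> t \<in> fst c \<longrightarrow>
        covariant_deriv A F \<eta> (covariant_deriv A F \<eta> Y) t c +
        curvature_term A F K c (velocity c \<eta> t) (Y t c) = 0)"

definition conjugate_along ::
    "'a chart set \<Rightarrow> ('a tvec \<Rightarrow> real) \<Rightarrow> ('a tvec \<Rightarrow> real) \<Rightarrow> real set \<Rightarrow> (real \<Rightarrow> 'a) \<Rightarrow>
     real \<Rightarrow> real \<Rightarrow> bool" where
  "conjugate_along A F K T \<eta> s t \<longleftrightarrow> s \<in> T \<and> t \<in> T \<and> s \<noteq> t \<and>
     (\<exists>Y. jacobi_field A F K T \<eta> Y \<and> (\<exists>r\<in>T. Y r \<noteq> (\<lambda>_. 0)) \<and>
          Y s = (\<lambda>_. 0) \<and> Y t = (\<lambda>_. 0))"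

definition without_conjugate_points ::
    "'a topology \<Rightarrow> 'a chart set \<Rightarrow> ('a tvec \<Rightarrow> real) \<Rightarrow> ('a tvec \<Rightarrow> real) \<Rightarrow> bool" where
  "without_conjugate_points X A F K \<longleftrightarrow>
     (\<forall>T \<eta> s t. unit_geodesic X A F T \<eta> \<longrightarrow> \<not> conjugate_along A F K T \<eta> s t)"

end

theory Submission
  imports Defs
begin

text \<open>
  Let \<open>J = S(I)\<close> be the Landsberg scalar. The Jacobi identity for \<open>S\<close>, \<open>H\<close>, \<open>V\<close> reads
  \<open>S(J) + I \<rho> + V(\<rho>) = 0\<close> (\<open>bianchi\<close>), so the hypothesis on \<open>V(\<rho>)\<close> says that \<open>S(J) = 0\<close>.

  Such identities are turned into vanishing statements by a maximum principle. The fields \<open>S\<close> and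
  \<open>V\<close> annihilate \<open>F\<close>, hence are tangent to the sphere bundles \<open>F = r\<close>, which are compact; where a
  smooth function on such a sphere bundle is extremal, its derivatives along \<open>S\<close> and \<open>V\<close> vanish
  (\<open>maximum_principle\<close>). Since \<open>S(I J) = J\<^sup>2\<close>, the extremal values of \<open>I J\<close> are \<open>0\<close>, so that \<open>I J\<close>
  is identically \<open>0\<close>, and therefore \<open>J = 0\<close> (\<open>landsberg\<close>).

  Now the bracket relations applied to \<open>I\<close> become \<open>S(V(I)) = - H(I)\<close> and \<open>S(H(I)) = \<rho> V(I)\<close>: along a
  unit speed geodesic \<open>V(I)\<close> solves \<open>f'' + K f = 0\<close>, and its product with the projection of \<open>H\<close> to
  the surface is a Jacobi field (\<open>main_scalar_field_jacobi\<close>). Suppose that \<open>V(I) \<noteq> 0\<close> at a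
  unit vector with \<open>K > 0\<close>. On the sphere bundle \<open>\<bar>K\<bar>\<close> is bounded below by a positive constant, geodesics
  can be prolonged for as long as desired (\<open>long_geodesic\<close>), and Sturm comparison produces two zeros
  of the Jacobi field, contrary to the absence of conjugate points. At unit vectors with
  \<open>K < 0\<close>, on the other hand, \<open>S(V(I) H(I)) = - H(I)\<^sup>2 + \<rho> V(I)\<^sup>2\<close> is negative unless \<open>V(I) = H(I) = 0\<close>.
  So the maximum principle for \<open>V(I) H(I)\<close> yields \<open>V(I) = 0\<close> on all unit vectors (\<open>VI_vanishes\<close>).

  Finally \<open>V(I \<rho>) = - I\<^sup>2 \<rho>\<close>, and the maximum principle along \<open>V\<close> gives \<open>I = 0\<close>
  (\<open>main_scalar_vanishes\<close>). Then the vertical derivative \<open>V\<close> rotates the pair formed by \<open>y\<close> and the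
  projection of \<open>H\<close>, which is orthogonal and of length \<open>F\<close> for \<open>g\<close>; hence \<open>g\<close> does not depend on \<open>y\<close>
  and \<open>F\<^sup>2\<close> is quadratic (\<open>riemannian_of_main_scalar\<close>).

  Geodesics can only be transported between charts if the geodesic spray is a vector field on the
  slit tangent bundle. This is read off from the bracket relations, which determine the spray
  (\<open>spray_field\<close>).
\<close>


section \<open>Calculus of smooth maps\<close>

abbreviation fd :: "('a::real_normed_vector \<Rightarrow> 'b::real_normed_vector) \<Rightarrow> 'a \<Rightarrow> 'a \<Rightarrow> 'b"
  where "fd f x \<equiv> frechet_derivative f (at x)"

lemma fd_works: "f differentiable (at x) \<Longrightarrow> (f has_derivative fd f x) (at x)"
  using frechet_derivative_works by blast

lemma fd_eqI: "(f has_derivative f') (at x) \<Longrightarrow> fd f x = f'"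
  using frechet_derivative_at by metis

lemma fd_linear: "f differentiable (at x) \<Longrightarrow> linear (fd f x)"
  by (rule linear_frechet_derivative)

lemma fd_cong:
  assumes "open U" "x \<in> U" "\<And>y. y \<in> U \<Longrightarrow> f y = g y" "f differentiable (at x)"
  shows "fd f x = fd g x"
  using frechet_derivative_transform_within_open[OF assms(4,1,2)] assms(3) by blast

lemma differentiable_cong_open:
  assumes "open U" "x \<in> U" "\<And>y. y \<in> U \<Longrightarrow> f y = g y" "f differentiable (at x)"
  shows "g differentiable (at x)"
  using assms by (meson differentiable_def has_derivative_transform_within_open)

lemma C_on_cong:
  assumes "open U" "\<And>x. x \<in> U \<Longrightarrow> f x = g x" "C_on k U f"
  shows "C_on k U g"
  using assms(2,3)
proof (induction k arbitrary: f g)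
  case 0
  then show ?case by (metis C_on.simps(1) continuous_on_cong)
next
  case (Suc k)
  have d: "f differentiable (at x)" if "x \<in> U" for x using Suc.prems that by simp
  have "g differentiable (at x)" if "x \<in> U" for x
    by (rule differentiable_cong_open[OF \<open>open U\<close> that _ d[OF that]]) (rule Suc.prems)
  moreover have "C_on k U (\<lambda>x. fd g x v)" for v
  proof (rule Suc.IH)
    show "fd f x v = fd g x v" if "x \<in> U" for x
      using fd_cong[OF \<open>open U\<close> that _ d[OF that], of g] Suc.prems(1) by simp
    show "C_on k U (\<lambda>x. fd f x v)" using Suc.prems by simp
  qed
  ultimately show ?case by simp
qed

lemma C_on_mono: "V \<subseteq> U \<Longrightarrow> C_on k U f \<Longrightarrow> C_on k V f"
  by (induction k arbitrary: f) (auto intro: continuous_on_subset)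

lemma C_on_SucD: "C_on (Suc k) U f \<Longrightarrow> C_on k U f"
proof (induction k arbitrary: f)
  case 0
  then show ?case
    by (auto intro!: continuous_at_imp_continuous_on differentiable_imp_continuous_within)
next
  case (Suc k)
  then show ?case by (metis C_on.simps(2))
qed

lemma C_on_const: "C_on k U (\<lambda>x. c)"
  by (induction k arbitrary: c) auto

lemma C_on_linear:
  assumes "open U" "bounded_linear L" "C_on k U f"
  shows "C_on k U (\<lambda>x. L (f x))"
  using assms(3)
proof (induction k arbitrary: f)
  case 0
  then have "continuous_on U f" by simp
  from bounded_linear.continuous_on[OF assms(2) this] show ?case by simp
next
  case (Suc k)
  have D: "((\<lambda>x. L (f x)) has_derivative (\<lambda>v. L (fd f x v))) (at x)" if "x \<in> U" for x
    by (rule bounded_linear.has_derivative[OF assms(2) fd_works]) (use Suc.prems that in simp)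
  have E: "L (fd f x v) = fd (\<lambda>x. L (f x)) x v" if "x \<in> U" for x v
    unfolding fd_eqI[OF D[OF that]] ..
  have "C_on k U (\<lambda>x. fd (\<lambda>x. L (f x)) x v)" for v
    by (rule C_on_cong[OF assms(1) E Suc.IH[of "\<lambda>x. fd f x v"]]) (use Suc.prems in auto)
  then show ?case using D unfolding C_on.simps differentiable_def by blast
qed

lemma C_on_ident: "open U \<Longrightarrow> C_on k U (\<lambda>x. x)"
  by (cases k) (auto intro: C_on_const)

lemma C_on_add:
  assumes "open U" "C_on k U f" "C_on k U g"
  shows "C_on k U (\<lambda>x. f x + g x)"
  using assms(2,3)
proof (induction k arbitrary: f g)
  case 0
  then show ?case by (auto intro: continuous_intros)
next
  case (Suc k)
  have D: "((\<lambda>x. f x + g x) has_derivative (\<lambda>v. fd f x v + fd g x v)) (at x)" if "x \<in> U" for x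
    by (intro has_derivative_add fd_works) (use Suc.prems that in auto)
  have "C_on k U (\<lambda>x. fd (\<lambda>x. f x + g x) x v)" for v
    by (rule C_on_cong[OF assms(1) _ Suc.IH[of "\<lambda>x. fd f x v" "\<lambda>x. fd g x v"]])
      (use Suc.prems fd_eqI[OF D] in auto)
  then show ?case using D unfolding C_on.simps differentiable_def by blast
qed

lemma C_on_sum:
  assumes "open U" "\<And>i. i \<in> I \<Longrightarrow> C_on k U (f i)"
  shows "C_on k U (\<lambda>x. \<Sum>i\<in>I. f i x)"
  using assms(2) by (induction I rule: infinite_finite_induct) (auto intro: C_on_const C_on_add assms(1))

lemma C_on_bilinear:
  assumes "bounded_bilinear p" "open U" "C_on k U f" "C_on k U g"
  shows "C_on k U (\<lambda>x. p (f x) (g x))"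
  using assms(3,4)
proof (induction k arbitrary: f g)
  case 0
  then show ?case using bounded_bilinear.continuous_on[OF assms(1)] by auto
next
  case (Suc k)
  have D: "((\<lambda>x. p (f x) (g x)) has_derivative (\<lambda>v. p (f x) (fd g x v) + p (fd f x v) (g x))) (at x)"
    if "x \<in> U" for x
    by (intro bounded_bilinear.FDERIV[OF assms(1)] fd_works) (use Suc.prems that in auto)
  have "C_on k U (\<lambda>x. fd (\<lambda>x. p (f x) (g x)) x v)" for v
    by (rule C_on_cong[OF assms(2) _ C_on_add[OF assms(2) Suc.IH[of f "\<lambda>x. fd g x v"] Suc.IH[of "\<lambda>x. fd f x v" g]]])
      (use Suc.prems Suc.prems[THEN C_on_SucD] fd_eqI[OF D] in auto)
  then show ?case using D unfolding C_on.simps differentiable_def by blast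
qed

text \<open>
  The predicate \<open>C_on\<close> speaks of derivatives in fixed directions only, whereas the chain rule
  differentiates \<open>g\<close> in the moving direction \<open>fd f x v\<close>. Expanding this direction in a basis reduces
  the composition to products of functions of one order less.
\<close>

lemma C_on_compose:
  fixes f :: "'a::real_normed_vector \<Rightarrow> 'b::euclidean_space" and g :: "'b \<Rightarrow> 'c::real_normed_vector"
  assumes "open U" "open W" "f ` U \<subseteq> W" "C_on k U f" "C_on k W g"
  shows "C_on k U (\<lambda>x. g (f x))"
  using assms(4,5)
proof (induction k arbitrary: g)
  case 0
  then show ?case using continuous_on_compose2[of W g U f] assms(3) by simp
next
  case (Suc k)
  have lin: "linear (fd g (f x))" if "x \<in> U" for x
    using Suc.prems that assms(3) by (auto intro!: fd_linear)
  have D: "((\<lambda>x. g (f x)) has_derivative (\<lambda>v. fd g (f x) (fd f x v))) (at x)" if "x \<in> U" for x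
    by (rule has_derivative_compose[OF fd_works fd_works]) (use Suc.prems that assms(3) in auto)
  have E: "fd (\<lambda>x. g (f x)) x v = (\<Sum>b\<in>Basis. (fd f x v \<bullet> b) *\<^sub>R fd g (f x) b)" if "x \<in> U" for x v
    unfolding fd_eqI[OF D[OF that]]
    by (subst euclidean_representation[of "fd f x v", symmetric])
      (simp add: linear_sum[OF lin[OF that]] linear_scale[OF lin[OF that]])
  have fk: "C_on k U f" using Suc.prems C_on_SucD by blast
  have "C_on k U (\<lambda>x. fd (\<lambda>x. g (f x)) x v)" for v
  proof (rule C_on_cong[OF assms(1)])
    show "C_on k U (\<lambda>x. \<Sum>b\<in>Basis. (fd f x v \<bullet> b) *\<^sub>R fd g (f x) b)"
    proof (intro C_on_sum[OF assms(1)] C_on_bilinear[OF bounded_bilinear_scaleR assms(1)])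
      show "C_on k U (\<lambda>x. fd f x v \<bullet> b)" for b
        by (rule C_on_linear[OF assms(1) bounded_linear_inner_left]) (use Suc.prems in auto)
      show "C_on k U (\<lambda>x. fd g (f x) b)" for b
        by (rule Suc.IH[OF fk, of "\<lambda>y. fd g y b"]) (use Suc.prems in auto)
    qed
  qed (use E in auto)
  then show ?case using D unfolding C_on.simps differentiable_def by blast
qed

lemma C_on_inverse:
  fixes f :: "'a::real_normed_vector \<Rightarrow> real"
  assumes "open U" "\<And>x. x \<in> U \<Longrightarrow> f x \<noteq> 0" "C_on k U f"
  shows "C_on k U (\<lambda>x. inverse (f x))"
  using assms(3)
proof (induction k)
  case 0
  then show ?case using assms(2) by (auto intro!: continuous_intros)
next
  case (Suc k)
  have D: "((\<lambda>x. inverse (f x)) has_derivative (\<lambda>v. - (inverse (f x) * fd f x v * inverse (f x)))) (at x)" if "x \<in> U" for x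
    by (rule Deriv.has_derivative_inverse[where f = f]) (use assms(2) fd_works[of f x] Suc.prems that in auto)
  have ik: "C_on k U (\<lambda>x. inverse (f x))" using Suc.IH Suc.prems C_on_SucD by blast
  have "C_on k U (\<lambda>x. fd (\<lambda>x. inverse (f x)) x v)" for v
  proof (rule C_on_cong[OF assms(1)])
    show "C_on k U (\<lambda>x. - (inverse (f x) * fd f x v * inverse (f x)))"
      by (intro C_on_linear[OF assms(1) bounded_linear_minus[OF bounded_linear_ident]]
          C_on_bilinear[OF bounded_bilinear_mult assms(1)] ik)
        (use Suc.prems in auto)
  qed (use fd_eqI[OF D] in auto)
  then show ?case using D unfolding C_on.simps differentiable_def by blast
qed

lemma smooth_onD: "smooth_on U f \<Longrightarrow> x \<in> U \<Longrightarrow> f differentiable (at x)"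
  unfolding smooth_on_def by (metis C_on.simps(2))

lemma smooth_on_fd: "smooth_on U f \<Longrightarrow> smooth_on U (\<lambda>x. fd f x v)"
  unfolding smooth_on_def by (metis C_on.simps(2))

lemma smooth_on_continuous: "smooth_on U f \<Longrightarrow> continuous_on U f"
  unfolding smooth_on_def by (metis C_on.simps(1))

lemma smooth_on_cong: "open U \<Longrightarrow> (\<And>x. x \<in> U \<Longrightarrow> f x = g x) \<Longrightarrow> smooth_on U f \<Longrightarrow> smooth_on U g"
  unfolding smooth_on_def by (metis C_on_cong)

lemma smooth_on_subset: "smooth_on U f \<Longrightarrow> V \<subseteq> U \<Longrightarrow> smooth_on V f"
  unfolding smooth_on_def by (metis C_on_mono)

lemma smooth_on_const: "smooth_on U (\<lambda>x. c)"
  by (simp add: smooth_on_def C_on_const)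

lemma smooth_on_linear: "open U \<Longrightarrow> bounded_linear L \<Longrightarrow> smooth_on U f \<Longrightarrow> smooth_on U (\<lambda>x. L (f x))"
  by (simp add: smooth_on_def C_on_linear)

lemma smooth_on_ident: "open U \<Longrightarrow> smooth_on U (\<lambda>x. x)"
  by (simp add: smooth_on_def C_on_ident)

lemma smooth_on_add: "open U \<Longrightarrow> smooth_on U f \<Longrightarrow> smooth_on U g \<Longrightarrow> smooth_on U (\<lambda>x. f x + g x)"
  by (simp add: smooth_on_def C_on_add)

lemma smooth_on_sum: "open U \<Longrightarrow> (\<And>i. i \<in> I \<Longrightarrow> smooth_on U (f i)) \<Longrightarrow> smooth_on U (\<lambda>x. \<Sum>i\<in>I. f i x)"
  by (simp add: smooth_on_def C_on_sum)

lemma smooth_on_scaleR: "open U \<Longrightarrow> smooth_on U f \<Longrightarrow> smooth_on U g \<Longrightarrow> smooth_on U (\<lambda>x. f x *\<^sub>R g x)"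
  by (simp add: smooth_on_def C_on_bilinear[OF bounded_bilinear_scaleR])

lemma smooth_on_mult:
  fixes f g :: "'a::real_normed_vector \<Rightarrow> real"
  shows "open U \<Longrightarrow> smooth_on U f \<Longrightarrow> smooth_on U g \<Longrightarrow> smooth_on U (\<lambda>x. f x * g x)"
  by (simp add: smooth_on_def C_on_bilinear[OF bounded_bilinear_mult])

lemma smooth_on_minus: "open U \<Longrightarrow> smooth_on U f \<Longrightarrow> smooth_on U (\<lambda>x. - f x)"
  by (rule smooth_on_linear[OF _ bounded_linear_minus[OF bounded_linear_ident]])

lemma smooth_on_diff: "open U \<Longrightarrow> smooth_on U f \<Longrightarrow> smooth_on U g \<Longrightarrow> smooth_on U (\<lambda>x. f x - g x)"
  using smooth_on_add[OF _ _ smooth_on_minus, of U f g] by simp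

lemma smooth_on_inverse:
  fixes f :: "'a::real_normed_vector \<Rightarrow> real"
  shows "open U \<Longrightarrow> (\<And>x. x \<in> U \<Longrightarrow> f x \<noteq> 0) \<Longrightarrow> smooth_on U f \<Longrightarrow> smooth_on U (\<lambda>x. inverse (f x))"
  by (simp add: smooth_on_def C_on_inverse)

lemma smooth_on_compose:
  fixes f :: "'a::real_normed_vector \<Rightarrow> 'b::euclidean_space"
  shows "open U \<Longrightarrow> open W \<Longrightarrow> f ` U \<subseteq> W \<Longrightarrow> smooth_on U f \<Longrightarrow> smooth_on W g \<Longrightarrow> smooth_on U (\<lambda>x. g (f x))"
  unfolding smooth_on_def using C_on_compose by blast

lemma smooth_on_Pair:
  assumes "open U" "smooth_on U f" "smooth_on U g"
  shows "smooth_on U (\<lambda>x. (f x, g x))"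
proof -
  have "smooth_on U (\<lambda>x. (f x, 0) + (0, g x))"
    by (intro smooth_on_add assms smooth_on_linear[OF assms(1), of "\<lambda>y. (y,0)"]
       smooth_on_linear[OF assms(1), of "\<lambda>y. (0,y)"] bounded_linear_Pair
       bounded_linear_ident bounded_linear_zero)
  then show ?thesis by simp
qed

lemma smooth_on_fst: "open U \<Longrightarrow> smooth_on U f \<Longrightarrow> smooth_on U (\<lambda>x. fst (f x))"
  by (rule smooth_on_linear[OF _ bounded_linear_fst])

lemma smooth_on_snd: "open U \<Longrightarrow> smooth_on U f \<Longrightarrow> smooth_on U (\<lambda>x. snd (f x))"
  by (rule smooth_on_linear[OF _ bounded_linear_snd])

lemma smooth_on_nth: "open U \<Longrightarrow> smooth_on U f \<Longrightarrow> smooth_on U (\<lambda>x. f x $ i)"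
  by (rule smooth_on_linear[OF _ bounded_linear_vec_nth])

lemma smooth_on_vec:
  fixes f :: "'n::finite \<Rightarrow> 'a::real_normed_vector \<Rightarrow> real"
  assumes "open U" "\<And>i. smooth_on U (f i)"
  shows "smooth_on U (\<lambda>x. \<chi> i. f i x)"
proof (rule smooth_on_cong[OF assms(1)])
  show "smooth_on U (\<lambda>x. \<Sum>i\<in>UNIV. f i x *\<^sub>R axis i 1)"
    by (intro smooth_on_sum smooth_on_scaleR smooth_on_const assms)
qed (simp add: vec_eq_iff axis_def if_distrib cong: if_cong)

text \<open>
  This turns derivatives along moving directions into combinations of derivatives in fixed ones.
\<close>

lemma fd_expand:
  fixes x :: "'a::euclidean_space"
  assumes "f differentiable (at x)"
  shows "fd f x v = (\<Sum>b\<in>Basis. (v \<bullet> b) *\<^sub>R fd f x b)"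
  by (subst euclidean_representation[of v, symmetric])
   (simp add: linear_sum[OF fd_linear[OF assms]] linear_scale[OF fd_linear[OF assms]])

lemma smooth_on_fd_field:
  fixes f :: "'a::euclidean_space \<Rightarrow> 'b::real_normed_vector" and Z :: "'a \<Rightarrow> 'a"
  assumes "open U" "smooth_on U f" "smooth_on U Z"
  shows "smooth_on U (\<lambda>x. fd f x (Z x))"
proof (rule smooth_on_cong[OF assms(1)])
  show "smooth_on U (\<lambda>x. \<Sum>b\<in>Basis. (Z x \<bullet> b) *\<^sub>R fd f x b)"
    by (intro smooth_on_sum smooth_on_scaleR smooth_on_fd assms smooth_on_linear[OF assms(1) bounded_linear_inner_left])
  show "(\<Sum>b\<in>Basis. (Z x \<bullet> b) *\<^sub>R fd f x b) = fd f x (Z x)" if "x \<in> U" for x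
    using fd_expand[OF smooth_onD[OF assms(2) that], symmetric] .
qed

lemma fd_compose:
  assumes "f differentiable (at x)" "g differentiable (at (f x))"
  shows "fd (\<lambda>x. g (f x)) x v = fd g (f x) (fd f x v)"
  using fd_eqI[OF has_derivative_compose[OF fd_works fd_works]] assms by metis

lemma fd_mult:
  fixes f g :: "'a::real_normed_vector \<Rightarrow> real"
  assumes "f differentiable (at x)" "g differentiable (at x)"
  shows "fd (\<lambda>x. f x * g x) x v = f x * fd g x v + fd f x v * g x"
  using fd_eqI[OF has_derivative_mult[OF fd_works fd_works]] assms by metis

lemma fd_diff:
  assumes "f differentiable (at x)" "g differentiable (at x)"
  shows "fd (\<lambda>x. f x - g x) x v = fd f x v - fd g x v"
  using fd_eqI[OF has_derivative_diff[OF fd_works fd_works]] assms by metis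

lemma fd_bounded_linear:
  assumes "bounded_linear L" "f differentiable (at x)"
  shows "fd (\<lambda>x. L (f x)) x v = L (fd f x v)"
  using fd_eqI[OF bounded_linear.has_derivative[OF assms(1) fd_works[OF assms(2)]]] by metis

lemma fd_sum:
  assumes "\<And>i. i \<in> I \<Longrightarrow> f i differentiable (at x)"
  shows "fd (\<lambda>x. \<Sum>i\<in>I. f i x) x v = (\<Sum>i\<in>I. fd (f i) x v)"
  using fd_eqI[OF has_derivative_sum[of I f "\<lambda>i. fd (f i) x"]] fd_works assms by metis

section \<open>Second derivatives commute\<close>

lemma has_real_derivative_line:
  fixes f :: "'a::real_normed_vector \<Rightarrow> real"
  assumes "f differentiable (at (z + t *\<^sub>R v))"
  shows "((\<lambda>s. f (z + s *\<^sub>R v)) has_real_derivative fd f (z + t *\<^sub>R v) v) (at t)"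
proof -
  have "((\<lambda>s. f (z + s *\<^sub>R v)) has_derivative (\<lambda>s. fd f (z + t *\<^sub>R v) (s *\<^sub>R v))) (at t)"
    by (rule has_derivative_compose[where g = f and f = "\<lambda>s. z + s *\<^sub>R v", OF _ fd_works[OF assms]])
      (auto intro!: derivative_eq_intros)
  then show ?thesis
    by (simp add: has_field_derivative_def linear_scale[OF fd_linear[OF assms]] mult_commute_abs)
qed

text \<open>
  The mean value theorem, applied in the direction \<open>v\<close> to the increment of \<open>f\<close> in the direction
  \<open>w\<close> and then in the direction \<open>w\<close> to the derivative of \<open>f\<close> along \<open>v\<close>.
\<close>

lemma second_difference:
  fixes f :: "'a::real_normed_vector \<Rightarrow> real"
  assumes "C_on 2 U f" and h: "h > 0"
    and sub: "\<And>s t. 0 \<le> s \<Longrightarrow> s \<le> h \<Longrightarrow> 0 \<le> t \<Longrightarrow> t \<le> h \<Longrightarrow> z + s *\<^sub>R v + t *\<^sub>R w \<in> U"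
  shows "\<exists>s t. 0 < s \<and> s < h \<and> 0 < t \<and> t < h \<and>
     f (z + h *\<^sub>R v + h *\<^sub>R w) - f (z + h *\<^sub>R v) - f (z + h *\<^sub>R w) + f z
      = h * h * fd (\<lambda>x. fd f x v) (z + s *\<^sub>R v + t *\<^sub>R w) w"
proof -
  have d1: "f differentiable (at x)" and d2: "(\<lambda>x. fd f x v) differentiable (at x)" if "x \<in> U" for x
    using assms(1) that by (auto simp: numeral_2_eq_2)
  define \<phi> where "\<phi> s = f ((z + h *\<^sub>R w) + s *\<^sub>R v) - f (z + s *\<^sub>R v)" for s
  have "(\<phi> has_real_derivative (fd f ((z + h *\<^sub>R w) + s *\<^sub>R v) v - fd f (z + s *\<^sub>R v) v)) (at s)"
    if "0 \<le> s" "s \<le> h" for s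
    unfolding \<phi>_def using sub[of s h] sub[of s 0] that h
    by (intro DERIV_diff has_real_derivative_line d1) (auto simp: algebra_simps)
  from MVT2[OF h this] obtain s where s: "0 < s" "s < h"
    and e1: "\<phi> h - \<phi> 0 = (h - 0) * (fd f ((z + h *\<^sub>R w) + s *\<^sub>R v) v - fd f (z + s *\<^sub>R v) v)" by blast
  define \<psi> where "\<psi> t = fd f ((z + s *\<^sub>R v) + t *\<^sub>R w) v" for t
  have "(\<psi> has_real_derivative fd (\<lambda>x. fd f x v) ((z + s *\<^sub>R v) + t *\<^sub>R w) w) (at t)"
    if "0 \<le> t" "t \<le> h" for t
    unfolding \<psi>_def using sub[of s t] that s by (intro has_real_derivative_line d2) auto
  from MVT2[OF h this] obtain t where t: "0 < t" "t < h"
    and e2: "\<psi> h - \<psi> 0 = (h - 0) * fd (\<lambda>x. fd f x v) ((z + s *\<^sub>R v) + t *\<^sub>R w) w" by blast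
  have "\<phi> h - \<phi> 0 = h * h * fd (\<lambda>x. fd f x v) (z + s *\<^sub>R v + t *\<^sub>R w) w"
    using e1 e2 by (simp add: \<psi>_def algebra_simps)
  then show ?thesis using s t by (intro exI[of _ s] exI[of _ t]) (simp add: \<phi>_def algebra_simps)
qed

text \<open>
  The second difference is symmetric in the two directions. Divided by the square of the step,
  it is close to either of the two mixed derivatives, since both are continuous.
\<close>

lemma second_derivative_symmetric:
  fixes f :: "'a::real_normed_vector \<Rightarrow> real"
  assumes "open U" "z \<in> U" "C_on 2 U f"
  shows "fd (\<lambda>x. fd f x v) z w = fd (\<lambda>x. fd f x w) z v"
proof (rule ccontr)
  define P where "P x = fd (\<lambda>x. fd f x v) x w" for x
  define Q where "Q x = fd (\<lambda>x. fd f x w) x v" for x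
  assume "fd (\<lambda>x. fd f x v) z w \<noteq> fd (\<lambda>x. fd f x w) z v"
  then have e: "\<bar>P z - Q z\<bar> / 2 > 0" by (simp add: P_def Q_def)
  have "continuous_on U P" "continuous_on U Q"
    using assms(3) by (auto simp: P_def Q_def numeral_2_eq_2)
  then have "isCont P z" "isCont Q z" using assms continuous_on_eq_continuous_at by blast+
  then obtain d1 d2 where d: "d1 > 0" "d2 > 0"
    and P: "\<And>x. dist x z < d1 \<Longrightarrow> dist (P x) (P z) < \<bar>P z - Q z\<bar> / 2"
    and Q: "\<And>x. dist x z < d2 \<Longrightarrow> dist (Q x) (Q z) < \<bar>P z - Q z\<bar> / 2"
    using e unfolding continuous_at_eps_delta by (metis)
  obtain r where r: "r > 0" "ball z r \<subseteq> U" using assms openE by blast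
  define m where "m = Min {d1, d2, r}"
  have m: "m > 0" "m \<le> d1" "m \<le> d2" "m \<le> r" using d r by (auto simp: m_def)
  \<comment> \<open>With this step the parallelogram spanned by \<open>h v\<close> and \<open>h w\<close> stays within distance \<open>m\<close> of \<open>z\<close>; the summand \<open>1\<close> covers \<open>v = w = 0\<close>.\<close>
  define h where "h = m / (2 * (norm v + norm w + 1))"
  have n: "norm v + norm w + 1 > 0" by (smt (verit) norm_ge_zero)
  have h: "h > 0" using m n by (simp add: h_def)
  have near: "dist (z + s *\<^sub>R v + t *\<^sub>R w) z < m" if "0 \<le> s" "s \<le> h" "0 \<le> t" "t \<le> h" for s t
  proof -
    have "dist (z + s *\<^sub>R v + t *\<^sub>R w) z = norm (s *\<^sub>R v + t *\<^sub>R w)" by (simp add: dist_norm add.assoc)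
    also have "\<dots> \<le> s * norm v + t * norm w" using norm_triangle_ineq[of "s *\<^sub>R v" "t *\<^sub>R w"] that by simp
    also have "\<dots> \<le> h * norm v + h * norm w" by (intro add_mono mult_right_mono) (use that in auto)
    also have "\<dots> \<le> h * (norm v + norm w + 1)" using h by (simp add: algebra_simps)
    also have "\<dots> = m / 2" using n by (simp add: h_def divide_simps)
    also have "\<dots> < m" using m by simp
    finally show ?thesis .
  qed
  have sub: "z + s *\<^sub>R v + t *\<^sub>R w \<in> U" if "0 \<le> s" "s \<le> h" "0 \<le> t" "t \<le> h" for s t
    using near[OF that] r(2) m by (auto simp: dist_commute subset_iff)
  have sub': "z + s *\<^sub>R w + t *\<^sub>R v \<in> U" if "0 \<le> s" "s \<le> h" "0 \<le> t" "t \<le> h" for s t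
    using sub[of t s] that by (simp add: algebra_simps)
  obtain s t where 1: "0 < s" "s < h" "0 < t" "t < h"
     "f (z + h *\<^sub>R v + h *\<^sub>R w) - f (z + h *\<^sub>R v) - f (z + h *\<^sub>R w) + f z = h * h * P (z + s *\<^sub>R v + t *\<^sub>R w)"
    using second_difference[OF assms(3) h sub] unfolding P_def by blast
  obtain s' t' where 2: "0 < s'" "s' < h" "0 < t'" "t' < h"
     "f (z + h *\<^sub>R w + h *\<^sub>R v) - f (z + h *\<^sub>R w) - f (z + h *\<^sub>R v) + f z = h * h * Q (z + s' *\<^sub>R w + t' *\<^sub>R v)"
    using second_difference[OF assms(3) h sub'] unfolding Q_def by blast
  have "h * h * P (z + s *\<^sub>R v + t *\<^sub>R w) = h * h * Q (z + t' *\<^sub>R v + s' *\<^sub>R w)"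
    using 1(5) 2(5) by (simp add: algebra_simps)
  then have eq: "P (z + s *\<^sub>R v + t *\<^sub>R w) = Q (z + t' *\<^sub>R v + s' *\<^sub>R w)" using h by simp
  have "dist (P (z + s *\<^sub>R v + t *\<^sub>R w)) (P z) < \<bar>P z - Q z\<bar> / 2"
    by (rule P) (use near[of s t] 1 m in auto)
  moreover have "dist (Q (z + t' *\<^sub>R v + s' *\<^sub>R w)) (Q z) < \<bar>P z - Q z\<bar> / 2"
    by (rule Q) (use near[of t' s'] 2 m in auto)
  moreover have "dist (P z) (Q z) \<le> dist (P (z + s *\<^sub>R v + t *\<^sub>R w)) (P z) + dist (Q (z + t' *\<^sub>R v + s' *\<^sub>R w)) (Q z)"
    using dist_triangle3[of "P z" "Q z" "Q (z + t' *\<^sub>R v + s' *\<^sub>R w)"] eq by simp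
  moreover define X where "X = dist (P z) (Q z)"
  ultimately show False unfolding dist_real_def[of "P z" "Q z", symmetric] X_def[symmetric] by linarith
qed


section \<open>Lie derivatives and the Jacobi identity of a frame\<close>

definition along :: "('a::real_normed_vector \<Rightarrow> 'a) \<Rightarrow> ('a \<Rightarrow> 'b::real_normed_vector) \<Rightarrow> 'a \<Rightarrow> 'b"
  where "along Z f x = fd f x (Z x)"

lemma along_smooth:
  fixes f :: "'a::euclidean_space \<Rightarrow> 'b::real_normed_vector"
  shows "open U \<Longrightarrow> smooth_on U f \<Longrightarrow> smooth_on U Z \<Longrightarrow> smooth_on U (along Z f)"
  unfolding along_def by (rule smooth_on_fd_field)

lemma along_cong:
  assumes "open U" "x \<in> U" "smooth_on U f" "\<And>y. y \<in> U \<Longrightarrow> f y = g y"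
  shows "along Z f x = along Z g x"
  unfolding along_def using fd_cong[OF assms(1,2,4) smooth_onD[OF assms(3,2)]] by simp

lemma along_diff:
  assumes "f differentiable (at x)" "g differentiable (at x)"
  shows "along Z (\<lambda>x. f x - g x) x = along Z f x - along Z g x"
  unfolding along_def by (rule fd_diff[OF assms])

lemma along_mult:
  fixes f g :: "'a::real_normed_vector \<Rightarrow> real"
  assumes "f differentiable (at x)" "g differentiable (at x)"
  shows "along Z (\<lambda>x. f x * g x) x = along Z f x * g x + f x * along Z g x"
  unfolding along_def using fd_mult[OF assms] by simp

text \<open>
  The product rule separates the change of \<open>f\<close> in the fixed direction \<open>Z x\<close> from the change of
  the direction.
\<close>

lemma fd_along:
  fixes f :: "'a::euclidean_space \<Rightarrow> real"
  assumes U: "open U" "x \<in> U" and f: "smooth_on U f" and Z: "Z differentiable (at x)"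
  shows "fd (along Z f) x v = fd (\<lambda>w. fd f w (Z x)) x v + fd f x (fd Z x v)"
proof -
  have fb: "(\<lambda>w. fd f w b) differentiable (at x)" for b
    using smooth_onD[OF smooth_on_fd[OF f] U(2)] .
  have Zb: "(\<lambda>w. Z w \<bullet> b) differentiable (at x)" for b
    using Z by (intro differentiable_inner) auto
  have DZ: "fd (\<lambda>w. Z w \<bullet> b) x v = fd Z x v \<bullet> b" for b
    by (rule fd_bounded_linear[OF bounded_linear_inner_left Z])
  have t: "(\<lambda>w. (Z w \<bullet> b) * fd f w b) differentiable (at x)" for b
    by (intro differentiable_mult Zb fb)
  have eq: "(\<Sum>b\<in>Basis. (Z w \<bullet> b) * fd f w b) = along Z f w" if "w \<in> U" for w
    unfolding along_def using fd_expand[OF smooth_onD[OF f that], of "Z w"] by simp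
  have "fd (along Z f) x v = fd (\<lambda>w. \<Sum>b\<in>Basis. (Z w \<bullet> b) * fd f w b) x v"
    by (rule fun_cong[OF fd_cong[OF U eq, symmetric]]) (auto intro!: differentiable_sum t)
  also have "\<dots> = (\<Sum>b\<in>Basis. (Z x \<bullet> b) * fd (\<lambda>w. fd f w b) x v + (fd Z x v \<bullet> b) * fd f x b)"
    by (simp add: fd_sum[OF t] fd_mult[OF Zb fb] DZ)
  also have "\<dots> = (\<Sum>b\<in>Basis. (Z x \<bullet> b) * fd (\<lambda>w. fd f w b) x v) + (\<Sum>b\<in>Basis. (fd Z x v \<bullet> b) * fd f x b)"
    by (rule sum.distrib)
  also have "(\<Sum>b\<in>Basis. (fd Z x v \<bullet> b) * fd f x b) = fd f x (fd Z x v)"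
    using fd_expand[OF smooth_onD[OF f U(2)], of "fd Z x v"] by simp
  also have "(\<Sum>b\<in>Basis. (Z x \<bullet> b) * fd (\<lambda>w. fd f w b) x v) = fd (\<lambda>w. \<Sum>b\<in>Basis. (Z x \<bullet> b) * fd f w b) x v"
    using fb by (subst fd_sum) (auto simp: fd_mult intro!: differentiable_mult)
  also have "fd (\<lambda>w. \<Sum>b\<in>Basis. (Z x \<bullet> b) * fd f w b) x v = fd (\<lambda>w. fd f w (Z x)) x v"
  proof (rule fun_cong[OF fd_cong[OF U]])
    show "(\<Sum>b\<in>Basis. (Z x \<bullet> b) * fd f w b) = fd f w (Z x)" if "w \<in> U" for w
      using fd_expand[OF smooth_onD[OF f that], of "Z x"] by simp
  qed (auto intro!: differentiable_sum differentiable_mult fb)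
  finally show ?thesis .
qed

text \<open>
  The second derivatives of \<open>f\<close> cancel by symmetry; only the derivatives of the two fields remain.
\<close>

lemma along_commutator:
  fixes f :: "'a::euclidean_space \<Rightarrow> real"
  assumes U: "open U" "x \<in> U" and f: "smooth_on U f"
    and Y: "Y differentiable (at x)" and Z: "Z differentiable (at x)"
  shows "along Y (along Z f) x - along Z (along Y f) x = fd f x (fd Z x (Y x) - fd Y x (Z x))"
proof -
  have "C_on 2 U f" using f by (simp add: smooth_on_def)
  from second_derivative_symmetric[OF U this, of "Z x" "Y x"]
  show ?thesis
    unfolding along_def[of Y "along Z f"] along_def[of Z "along Y f"] fd_along[OF U f Z] fd_along[OF U f Y]
    by (simp add: linear_diff[OF fd_linear[OF smooth_onD[OF f U(2)]]])
qed

text \<open>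
  The bracket relations of the Berwald frame on an open set of coordinates, separated from
  their geometric origin.
\<close>

locale berwald_relations =
  fixes U :: "'a::euclidean_space set" and S H V :: "'a \<Rightarrow> 'a" and \<rho> I :: "'a \<Rightarrow> real"
  assumes U: "open U"
    and smooth: "smooth_on U S" "smooth_on U H" "smooth_on U V" "smooth_on U \<rho>" "smooth_on U I"
    and SH: "\<And>x. x \<in> U \<Longrightarrow> fd H x (S x) - fd S x (H x) = \<rho> x *\<^sub>R V x"
    and VS: "\<And>x. x \<in> U \<Longrightarrow> fd S x (V x) - fd V x (S x) = H x"
    and HV: "\<And>x. x \<in> U \<Longrightarrow> fd V x (H x) - fd H x (V x) = S x + I x *\<^sub>R H x + along S I x *\<^sub>R V x"
begin

abbreviation "J \<equiv> along S I"

lemmas frame_differentiable = smooth[THEN smooth_onD]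

lemma along_frame_smooth: "smooth_on U f \<Longrightarrow> smooth_on U (along S f)"
  "smooth_on U f \<Longrightarrow> smooth_on U (along H f)"
  "smooth_on U f \<Longrightarrow> smooth_on U (along V f)" for f :: "'a \<Rightarrow> real"
  by (rule along_smooth[OF U]; simp add: smooth)+

lemma commute_S_H:
  fixes f :: "'a \<Rightarrow> real" assumes "smooth_on U f" "x \<in> U"
  shows "along S (along H f) x = along H (along S f) x + \<rho> x * along V f x"
  using along_commutator[OF U assms(2,1) frame_differentiable(1)[OF assms(2)] frame_differentiable(2)[OF assms(2)]] SH[OF assms(2)]
  by (simp add: along_def[of V f] linear_scale[OF fd_linear[OF smooth_onD[OF assms]]])

lemma commute_V_S:
  fixes f :: "'a \<Rightarrow> real" assumes "smooth_on U f" "x \<in> U"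
  shows "along V (along S f) x = along S (along V f) x + along H f x"
  using along_commutator[OF U assms(2,1) frame_differentiable(3)[OF assms(2)] frame_differentiable(1)[OF assms(2)]] VS[OF assms(2)]
  by (simp add: along_def[of H f])

lemma commute_H_V:
  fixes f :: "'a \<Rightarrow> real" assumes "smooth_on U f" "x \<in> U"
  shows "along H (along V f) x = along V (along H f) x + along S f x + I x * along H f x + J x * along V f x"
  using along_commutator[OF U assms(2,1) frame_differentiable(2)[OF assms(2)] frame_differentiable(3)[OF assms(2)]] HV[OF assms(2)]
  by (simp add: along_def[of V f] along_def[of S f] along_def[of H f] linear_add[OF fd_linear[OF smooth_onD[OF assms]]]
    linear_scale[OF fd_linear[OF smooth_onD[OF assms]]])

text \<open>
  The Jacobi identity \<open>[S, [H, V]] + [H, [V, S]] + [V, [S, H]] = 0\<close>, evaluated on a test function: the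
  three commutation rules rewrite every third order term until only multiples of \<open>V(f)\<close> are left.
\<close>

lemma bianchi_on:
  fixes f :: "'a \<Rightarrow> real" assumes f: "smooth_on U f" and x: "x \<in> U"
  shows "(along S J x + I x * \<rho> x + along V \<rho> x) * along V f x = 0"
proof -
  note sms = smooth_on_add[OF U] smooth_on_diff[OF U] smooth_on_mult[OF U] along_frame_smooth smooth f
  have d: "g differentiable (at x)" if "smooth_on U g" for g :: "'a \<Rightarrow> real"
    using smooth_onD[OF that x] .
  have A1: "along S (along H (along V f)) x = along H (along S (along V f)) x + \<rho> x * along V (along V f) x"
    by (rule commute_S_H[OF along_frame_smooth(3)[OF f] x])
  have "along H (along S (along V f)) x = along H (\<lambda>x. along V (along S f) x - along H f x) x"
    by (rule along_cong[OF U x]) (use commute_V_S[OF f] in \<open>auto intro!: sms\<close>)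
  also have "\<dots> = along H (along V (along S f)) x - along H (along H f) x"
    by (intro along_diff d sms)
  finally have A2: "along H (along S (along V f)) x = along H (along V (along S f)) x - along H (along H f) x" .
  have A3: "along H (along V (along S f)) x = along V (along H (along S f)) x + along S (along S f) x
      + I x * along H (along S f) x + J x * along V (along S f) x"
    by (rule commute_H_V[OF along_frame_smooth(1)[OF f] x])
  have "along V (along H (along S f)) x = along V (\<lambda>x. along S (along H f) x - \<rho> x * along V f x) x"
    by (rule along_cong[OF U x]) (use commute_S_H[OF f] in \<open>auto intro!: sms\<close>)
  also have "\<dots> = along V (along S (along H f)) x - (along V \<rho> x * along V f x + \<rho> x * along V (along V f) x)"
    using along_diff[of "along S (along H f)" x "\<lambda>x. \<rho> x * along V f x" V]
      along_mult[of \<rho> x "along V f" V] by (simp add: d sms)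
  finally have A4: "along V (along H (along S f)) x
    = along V (along S (along H f)) x - (along V \<rho> x * along V f x + \<rho> x * along V (along V f) x)" .
  have A5: "along V (along S (along H f)) x = along S (along V (along H f)) x + along H (along H f) x"
    by (rule commute_V_S[OF along_frame_smooth(2)[OF f] x])
  have "along S (along V (along H f)) x
      = along S (\<lambda>x. along H (along V f) x - along S f x - I x * along H f x - J x * along V f x) x"
    by (rule along_cong[OF U x]) (use commute_H_V[OF f] in \<open>auto intro!: sms\<close>)
  also have "\<dots> = along S (\<lambda>x. along H (along V f) x - along S f x - I x * along H f x) x
      - along S (\<lambda>x. J x * along V f x) x"
    by (intro along_diff d sms)
  also have "along S (\<lambda>x. along H (along V f) x - along S f x - I x * along H f x) x
     = along S (\<lambda>x. along H (along V f) x - along S f x) x - along S (\<lambda>x. I x * along H f x) x"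
    by (intro along_diff d sms)
  also have "along S (\<lambda>x. along H (along V f) x - along S f x) x
      = along S (along H (along V f)) x - along S (along S f) x"
    by (intro along_diff d sms)
  also have "along S (\<lambda>x. I x * along H f x) x = J x * along H f x + I x * along S (along H f) x"
    by (intro along_mult d sms)
  also have "along S (\<lambda>x. J x * along V f x) x = along S J x * along V f x + J x * along S (along V f) x"
    by (intro along_mult d sms)
  finally have A6: "along S (along V (along H f)) x = along S (along H (along V f)) x - along S (along S f) x
    - (J x * along H f x + I x * along S (along H f) x) - (along S J x * along V f x + J x * along S (along V f) x)" .
  show ?thesis
    using A1 A2 A3 A4 A5 A6 commute_S_H[OF f x] commute_V_S[OF f x] by algebra
qed

text \<open>
  Some coordinate function has a nonzero derivative along \<open>V\<close>.
\<close>

lemma bianchi: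
  assumes x: "x \<in> U" and "V x \<noteq> 0"
  shows "along S J x + I x * \<rho> x + along V \<rho> x = 0"
proof -
  obtain b where b: "b \<in> Basis" "V x \<bullet> b \<noteq> 0" using assms(2) euclidean_all_zero_iff by blast
  have "smooth_on U (\<lambda>x. x \<bullet> b)"
    by (rule smooth_on_linear[OF U bounded_linear_inner_left smooth_on_ident[OF U]])
  moreover have "along V (\<lambda>x. x \<bullet> b) x = V x \<bullet> b"
    unfolding along_def using fd_bounded_linear[OF bounded_linear_inner_left, of "\<lambda>x. x" x b] by simp
  ultimately show ?thesis using bianchi_on[of "\<lambda>x. x \<bullet> b" x] x b by simp
qed

text \<open>
  The relations for \<open>[V, S]\<close> and \<open>[S, H]\<close>, applied to \<open>I\<close> when \<open>S(I) = 0\<close>. Together they say that \<open>V(I)\<close> solves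
  the Jacobi equation along the integral curves of \<open>S\<close>.
\<close>

lemma landsberg_derivatives:
  assumes J0: "\<And>x. x \<in> U \<Longrightarrow> J x = 0" and x: "x \<in> U"
  shows "along S (along V I) x = - along H I x"
    and "along S (along H I) x = \<rho> x * along V I x"
proof -
  have "along Z J x = along Z (\<lambda>x. 0) x" for Z
    by (rule along_cong[OF U x]) (auto intro!: along_frame_smooth smooth J0)
  then have 0: "along Z J x = 0" for Z by (simp add: along_def)
  show "along S (along V I) x = - along H I x" using commute_V_S[OF smooth(5) x] 0 by simp
  show "along S (along H I) x = \<rho> x * along V I x" using commute_S_H[OF smooth(5) x] 0 by simp
qed

end


section \<open>Finsler identities in one chart\<close>

lemma matrix_inv_inverse:
  fixes M :: "'a::semiring_1^'n^'m"
  assumes "invertible M"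
  shows "M ** matrix_inv M = mat 1" and "matrix_inv M ** M = mat 1"
  using someI_ex[OF assms[unfolded invertible_def]] unfolding matrix_inv_def by blast+

lemma coords_expand:
  fixes z :: coords
  shows "z = (\<Sum>j\<in>UNIV. fst z $ j *\<^sub>R (axis j 1, 0)) + (\<Sum>j\<in>UNIV. snd z $ j *\<^sub>R (0, axis j 1))"
  by (cases z) (simp add: sum_2 vec_eq_iff axis_def forall_2)

lemma fd_coords:
  assumes "f differentiable (at z)"
  shows "fd f z v = (\<Sum>j\<in>UNIV. fst v $ j * dx j f z) + (\<Sum>j\<in>UNIV. snd v $ j * dy j f z)"
  by (subst coords_expand[of v])
    (simp add: linear_add[OF fd_linear[OF assms]] linear_sum[OF fd_linear[OF assms]]
      linear_scale[OF fd_linear[OF assms]] dx_def dy_def del: scaleR_Pair)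

lemma dx_smooth: "smooth_on U f \<Longrightarrow> smooth_on U (dx j f)"
  and dy_smooth: "smooth_on U f \<Longrightarrow> smooth_on U (dy j f)"
  using smooth_on_fd[of U f] by (simp_all add: dx_def[abs_def] dy_def[abs_def])

lemma mixed_partials:
  assumes "open U" "z \<in> U" "smooth_on U f"
  shows "dx i (dy j f) z = dy j (dx i f) z" and "dy i (dy j f) z = dy j (dy i f) z"
  using second_derivative_symmetric[OF assms(1,2)] assms(3)
  by (simp_all add: dx_def[abs_def] dy_def[abs_def] smooth_on_def)

lemma bounded_linear_snd_nth: "bounded_linear (\<lambda>w::coords. snd w $ l)"
  by (rule bounded_linear_compose[OF bounded_linear_vec_nth bounded_linear_snd])

definition fibre_homogeneous :: "coords set \<Rightarrow> nat \<Rightarrow> (coords \<Rightarrow> real) \<Rightarrow> bool" where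
  "fibre_homogeneous U k f \<longleftrightarrow> (\<forall>z\<in>U. \<forall>t>0. f (fst z, t *\<^sub>R snd z) = t ^ k * f z)"

definition conic :: "coords set \<Rightarrow> bool" where
  "conic U \<longleftrightarrow> (\<forall>z\<in>U. \<forall>t>0. (fst z, t *\<^sub>R snd z) \<in> U)"

text \<open>
  Differentiate the homogeneity relation. Written with both directions scaled, one formula gives
  the degrees of all partial derivatives, and it still makes sense in degree \<open>0\<close>.
\<close>

lemma fd_fibre_homogeneous:
  assumes U: "open U" "conic U" "z \<in> U" and f: "smooth_on U f" "fibre_homogeneous U k f" and t: "t > 0"
  shows "fd f (fst z, t *\<^sub>R snd z) (a, t *\<^sub>R b) = t ^ k * fd f z (a, b)"
proof -
  have d: "f differentiable (at (fst z, t *\<^sub>R snd z))" 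
    using U t smooth_onD[OF f(1)] by (auto simp: conic_def)
  have "((\<lambda>w. (fst w, t *\<^sub>R snd w)) has_derivative (\<lambda>v. (fst v, t *\<^sub>R snd v))) (at z)"
    by (auto intro!: derivative_eq_intros)
  from has_derivative_compose[OF this fd_works[OF d]]
  have 1: "fd (\<lambda>w. f (fst w, t *\<^sub>R snd w)) z = (\<lambda>v. fd f (fst z, t *\<^sub>R snd z) (fst v, t *\<^sub>R snd v))"
    by (rule fd_eqI)
  have fz: "f differentiable (at z)" using smooth_onD[OF f(1) U(3)] .
  have "fd (\<lambda>w. t ^ k * f w) z = fd (\<lambda>w. f (fst w, t *\<^sub>R snd w)) z"
    by (rule fd_cong[OF U(1,3)]) (use f(2) t fz in \<open>auto simp: fibre_homogeneous_def\<close>)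
  then show ?thesis using 1 fd_mult[OF differentiable_const fz, of "t ^ k"] by (auto dest: fun_cong[of _ _ "(a,b)"])
qed

lemma homogeneous_dx:
  assumes "open U" "conic U" "smooth_on U f" "fibre_homogeneous U k f"
  shows "fibre_homogeneous U k (dx j f)"
  using fd_fibre_homogeneous[OF assms(1,2) _ assms(3,4), of _ _ "axis j 1" 0]
  by (auto simp: fibre_homogeneous_def dx_def)

lemma homogeneous_dy:
  assumes "open U" "conic U" "smooth_on U f" "fibre_homogeneous U (Suc k) f"
  shows "fibre_homogeneous U k (dy j f)"
  unfolding fibre_homogeneous_def
proof (intro ballI allI impI)
  fix z and t :: real assume z: "z \<in> U" and t: "t > 0"
  have zt: "(fst z, t *\<^sub>R snd z) \<in> U" using assms(2) z t by (auto simp: conic_def)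
  have "fd f (fst z, t *\<^sub>R snd z) (0, t *\<^sub>R axis j 1) = t * dy j f (fst z, t *\<^sub>R snd z)"
    using linear_scale[OF fd_linear[OF smooth_onD[OF assms(3) zt]], of t "(0, axis j 1)"] by (simp add: dy_def)
  then show "dy j f (fst z, t *\<^sub>R snd z) = t ^ k * dy j f z"
    using fd_fibre_homogeneous[OF assms(1,2) z assms(3,4) t, of 0 "axis j 1"] t by (simp add: dy_def)
qed

lemma euler:
  assumes "conic U" "z \<in> U" "smooth_on U f" "fibre_homogeneous U k f"
  shows "fd f z (0, snd z) = k * f z"
proof -
  have d: "f differentiable (at ((\<lambda>t. (fst z, t *\<^sub>R snd z)) 1))" using smooth_onD[OF assms(3,2)] by simp
  have "((\<lambda>t. (fst z, t *\<^sub>R snd z)) has_derivative (\<lambda>t. (0, t *\<^sub>R snd z))) (at 1)"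
    by (auto intro!: derivative_eq_intros)
  from has_derivative_compose[OF this fd_works[OF d]]
  have 1: "fd (\<lambda>t. f (fst z, t *\<^sub>R snd z)) 1 = (\<lambda>t. fd f z (0, t *\<^sub>R snd z))"
    using fd_eqI by simp
  have 2: "((\<lambda>t. t ^ k * f z) has_derivative (\<lambda>t. k * t * f z)) (at 1)"
    by (auto intro!: derivative_eq_intros)
  have "fd (\<lambda>t. t ^ k * f z) 1 = fd (\<lambda>t. f (fst z, t *\<^sub>R snd z)) 1"
    by (rule fd_cong[of "{0<..}"]) (use assms 2 in \<open>auto simp: fibre_homogeneous_def differentiable_def\<close>)
  then show ?thesis using 1 fd_eqI[OF 2] by (auto dest: fun_cong[of _ _ 1])
qed

lemma euler_dy:
  assumes "conic U" "z \<in> U" "smooth_on U f" "fibre_homogeneous U k f"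
  shows "(\<Sum>j\<in>UNIV. snd z $ j * dy j f z) = k * f z"
  using euler[OF assms] fd_coords[OF smooth_onD[OF assms(3,2)], of "(0, snd z)"] by simp

text \<open>
  The coordinate expression of \<open>F\<^sup>2\<close> in a single chart. Everything up to the Chern-Rund
  coefficients is determined by it.
\<close>

locale finsler_chart =
  fixes A :: "'a chart set" and F :: "'a tvec \<Rightarrow> real" and c :: "'a chart"
  assumes chart_image_open: "open (snd c ` fst c)"
    and L_smooth: "smooth_on (slit_dom c) (F2 A F c)"
    and L_homogeneous: "fibre_homogeneous (slit_dom c) 2 (F2 A F c)"
    and metric_rank: "\<And>z. z \<in> slit_dom c \<Longrightarrow> rank (metric A F c z) = 2"
begin

abbreviation "U \<equiv> slit_dom c"
abbreviation "L \<equiv> F2 A F c"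
abbreviation "g i j z \<equiv> metric A F c z $ i $ j"
abbreviation "G i z \<equiv> spray_coeff A F c z $ i"
abbreviation "N \<equiv> nonlinear_conn A F c"
abbreviation "S \<equiv> geodesic_spray A F c"

lemma U_open: "open U" unfolding slit_dom_def by (intro open_Times chart_image_open) auto

lemma U_conic: "conic U" by (auto simp: conic_def slit_dom_def)

lemma g_eq: "g i j = (\<lambda>z. (1/2) * dy i (dy j L) z)" by (simp add: metric_def)

lemma g_at: "g i j z = (1/2) * dy i (dy j L) z" by (simp add: metric_def)

lemma L_partials_smooth: "smooth_on U L" "smooth_on U (dx i L)" "smooth_on U (dy i L)" "smooth_on U (dy i (dy j L))"
    "smooth_on U (dx i (dy j L))"
  by (intro dx_smooth dy_smooth L_smooth)+

lemma g_smooth: "smooth_on U (g i j)"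
  unfolding g_eq by (intro smooth_on_mult U_open smooth_on_const L_partials_smooth)

lemma g_sym: "z \<in> U \<Longrightarrow> g i j z = g j i z"
  using mixed_partials(2)[OF U_open _ L_smooth] by (simp add: g_at)

lemma g_invertible: "z \<in> U \<Longrightarrow> invertible (metric A F c z)"
  using metric_rank[of z] det_eq_0_rank[of "metric A F c z"] by (simp add: invertible_det_nz)

lemma L_dy_homogeneous: "fibre_homogeneous U 1 (dy i L)"
  by (rule homogeneous_dy[OF U_open U_conic L_smooth]) (use L_homogeneous in \<open>simp add: numeral_2_eq_2\<close>)

lemma L_dydy_homogeneous: "fibre_homogeneous U 0 (dy j (dy i L))"
  by (rule homogeneous_dy[OF U_open U_conic L_partials_smooth(3)]) (use L_dy_homogeneous in simp)

lemma g_homogeneous: "fibre_homogeneous U 0 (g i j)"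
  using L_dydy_homogeneous[of i j] by (simp add: g_at fibre_homogeneous_def)

lemma metric_homogeneous: "z \<in> U \<Longrightarrow> t > 0 \<Longrightarrow> metric A F c (fst z, t *\<^sub>R snd z) = metric A F c z"
  using g_homogeneous by (simp add: fibre_homogeneous_def vec_eq_iff)

lemma L_euler: "z \<in> U \<Longrightarrow> (\<Sum>l\<in>UNIV. snd z $ l * dy l L z) = 2 * L z"
  using euler_dy[OF U_conic _ L_smooth L_homogeneous] by simp

lemma g_euler: "z \<in> U \<Longrightarrow> (\<Sum>j\<in>UNIV. snd z $ j * g j l z) = (1/2) * dy l L z"
  using euler_dy[OF U_conic _ L_partials_smooth(3) L_dy_homogeneous, of z l]
  by (simp add: g_at sum_2 algebra_simps)

lemma metric_mult_y: "z \<in> U \<Longrightarrow> metric A F c z *v snd z = (\<chi> l. (1/2) * dy l L z)"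
  using g_euler[of z] g_sym[of z]
  by (simp add: matrix_vector_mult_def vec_eq_iff mult.commute)

lemma g_yy: "z \<in> U \<Longrightarrow> snd z \<bullet> (metric A F c z *v snd z) = L z"
  using L_euler[of z] by (simp add: metric_mult_y inner_vec_def sum_2 algebra_simps)

text \<open>The spray equation.\<close>

lemma spray_solves:
  assumes "z \<in> U"
  shows "4 * (metric A F c z *v spray_coeff A F c z) $ l
    = (\<Sum>k\<in>UNIV. snd z $ k * dx k (dy l L) z) - dx l L z"
  using matrix_inv_inverse(1)[OF g_invertible[OF assms]]
  by (simp add: spray_coeff_def matrix_vector_mult_scaleR matrix_vector_mul_assoc)

text \<open>
  The Euler-Lagrange equations of \<open>F\<^sup>2\<close>, which characterise the spray without inverting the metric.
\<close>

lemma S_dy_L: "z \<in> U \<Longrightarrow> fd (dy l L) z (S z) = dx l L z"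
  using spray_solves[of z l] g_sym[of z 1 2] fd_coords[OF smooth_onD[OF L_partials_smooth(3)], of z l "S z"]
  by (cases "l = 1"; simp add: geodesic_spray_def matrix_vector_mult_def sum_2 g_at algebra_simps)
   (use exhaust_2[of l] in \<open>auto simp: algebra_simps\<close>)

text \<open>
  Cramer's rule expresses the coefficients rationally in smooth functions.
\<close>

lemma spray_smooth: "smooth_on U (spray_coeff A F c)"
proof -
  define b where "b l z = (1/4) * ((\<Sum>k\<in>UNIV. snd z $ k * dx k (dy l L) z) - dx l L z)" for l z
  have b: "smooth_on U (b l)" for l
    unfolding b_def
    by (intro smooth_on_mult smooth_on_const smooth_on_diff smooth_on_sum U_open L_partials_smooth
       smooth_on_nth smooth_on_snd smooth_on_ident)
  have nz: "det (metric A F c z) \<noteq> 0" if "z \<in> U" for z using g_invertible[OF that] by (simp add: invertible_det_nz)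
  have "(metric A F c z *v spray_coeff A F c z) $ l = b l z" if "z \<in> U" for z l
    unfolding b_def spray_solves[OF that, symmetric] by simp
  then have "metric A F c z *v spray_coeff A F c z = (\<chi> l. b l z)" if "z \<in> U" for z
    using that by (simp add: vec_eq_iff)
  then have 1: "spray_coeff A F c z = (\<chi> k. det (\<chi> i j. if j = k then (\<chi> l. b l z) $ i else g i j z) / det (metric A F c z))" if "z \<in> U" for z
    using that cramer[OF nz[OF that], of "spray_coeff A F c z" "\<chi> l. b l z"] by blast
  have eq: "(\<chi> k. det (\<chi> i j. if j = k then b i z else g i j z) * inverse (det (metric A F c z))) = spray_coeff A F c z"
    if "z \<in> U" for z unfolding 1[OF that] divide_inverse vec_lambda_beta ..
  show ?thesis
  proof (rule smooth_on_cong[OF U_open eq])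
    have e: "smooth_on U (\<lambda>z. if P then b i z else g i j z)" for P i j
      by (cases P) (simp_all only: if_True if_False b g_smooth)
    show "smooth_on U (\<lambda>z. \<chi> k. det (\<chi> i j. if j = k then b i z else g i j z) * inverse (det (metric A F c z)))"
      unfolding det_2 vec_lambda_beta
      by (intro smooth_on_vec smooth_on_mult smooth_on_inverse smooth_on_diff U_open g_smooth e nz[unfolded det_2])
  qed
qed

lemma G_smooth: "smooth_on U (G i)" by (rule smooth_on_nth[OF U_open spray_smooth])

lemma S_smooth: "smooth_on U S"
  unfolding geodesic_spray_def
  by (intro smooth_on_Pair smooth_on_scaleR smooth_on_const smooth_on_snd smooth_on_ident spray_smooth U_open)

lemma spray_homogeneous: "fibre_homogeneous U 2 (G i)"
proof -
  have "spray_coeff A F c (fst z, t *\<^sub>R snd z) = t\<^sup>2 *\<^sub>R spray_coeff A F c z" if "z \<in> U" "t > 0" for z t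
  proof -
    have "dx k (dy l L) (fst z, t *\<^sub>R snd z) = t * dx k (dy l L) z" for k l
      using homogeneous_dx[OF U_open U_conic L_partials_smooth(3) L_dy_homogeneous] that by (simp add: fibre_homogeneous_def)
    moreover have "dx l L (fst z, t *\<^sub>R snd z) = t\<^sup>2 * dx l L z" for l
      using homogeneous_dx[OF U_open U_conic L_smooth L_homogeneous] that by (simp add: fibre_homogeneous_def)
    ultimately have "(\<chi> l. (\<Sum>k\<in>UNIV. (t *\<^sub>R snd z) $ k * dx k (dy l L) (fst z, t *\<^sub>R snd z)) - dx l L (fst z, t *\<^sub>R snd z))
        = t\<^sup>2 *\<^sub>R (\<chi> l. (\<Sum>k\<in>UNIV. snd z $ k * dx k (dy l L) z) - dx l L z)"
      by (simp add: vec_eq_iff power2_eq_square algebra_simps sum_distrib_left)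
    then show ?thesis
      by (simp add: spray_coeff_def metric_homogeneous[OF that] matrix_vector_mult_scaleR)
  qed
  then show ?thesis by (simp add: fibre_homogeneous_def)
qed

lemma N_euler: "z \<in> U \<Longrightarrow> (\<Sum>j\<in>UNIV. snd z $ j * N m j z) = 2 * G m z"
  using euler_dy[OF U_conic _ G_smooth spray_homogeneous] by (simp add: nonlinear_conn_def)

text \<open>
  By Euler's relation \<open>2 L = y\<^sup>l \<partial>L/\<partial>y\<^sup>l\<close>. The Euler-Lagrange equations show that the derivative of
  the right hand side along \<open>S\<close> is \<open>S(L)\<close> itself, so \<open>2 S(L) = S(L)\<close>.
\<close>

lemma S_L: assumes "z \<in> U" shows "fd L z (S z) = 0"
proof -
  have 1: "fd (\<lambda>w. \<Sum>l\<in>UNIV. snd w $ l * dy l L w) z (S z) = fd (\<lambda>w. 2 * L w) z (S z)"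
    by (rule fun_cong[OF fd_cong[OF U_open assms L_euler]])
     (auto intro!: smooth_onD[OF _ assms] smooth_on_sum smooth_on_mult L_partials_smooth U_open smooth_on_nth smooth_on_snd smooth_on_ident)
  have dl: "dy l L differentiable (at z)" for l using smooth_onD[OF L_partials_smooth(3) assms] .
  have ds: "(\<lambda>w::coords. snd w $ l) differentiable (at z)" and Ds: "fd (\<lambda>w::coords. snd w $ l) z v = snd v $ l" for l v
    by (rule bounded_linear_imp_differentiable[OF bounded_linear_snd_nth])
      (simp add: fd_bounded_linear[OF bounded_linear_snd_nth])
  have "fd (\<lambda>w. \<Sum>l\<in>UNIV. snd w $ l * dy l L w) z (S z)
     = (\<Sum>l\<in>UNIV. snd z $ l * dx l L z + snd (S z) $ l * dy l L z)"
    by (subst fd_sum) (auto intro!: differentiable_mult ds dl simp: fd_mult[OF ds dl] Ds S_dy_L[OF assms])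
  also have "\<dots> = fd L z (S z)"
    using fd_coords[OF smooth_onD[OF L_smooth assms], of "S z"] by (simp add: geodesic_spray_def sum_2)
  finally show ?thesis
    using 1 fd_mult[OF differentiable_const smooth_onD[OF L_smooth assms], of 2 "S z"] by simp
qed

lemma fd_S:
  assumes "z \<in> U"
  shows "fd S z v = (snd v, (- 2) *\<^sub>R fd (spray_coeff A F c) z v)"
proof -
  have "(S has_derivative (\<lambda>v. (snd v, (- 2) *\<^sub>R fd (spray_coeff A F c) z v))) (at z)"
    unfolding geodesic_spray_def
    by (intro has_derivative_Pair has_derivative_scaleR_right has_derivative_snd has_derivative_ident
       fd_works smooth_onD[OF spray_smooth assms])
  then show ?thesis by (simp only: fd_eqI)
qed

lemma fd_spray_nth: "z \<in> U \<Longrightarrow> fd (spray_coeff A F c) z v $ i = fd (G i) z v"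
  using fd_bounded_linear[OF bounded_linear_vec_nth smooth_onD[OF spray_smooth, of z], of i v] by simp

lemma fd_spray_vertical:
  "z \<in> U \<Longrightarrow> fd (spray_coeff A F c) z (0, a) = (\<chi> i. \<Sum>j\<in>UNIV. N i j z * a $ j)"
  using fd_coords[OF smooth_onD[OF G_smooth], of z _ "(0,a)"]
  by (simp add: vec_eq_iff fd_spray_nth nonlinear_conn_def mult.commute)

lemma fd_g: "z \<in> U \<Longrightarrow> fd (g i j) z v = (1/2) * fd (dy i (dy j L)) z v"
  unfolding g_eq using fd_mult[OF differentiable_const smooth_onD[OF L_partials_smooth(4)], of z "1/2" i j v] by simp

text \<open>
  Differentiate the Euler-Lagrange equation \<open>S(\<partial>L/\<partial>y\<^sup>l) = \<partial>L/\<partial>x\<^sup>l\<close> in the direction of \<open>y\<^sup>k\<close>.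
\<close>

lemma S_g:
  assumes z: "z \<in> U"
  shows "fd (g l k) z (S z) = (1/2) * (dx l (dy k L) z - dx k (dy l L) z) + 2 * (\<Sum>m\<in>UNIV. N m k z * g m l z)"
proof -
  let ?v = "(0, axis k 1) :: coords"
  have 1: "fd (along S (dy l L)) z ?v = fd (dx l L) z ?v"
    by (rule fun_cong[OF fd_cong[OF U_open z]])
      (use S_dy_L smooth_onD[OF along_smooth[OF U_open L_partials_smooth(3) S_smooth] z] in \<open>auto simp: along_def\<close>)
  have 2: "fd (along S (dy l L)) z ?v = fd (\<lambda>w. fd (dy l L) w (S z)) z ?v + fd (dy l L) z (fd S z ?v)"
    by (rule fd_along[OF U_open z L_partials_smooth(3) smooth_onD[OF S_smooth z]])
  have 3: "fd (\<lambda>w. fd (dy l L) w (S z)) z ?v = fd (dy k (dy l L)) z (S z)"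
    using second_derivative_symmetric[OF U_open z, of "dy l L" "S z" ?v] L_partials_smooth(3)[of l]
    by (simp add: smooth_on_def dy_def[abs_def])
  have 4: "fd (g l k) z (S z) = (1/2) * fd (dy k (dy l L)) z (S z)"
  proof -
    have "fd (g l k) z = fd (g k l) z"
      by (rule fd_cong[OF U_open z g_sym smooth_onD[OF g_smooth z]])
    then show ?thesis by (simp add: fd_g[OF z])
  qed
  have 5: "fd (dy l L) z (fd S z ?v) = dx k (dy l L) z - 4 * (\<Sum>m\<in>UNIV. N m k z * g m l z)"
    using exhaust_2[of k]
    by (auto simp: fd_S[OF z] fd_coords[OF smooth_onD[OF L_partials_smooth(3) z]] fd_spray_vertical[OF z] sum_2 axis_def g_at algebra_simps)
  have 6: "fd (dx l L) z ?v = dx l (dy k L) z"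
    using mixed_partials(1)[OF U_open z L_smooth, of l k] by (simp add: dy_def)
  show ?thesis unfolding 4 3[symmetric] using 1 2 5 6 by (simp add: field_simps)
qed

lemma y_dx_g: assumes z: "z \<in> U" shows "(\<Sum>j\<in>UNIV. snd z $ j * dx k (g j l) z) = (1/2) * dx k (dy l L) z"
proof -
  have e: "(\<Sum>j\<in>UNIV. snd z $ j * dy j (dx k (dy l L)) z) = dx k (dy l L) z"
    using euler_dy[OF U_conic z L_partials_smooth(5) homogeneous_dx[OF U_open U_conic L_partials_smooth(3) L_dy_homogeneous]] by simp
  have "dy j (dx k (dy l L)) z = 2 * dx k (g j l) z" for j
    unfolding mixed_partials(1)[OF U_open z L_partials_smooth(3), symmetric] by (simp add: dx_def fd_g[OF z])
  then show ?thesis using e by (simp add: sum_2 algebra_simps)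
qed

lemma y_dy_g: assumes z: "z \<in> U" shows "(\<Sum>j\<in>UNIV. snd z $ j * dy m (g j l) z) = 0"
proof -
  have e: "(\<Sum>j\<in>UNIV. snd z $ j * dy j (dy m (dy l L)) z) = 0"
    using euler_dy[OF U_conic z L_partials_smooth(4) L_dydy_homogeneous] by simp
  have "dy j (dy m (dy l L)) z = 2 * dy m (g j l) z" for j
    using mixed_partials(2)[OF U_open z L_partials_smooth(3), of j m l] fd_g[OF z, of j l "(0, axis m 1)"]
    by (simp add: dy_def[of m "dy j (dy l L)"] dy_def[of m "g j l"])
  then show ?thesis using e by (simp add: sum_2 algebra_simps)
qed

text \<open>
  With reference vector \<open>y\<close>, the Chern-Rund connection acts in the direction \<open>y\<close> through the
  nonlinear connection. In the Koszul formula contracted with \<open>y\<close>, the first term is \<open>S(g\<^sub>l\<^sub>k)\<close> and the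
  two others are the mixed derivatives \<open>\<partial>\<^sup>2L/\<partial>x\<partial>y\<close>, which cancel those in \<open>S_g\<close>.
\<close>

lemma chern_rund_reference:
  assumes z: "z \<in> U"
  shows "(\<Sum>j\<in>UNIV. chern_rund A F c i j k z * snd z $ j) = N i k z"
proof -
  have h: "(\<Sum>j\<in>UNIV. snd z $ j * hderiv A F c k (g j l) z) = (1/2) * dx k (dy l L) z" for k l
    using y_dx_g[OF z, of k l] y_dy_g[OF z, of 1 l] y_dy_g[OF z, of 2 l] unfolding hderiv_def sum_2
    by algebra
  have s: "(\<Sum>j\<in>UNIV. snd z $ j * hderiv A F c j (g l k) z) = fd (g l k) z (S z)" for l
    using N_euler[OF z, of 1] N_euler[OF z, of 2] fd_coords[OF smooth_onD[OF g_smooth z], of l k "S z"]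
    unfolding hderiv_def sum_2 by (simp add: geodesic_spray_def) algebra
  define r where "r l j = hderiv A F c j (g l k) z + hderiv A F c k (g j l) z - hderiv A F c l (g j k) z" for l j
  have r: "(\<Sum>j\<in>UNIV. snd z $ j * r l j) = 2 * (\<Sum>m\<in>UNIV. N m k z * g m l z)" for l
    using s[of l] h[of k l] h[of l k] S_g[OF z, of l k] unfolding r_def sum_2 by algebra
  let ?M = "matrix_inv (metric A F c z)"
  have "(\<Sum>j\<in>UNIV. chern_rund A F c i j k z * snd z $ j) = (1/2) * (\<Sum>l\<in>UNIV. ?M $ i $ l * (\<Sum>j\<in>UNIV. snd z $ j * r l j))"
    unfolding chern_rund_def r_def[symmetric] sum_2 by algebra
  also have "\<dots> = (\<Sum>m\<in>UNIV. (\<Sum>l\<in>UNIV. ?M $ i $ l * g l m z) * N m k z)"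
    unfolding r sum_2 using g_sym[OF z, of 1 2] by (simp add: algebra_simps)
  also have "\<dots> = (\<Sum>m\<in>UNIV. (?M ** metric A F c z) $ i $ m * N m k z)"
    by (simp add: matrix_matrix_mult_def)
  also have "\<dots> = N i k z"
    using matrix_inv_inverse(2)[OF g_invertible[OF z]] exhaust_2[of i] by (auto simp: mat_def sum_2)
  finally show ?thesis .
qed

end


section \<open>Transition maps and tangent vectors\<close>

lemma bounded_linear_fd: "f differentiable (at x) \<Longrightarrow> bounded_linear (fd f x)"
  using fd_works has_derivative_bounded_linear by blast

locale atlas_surface =
  fixes X :: "'a topology" and A :: "'a chart set"
  assumes surface: "smooth_surface X A"
begin

abbreviation "TT \<equiv> (tangent_transition :: 'a chart \<Rightarrow> 'a chart \<Rightarrow> coords \<Rightarrow> coords)"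

lemma chart: assumes "c \<in> A"
  shows "openin X (fst c)" and "open (snd c ` fst c)"
    and "homeomorphic_map (subtopology X (fst c)) (top_of_set (snd c ` fst c)) (snd c)"
  using surface assms by (auto simp: smooth_surface_def is_chart_def)

lemma chart_topspace: "c \<in> A \<Longrightarrow> topspace (subtopology X (fst c)) = fst c"
  using openin_subset[OF chart(1)[of c]] by (simp add: Int_absorb1)

lemma chart_inj: "c \<in> A \<Longrightarrow> inj_on (snd c) (fst c)"
  using homeomorphic_imp_injective_map[OF chart(3)] chart_topspace by metis

lemma chart_inv [simp]: "c \<in> A \<Longrightarrow> p \<in> fst c \<Longrightarrow> inv_into (fst c) (snd c) (snd c p) = p"
  using chart_inj by simp

lemma chart_cover: "p \<in> topspace X \<Longrightarrow> \<exists>c\<in>A. p \<in> fst c"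
  using surface by (auto simp: smooth_surface_def)

lemma chart_subset: "c \<in> A \<Longrightarrow> fst c \<subseteq> topspace X"
  using openin_subset[OF chart(1)] .

lemma chart_open_image:
  assumes "c \<in> A" "openin X W" "W \<subseteq> fst c"
  shows "open (snd c ` W)"
proof -
  have "openin (subtopology X (fst c)) W"
    using assms by (simp add: openin_open_subtopology[OF chart(1)])
  then have "openin (top_of_set (snd c ` fst c)) (snd c ` W)"
    using homeomorphic_imp_open_map[OF chart(3)[OF assms(1)]] by (auto simp: open_map_def)
  then show ?thesis using openin_open_eq[OF chart(2)[OF assms(1)]] by blast
qed

lemma chart_open_vimage:
  assumes "c \<in> A" "open W"
  shows "openin X {p \<in> fst c. snd c p \<in> W}"
proof -
  have "continuous_map (subtopology X (fst c)) (top_of_set (snd c ` fst c)) (snd c)"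
    using homeomorphic_imp_continuous_map[OF chart(3)[OF assms(1)]] .
  then have "continuous_map (subtopology X (fst c)) euclidean (snd c)"
    by (simp add: continuous_map_in_subtopology)
  from openin_continuous_map_preimage[OF this, of W]
  have "openin (subtopology X (fst c)) {p \<in> fst c. snd c p \<in> W}"
    unfolding chart_topspace[OF assms(1)] using assms(2) by simp
  then show ?thesis using openin_open_subtopology[OF chart(1)[OF assms(1)]] by blast
qed

lemma overlap_open: "c \<in> A \<Longrightarrow> d \<in> A \<Longrightarrow> open (overlap c d)"
  unfolding overlap_def by (rule chart_open_image) (auto intro: chart)

lemma transition_eq: "c \<in> A \<Longrightarrow> p \<in> fst c \<Longrightarrow> transition c d (snd c p) = snd d p"
  by (simp add: transition_def)

lemma transition_smooth: "c \<in> A \<Longrightarrow> d \<in> A \<Longrightarrow> smooth_on (overlap c d) (transition c d)"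
  using surface by (auto simp: smooth_surface_def)

lemma transition_diffble:
  assumes "c \<in> A" "d \<in> A" "p \<in> fst c" "p \<in> fst d"
  shows "transition c d differentiable (at (snd c p))"
  using smooth_onD[OF transition_smooth[OF assms(1,2)]] assms by (auto simp: overlap_def)

lemma transition_cocycle:
  assumes "c \<in> A" "d \<in> A" "e \<in> A" "p \<in> fst c" "p \<in> fst d" "p \<in> fst e"
  shows "fd (transition c e) (snd c p) v = fd (transition d e) (snd d p) (fd (transition c d) (snd c p) v)"
proof -
  let ?W = "snd c ` (fst c \<inter> fst d \<inter> fst e)"
  have W: "open ?W" by (intro chart_open_image openin_Int chart(1) assms) auto
  have d1: "transition d e differentiable (at (transition c d (snd c p)))"
    using transition_diffble assms by (simp add: transition_eq)
  have d2: "(\<lambda>x. transition d e (transition c d x)) differentiable (at (snd c p))"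
    using differentiable_chain_at[OF transition_diffble[OF assms(1,2,4,5)] d1] by (simp add: o_def)
  have "fd (\<lambda>x. transition d e (transition c d x)) (snd c p) = fd (transition c e) (snd c p)"
    by (rule fd_cong[OF W _ _ d2]) (use assms in \<open>auto simp: transition_eq\<close>)
  then show ?thesis
    using fd_compose[OF transition_diffble[OF assms(1,2,4,5)] d1, of v] assms by (simp add: transition_eq)
qed

lemma transition_self:
  assumes "c \<in> A" "p \<in> fst c"
  shows "fd (transition c c) (snd c p) v = v"
proof -
  have "fd (\<lambda>x. x) (snd c p) = fd (transition c c) (snd c p)"
    by (rule fd_cong[OF chart(2)[OF assms(1)]]) (use assms in \<open>auto simp: transition_eq\<close>)
  then show ?thesis by (simp add: fun_eq_iff)
qed

lemma transition_inverse:
  assumes "c \<in> A" "d \<in> A" "p \<in> fst c" "p \<in> fst d"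
  shows "fd (transition d c) (snd d p) (fd (transition c d) (snd c p) v) = v"
  using transition_cocycle[of c d c p v] transition_self[of c p v] assms by simp

lemma transition_nonzero:
  assumes "c \<in> A" "d \<in> A" "p \<in> fst c" "p \<in> fst d" "v \<noteq> 0"
  shows "fd (transition c d) (snd c p) v \<noteq> 0"
  using transition_inverse[OF assms(1-4), of v] assms(5)
    linear_0[OF fd_linear[OF transition_diffble[OF assms(2,1,4,3)]]] by auto

lemma tvec_eq:
  assumes "c \<in> A" "p \<in> fst c"
  shows "tvec A c (snd c p, y) =
    (p, \<lambda>d. if d \<in> A \<and> p \<in> fst d then fd (transition c d) (snd c p) y else 0)"
  using assms by (simp add: tvec_def Let_def)

lemma tvec_transition:
  assumes "c \<in> A" "d \<in> A" "p \<in> fst c" "p \<in> fst d"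
  shows "tvec A d (snd d p, fd (transition c d) (snd c p) y) = tvec A c (snd c p, y)"
  using assms by (simp add: tvec_eq fun_eq_iff transition_cocycle[of c d, symmetric])

lemma TT_eq:
  assumes "c \<in> A" "p \<in> fst c"
  shows "TT c d (snd c p, y) = (snd d p, fd (transition c d) (snd c p) y)"
  using assms by (simp add: tangent_transition_def transition_eq)

lemma tvec_TT:
  assumes "c \<in> A" "d \<in> A" "z \<in> overlap c d \<times> UNIV"
  shows "tvec A d (TT c d z) = tvec A c z"
  using assms by (cases z) (auto simp: overlap_def TT_eq tvec_transition)

lemma TT_slit:
  assumes "c \<in> A" "d \<in> A" "z \<in> overlap c d \<times> (- {0})"
  shows "TT c d z \<in> overlap d c \<times> (- {0})"
proof -
  obtain p y where p: "p \<in> fst c" "p \<in> fst d" "y \<noteq> 0" "z = (snd c p, y)"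
    using assms(3) by (auto simp: overlap_def)
  show ?thesis
    unfolding p(4) TT_eq[OF assms(1) p(1)] overlap_def
    using p transition_nonzero[OF assms(1,2) p(1-3)] by simp
qed

lemma TT_inverse:
  assumes "c \<in> A" "d \<in> A" "z \<in> overlap c d \<times> UNIV"
  shows "TT d c (TT c d z) = z"
  using assms by (cases z) (auto simp: overlap_def TT_eq transition_inverse)

lemma overlap_slit: "overlap c d \<times> (- {0}) \<subseteq> slit_dom c"
  by (auto simp: overlap_def slit_dom_def)

lemma slit_open: "c \<in> A \<Longrightarrow> open (slit_dom c)"
  unfolding slit_dom_def using chart(2) by (intro open_Times) auto

lemma overlap_slit_open: "c \<in> A \<Longrightarrow> d \<in> A \<Longrightarrow> open (overlap c d \<times> (- {0 :: real^2}))"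
  by (intro open_Times overlap_open) auto

lemma TT_smooth:
  assumes "c \<in> A" "d \<in> A"
  shows "smooth_on (overlap c d \<times> (- {0})) (TT c d)"
proof -
  let ?U = "overlap c d \<times> (- {0}) :: coords set"
  have U: "open ?U" using overlap_slit_open[OF assms] .
  have f: "smooth_on ?U fst" "smooth_on ?U snd"
    using smooth_on_fst[OF U smooth_on_ident[OF U]] smooth_on_snd[OF U smooth_on_ident[OF U]] by simp_all
  have t: "smooth_on ?U (\<lambda>z. transition c d (fst z))"
    by (rule smooth_on_compose[OF U overlap_open[OF assms] _ f(1) transition_smooth[OF assms]]) auto
  have "smooth_on ?U (\<lambda>z. \<Sum>b\<in>Basis. (snd z \<bullet> b) *\<^sub>R fd (transition c d) (fst z) b)"
  proof (intro smooth_on_sum[OF U] smooth_on_scaleR[OF U] smooth_on_linear[OF U bounded_linear_inner_left] f)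
    show "smooth_on ?U (\<lambda>z. fd (transition c d) (fst z) b)" for b
      by (rule smooth_on_compose[OF U overlap_open[OF assms] _ f(1) smooth_on_fd[OF transition_smooth[OF assms]]]) auto
  qed
  then have "smooth_on ?U (\<lambda>z. fd (transition c d) (fst z) (snd z))"
    by (rule smooth_on_cong[OF U, rotated])
      (use fd_expand[OF smooth_onD[OF transition_smooth[OF assms]], symmetric] in auto)
  from smooth_on_Pair[OF U t this] show ?thesis
    by (simp add: tangent_transition_def case_prod_unfold)
qed

text \<open>
  The horizontal part of a vector on the tangent bundle transforms by the differential of the
  transition map alone.
\<close>

lemma fst_fd_TT:
  assumes "c \<in> A" "d \<in> A" "z \<in> overlap c d \<times> (- {0})"
  shows "fst (fd (TT c d) z v) = fd (transition c d) (fst z) (fst v)"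
proof -
  have d: "TT c d differentiable (at z)" using smooth_onD[OF TT_smooth[OF assms(1,2)] assms(3)] .
  have "fst (fd (TT c d) z v) = fd (\<lambda>w. fst (TT c d w)) z v"
    by (rule fd_bounded_linear[OF bounded_linear_fst d, symmetric])
  also have "(\<lambda>w. fst (TT c d w)) = (\<lambda>w. transition c d (fst w))"
    by (simp add: tangent_transition_def case_prod_unfold)
  also have "fd (\<lambda>w. transition c d (fst w)) z v = fd (transition c d) (fst z) (fd fst z v)"
    by (rule fd_compose) (use assms(3) smooth_onD[OF transition_smooth[OF assms(1,2)]] in \<open>auto intro: bounded_linear_imp_differentiable bounded_linear_fst\<close>)
  also have "fd fst z v = fst v"
    using fd_bounded_linear[OF bounded_linear_fst, of "\<lambda>w. w"] by simp
  finally show ?thesis .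
qed

lemma tvec_tangent:
  assumes "c \<in> A" "p \<in> fst c"
  shows "tvec A c (snd c p, y) \<in> tangent_bundle X A"
    and "y \<noteq> 0 \<Longrightarrow> tvec A c (snd c p, y) \<in> slit_bundle X A"
proof -
  have "p \<in> topspace X" using assms chart_subset[OF assms(1)] by blast
  moreover have "(\<lambda>d. if d \<in> A \<and> p \<in> fst d then fd (transition c d) (snd c p) y else 0) \<in> tangent_space A p"
    unfolding tangent_space_def
  proof (intro CollectI conjI ballI impI allI)
    fix d e assume "d \<in> A" "e \<in> A" "p \<in> fst d \<inter> fst e"
    then show "(if e \<in> A \<and> p \<in> fst e then fd (transition c e) (snd c p) y else 0) =
       fd (transition d e) (snd d p) (if d \<in> A \<and> p \<in> fst d then fd (transition c d) (snd c p) y else 0)"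
      using transition_cocycle[OF assms(1) _ _ assms(2), of d e y] by simp
  qed auto
  ultimately show 1: "tvec A c (snd c p, y) \<in> tangent_bundle X A"
    unfolding tvec_eq[OF assms] tangent_bundle_def by blast
  assume y: "y \<noteq> 0"
  have "snd (tvec A c (snd c p, y)) c = y"
    using assms transition_self[OF assms, of y] by (simp add: tvec_eq)
  then have "snd (tvec A c (snd c p, y)) \<noteq> (\<lambda>_. 0)" using y by metis
  then show "tvec A c (snd c p, y) \<in> slit_bundle X A"
    using 1 unfolding slit_bundle_def by blast
qed

lemma tvec_scale:
  assumes "c \<in> A" "p \<in> fst c"
  shows "tvec A c (snd c p, t *\<^sub>R y) = (p, \<lambda>d. t *\<^sub>R snd (tvec A c (snd c p, y)) d)"
  using assms by (simp add: tvec_eq fun_eq_iff linear_scale[OF fd_linear[OF transition_diffble[OF assms(1) _ assms(2)]]])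

lemma tvec_zero:
  assumes "c \<in> A" "p \<in> fst c"
  shows "tvec A c (snd c p, 0) = (p, \<lambda>_. 0)"
  using assms by (simp add: tvec_eq fun_eq_iff linear_0[OF fd_linear[OF transition_diffble[OF assms(1) _ assms(2)]]])

section \<open>Functions on the slit tangent bundle in charts\<close>

text \<open>
  A function on the slit tangent bundle is handled as the family of its coordinate expressions,
  because its derivatives along vector fields are only available in charts.
\<close>

definition scalar :: "('a chart \<Rightarrow> coords \<Rightarrow> real) \<Rightarrow> bool" where
  "scalar g \<longleftrightarrow> (\<forall>c\<in>A. smooth_on (slit_dom c) (g c)) \<and>
    (\<forall>c\<in>A. \<forall>d\<in>A. \<forall>z\<in>overlap c d \<times> (- {0}). g d (TT c d z) = g c z)"

lemma scalar_smooth: "scalar g \<Longrightarrow> c \<in> A \<Longrightarrow> smooth_on (slit_dom c) (g c)"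
  by (simp add: scalar_def)

lemma scalar_TT: "scalar g \<Longrightarrow> c \<in> A \<Longrightarrow> d \<in> A \<Longrightarrow> z \<in> overlap c d \<times> (- {0}) \<Longrightarrow> g d (TT c d z) = g c z"
  unfolding scalar_def by blast

lemma vector_field_TT:
  "vector_field A Z \<Longrightarrow> c \<in> A \<Longrightarrow> d \<in> A \<Longrightarrow> z \<in> overlap c d \<times> (- {0}) \<Longrightarrow>
    Z d (TT c d z) = fd (TT c d) z (Z c z)"
  unfolding vector_field_def by blast

lemma vector_field_smooth: "vector_field A Z \<Longrightarrow> c \<in> A \<Longrightarrow> smooth_on (slit_dom c) (Z c)"
  by (simp add: vector_field_def)

lemma scalar_smooth_fun: "smooth_fun A f \<Longrightarrow> scalar (\<lambda>c z. f (tvec A c z))"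
  unfolding scalar_def smooth_fun_def using tvec_TT by fastforce

lemma scalar_mult: "scalar f \<Longrightarrow> scalar g \<Longrightarrow> scalar (\<lambda>c z. f c z * g c z)"
  unfolding scalar_def by (simp add: smooth_on_mult slit_open)

lemma scalar_minus: "scalar f \<Longrightarrow> scalar (\<lambda>c z. - f c z)"
  unfolding scalar_def by (simp add: smooth_on_minus slit_open)

text \<open>
  The chain rule for a function pulled back along a change of chart: this is the reason why
  derivatives along vector fields are again chart independent.
\<close>

lemma fd_TT:
  assumes "c \<in> A" "d \<in> A" "z \<in> overlap c d \<times> (- {0})" 
    and f: "f differentiable (at (TT c d z))"
    and eq: "\<And>w. w \<in> overlap c d \<times> (- {0}) \<Longrightarrow> g w = f (TT c d w)"
  shows "fd f (TT c d z) (fd (TT c d) z v) = fd g z v"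
proof -
  have d: "TT c d differentiable (at z)" using smooth_onD[OF TT_smooth[OF assms(1,2)] assms(3)] .
  have "(\<lambda>w. f (TT c d w)) differentiable (at z)"
    using differentiable_chain_at[OF d f] by (simp add: o_def)
  from fd_cong[OF overlap_slit_open[OF assms(1,2)] assms(3) eq[symmetric] this]
  have "fd (\<lambda>w. f (TT c d w)) z = fd g z" .
  then show ?thesis using fd_compose[OF d f, of v] by simp
qed

lemma scalar_along:
  assumes Z: "vector_field A Z" and g: "scalar g"
  shows "scalar (\<lambda>c. along (Z c) (g c))"
  unfolding scalar_def
proof (intro conjI ballI)
  fix c assume c: "c \<in> A"
  show "smooth_on (slit_dom c) (along (Z c) (g c))"
    using Z g c by (intro along_smooth slit_open) (simp_all add: vector_field_def scalar_def)
  fix d and z :: coords assume d: "d \<in> A" and z: "z \<in> overlap c d \<times> (- {0})"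
  have "g d differentiable (at (TT c d z))"
    by (rule smooth_onD[OF scalar_smooth[OF g d] subsetD[OF overlap_slit TT_slit[OF c d z]]])
  from fd_TT[OF c d z this, of "g c" "Z c z"]
  show "along (Z d) (g d) (TT c d z) = along (Z c) (g c) z"
    unfolding along_def vector_field_TT[OF Z c d z] using scalar_TT[OF g c d] by simp
qed

lemma vector_field_almost_tangent:
  assumes Z: "vector_field A Z"
  shows "vector_field A (almost_tangent Z)"
  unfolding vector_field_def
proof (intro conjI ballI)
  fix c assume c: "c \<in> A"
  have "smooth_on (slit_dom c) (\<lambda>z. (0, fst (Z c z)))"
    using Z c by (intro smooth_on_Pair smooth_on_fst smooth_on_const slit_open) (simp_all add: vector_field_def)
  then show "smooth_on (slit_dom c) (almost_tangent Z c)"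
    by (simp add: almost_tangent_def[abs_def])
  fix d and z :: coords assume d: "d \<in> A" and z: "z \<in> overlap c d \<times> (- {0})"
  let ?a = "fst (Z c z)"
  have "fst (Z d (TT c d z)) = fd (transition c d) (fst z) ?a"
    unfolding vector_field_TT[OF Z c d z] by (rule fst_fd_TT[OF c d z])
  moreover have "fd (TT c d) z (0, ?a) = (0, fd (transition c d) (fst z) ?a)"
  proof -
    have dT: "TT c d differentiable (at z)" using smooth_onD[OF TT_smooth[OF c d] z] .
    have tx: "transition c d differentiable (at (fst z))" using smooth_onD[OF transition_smooth[OF c d]] z by auto
    have "TT c d differentiable (at (fst z, snd z + 0 *\<^sub>R ?a))" using dT by simp
    then have d0: "TT c d differentiable (at ((\<lambda>t. (fst z, snd z + t *\<^sub>R ?a)) 0))" .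
    have l: "((\<lambda>t. (fst z, snd z + t *\<^sub>R ?a)) has_derivative (\<lambda>t. (0, t *\<^sub>R ?a))) (at 0)"
      by (auto intro!: derivative_eq_intros)
    have 1: "((\<lambda>t. TT c d (fst z, snd z + t *\<^sub>R ?a)) has_derivative (\<lambda>t. fd (TT c d) z (0, t *\<^sub>R ?a))) (at 0)"
      using has_derivative_compose[OF l fd_works[OF d0]] by simp
    have 2: "((\<lambda>t. TT c d (fst z, snd z + t *\<^sub>R ?a)) has_derivative (\<lambda>t. (0, fd (transition c d) (fst z) (t *\<^sub>R ?a)))) (at 0)"
      unfolding tangent_transition_def
      by (auto intro!: derivative_eq_intros bounded_linear.has_derivative[OF bounded_linear_fd[OF tx]])
    show ?thesis using fun_cong[OF has_derivative_unique[OF 1 2], of 1] by simp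
  qed
  ultimately show "almost_tangent Z d (TT c d z) = fd (TT c d) z (almost_tangent Z c z)"
    by (simp add: almost_tangent_def)
qed

end


section \<open>A maximum principle on the sphere bundles\<close>

locale finsler_surface = atlas_surface X A for X :: "'a topology" and A +
  fixes F :: "'a tvec \<Rightarrow> real"
  assumes compact: "compact_space X" and finsler: "finsler X A F"
begin

definition Fc :: "'a chart \<Rightarrow> coords \<Rightarrow> real" where "Fc c z = F (tvec A c z)"

lemma Fc_scalar: "scalar Fc"
proof -
  have "smooth_fun A F" using finsler by (simp add: finsler_def)
  from scalar_smooth_fun[OF this] show ?thesis by (simp add: Fc_def[abs_def])
qed

lemma slit_cases:
  assumes "z \<in> slit_dom c"
  obtains p y where "p \<in> fst c" "y \<noteq> 0" "z = (snd c p, y)"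
  using assms by (auto simp: slit_dom_def)

lemma Fc_pos: assumes "c \<in> A" "z \<in> slit_dom c" shows "Fc c z > 0"
proof -
  obtain p y where p: "p \<in> fst c" "y \<noteq> 0" "z = (snd c p, y)" by (rule slit_cases[OF assms(2)])
  then show ?thesis using tvec_tangent(2)[OF assms(1) p(1,2)] finsler by (simp add: finsler_def Fc_def)
qed

lemma Fc_scale: assumes "c \<in> A" "z \<in> slit_dom c" "t > 0" shows "Fc c (fst z, t *\<^sub>R snd z) = t * Fc c z"
proof -
  obtain p y where p: "p \<in> fst c" "y \<noteq> 0" "z = (snd c p, y)" by (rule slit_cases[OF assms(2)])
  have "tvec A c z \<in> tangent_bundle X A" using tvec_tangent(1)[OF assms(1) p(1)] p(3) by simp
  moreover have "\<forall>(p, v)\<in>tangent_bundle X A. \<forall>t>0. F (p, \<lambda>c. t *\<^sub>R v c) = t * F (p, v)"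
    using finsler unfolding finsler_def by blast
  ultimately have "F (fst (tvec A c z), \<lambda>d. t *\<^sub>R snd (tvec A c z) d) = t * F (tvec A c z)"
    using assms(3) by (simp add: case_prod_unfold)
  moreover have "tvec A c (fst z, t *\<^sub>R snd z) = (fst (tvec A c z), \<lambda>d. t *\<^sub>R snd (tvec A c z) d)"
    using tvec_scale[OF assms(1) p(1)] tvec_eq[OF assms(1) p(1)] by (simp add: p(3))
  ultimately show ?thesis by (simp add: Fc_def)
qed

lemma Fc_zero: assumes "c \<in> A" "x \<in> snd c ` fst c" shows "Fc c (x, 0) = 0"
proof -
  obtain p where p: "p \<in> fst c" "x = snd c p" using assms(2) by auto
  have "p \<in> topspace X" using p chart_subset[OF assms(1)] by auto
  then show ?thesis using finsler tvec_zero[OF assms(1) p(1)] p(2) by (simp add: finsler_def Fc_def)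
qed

lemma F2_eq: "F2 A F c = (\<lambda>z. (Fc c z)\<^sup>2)"
  by (simp add: F2_def Fc_def fun_eq_iff)

lemma Fc_smooth: "c \<in> A \<Longrightarrow> smooth_on (slit_dom c) (Fc c)"
  using scalar_smooth[OF Fc_scalar] .

lemma finsler_chart: assumes "c \<in> A" shows "finsler_chart A F c"
proof
  show "open (snd c ` fst c)" by (rule chart(2)[OF assms])
  show "smooth_on (slit_dom c) (F2 A F c)"
    unfolding F2_eq power2_eq_square by (intro smooth_on_mult slit_open assms Fc_smooth)
  show "fibre_homogeneous (slit_dom c) 2 (F2 A F c)"
    unfolding fibre_homogeneous_def F2_eq using Fc_scale[OF assms] by (simp add: power_mult_distrib)
  show "rank (metric A F c z) = 2" if "z \<in> slit_dom c" for z
    using finsler assms that unfolding finsler_def by blast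
qed

lemma fd_F2: assumes "c \<in> A" "z \<in> slit_dom c" shows "fd (F2 A F c) z v = 2 * Fc c z * fd (Fc c) z v"
proof -
  have d: "Fc c differentiable (at z)" using smooth_onD[OF Fc_smooth[OF assms(1)] assms(2)] .
  show ?thesis unfolding F2_eq power2_eq_square fd_mult[OF d d] by simp
qed

lemma spray_F: assumes "c \<in> A" "z \<in> slit_dom c" shows "fd (Fc c) z (geodesic_spray A F c z) = 0"
  using fd_F2[OF assms] finsler_chart.S_L[OF finsler_chart[OF assms(1)] assms(2)] Fc_pos[OF assms]
  by simp

text \<open>
  The compact pieces are closed coordinate balls; finitely many of the open ones cover the surface.
\<close>

lemma finite_compact_cover:
  obtains P where "finite P" "\<And>q. q \<in> P \<Longrightarrow> fst q \<in> A \<and> compact (snd q) \<and> snd q \<subseteq> snd (fst q) ` fst (fst q)"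
    "\<And>p. p \<in> topspace X \<Longrightarrow> \<exists>q\<in>P. p \<in> fst (fst q) \<and> snd (fst q) p \<in> snd q"
proof -
  define W where "W = (\<lambda>(c :: 'a chart, x, r). {p \<in> fst c. snd c p \<in> ball x r})"
  define \<I> where "\<I> = {(c, x, r). c \<in> A \<and> cball x r \<subseteq> snd c ` fst c}"
  have op: "openin X (W i)" if "i \<in> \<I>" for i
    using that chart_open_vimage by (force simp: W_def \<I>_def)
  have "topspace X \<subseteq> \<Union>(W ` \<I>)"
  proof
    fix p assume "p \<in> topspace X"
    then obtain c where c: "c \<in> A" "p \<in> fst c" using chart_cover by blast
    then obtain r where r: "r > 0" "cball (snd c p) r \<subseteq> snd c ` fst c"
      using chart(2)[OF c(1)] open_contains_cball by blast
    have "(c, snd c p, r) \<in> \<I>" using c r by (simp add: \<I>_def)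
    moreover have "p \<in> W (c, snd c p, r)" using c r by (simp add: W_def)
    ultimately show "p \<in> \<Union>(W ` \<I>)" by blast
  qed
  then have "\<exists>\<F>. finite \<F> \<and> \<F> \<subseteq> W ` \<I> \<and> topspace X \<subseteq> \<Union>\<F>"
    using compact op unfolding compact_space_alt by (metis (no_types, lifting) imageE)
  then obtain \<F> where \<F>: "finite \<F>" "\<F> \<subseteq> W ` \<I>" "topspace X \<subseteq> \<Union>\<F>" by blast
  then obtain \<J> where J: "\<J> \<subseteq> \<I>" "finite \<J>" "\<F> = W ` \<J>" using finite_subset_image by meson
  define P where "P = (\<lambda>(c :: 'a chart, x :: real^2, r). (c, cball x r)) ` \<J>"
  show ?thesis
  proof
    show "finite P" using J by (simp add: P_def)
    show "fst q \<in> A \<and> compact (snd q) \<and> snd q \<subseteq> snd (fst q) ` fst (fst q)" if qP: "q \<in> P" for q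
    proof -
      obtain j where j: "j \<in> \<J>" "q = (\<lambda>(c, x, r). (c, cball x r)) j" using qP unfolding P_def by blast
      obtain c x r where ce: "j = (c, x, r)" by (metis prod_cases3)
      have i: "(c, x, r) \<in> \<J>" "q = (c, cball x r)" using j ce by simp_all
      then have "(c, x, r) \<in> \<I>" using J by blast
      then show ?thesis unfolding i(2) by (simp add: \<I>_def)
    qed
    show "\<exists>q\<in>P. p \<in> fst (fst q) \<and> snd (fst q) p \<in> snd q" if p: "p \<in> topspace X" for p
    proof -
      obtain i where i: "i \<in> \<J>" "p \<in> W i" using \<F>(3) J(3) p by blast
      obtain c x r where ce: "i = (c, x, r)" by (metis prod_cases3)
      have "(c, cball x r) \<in> P" using i(1) unfolding P_def ce by force
      moreover have "p \<in> fst c" "snd c p \<in> cball x r" using i(2) unfolding ce W_def by simp_all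
      ultimately show ?thesis by (metis fst_conv snd_conv)
    qed
  qed
qed

definition level :: "real \<Rightarrow> 'a chart \<Rightarrow> coords set" where
  "level r c = {z \<in> slit_dom c. Fc c z = r}"

text \<open>
  The minimum and the maximum of \<open>F\<close> on the Euclidean unit vectors over \<open>B\<close> bound the length of
  the vectors with \<open>F = r\<close> from above and away from \<open>0\<close>.
\<close>

lemma level_compact:
  assumes c: "c \<in> A" and B: "compact B" "B \<subseteq> snd c ` fst c" and r: "r > 0"
  shows "compact {z \<in> level r c. fst z \<in> B}"
proof (cases "B = {}")
  case False
  let ?K = "B \<times> sphere (0::real^2) 1"
  have K: "compact ?K" using B by (intro compact_Times) auto
  have Ks: "?K \<subseteq> slit_dom c" using B by (auto simp: slit_dom_def)
  have Kn: "?K \<noteq> {}" using False by simp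
  have ct: "continuous_on (slit_dom c) (Fc c)" by (rule smooth_on_continuous[OF Fc_smooth[OF c]])
  then have cK: "continuous_on ?K (Fc c)" using Ks continuous_on_subset by blast
  obtain z1 where z1: "z1 \<in> ?K" "\<And>z. z \<in> ?K \<Longrightarrow> Fc c z1 \<le> Fc c z"
    using continuous_attains_inf[OF K Kn cK] by blast
  obtain z2 where z2: "z2 \<in> ?K" "\<And>z. z \<in> ?K \<Longrightarrow> Fc c z \<le> Fc c z2"
    using continuous_attains_sup[OF K Kn cK] by blast
  define m where "m = Fc c z1"
  define M where "M = Fc c z2"
  have pos: "m > 0" "M > 0" using Fc_pos[OF c] z1(1) z2(1) Ks by (auto simp: m_def M_def)
  \<comment> \<open>The level set is closed in this compact set; the lower bound on the norm keeps it off the zero section.\<close>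
  let ?C = "B \<times> (cball (0::real^2) (r / m) \<inter> {y. norm y \<ge> r / M})"
  have C: "compact ?C"
  proof (intro compact_Times compact_Int_closed B)
    show "closed {y::real^2. r / M \<le> norm y}" by (intro closed_Collect_le continuous_intros)
  qed simp
  have rM: "r / M > 0" using r pos by simp
  have Cs: "?C \<subseteq> slit_dom c" using B rM by (auto simp: slit_dom_def)
  have eq: "{z \<in> level r c. fst z \<in> B} = {z \<in> ?C. Fc c z = r}"
  proof (intro set_eqI iffI)
    fix z assume z: "z \<in> {z \<in> level r c. fst z \<in> B}"
    then have zs: "z \<in> slit_dom c" and zr: "Fc c z = r" and zB: "fst z \<in> B" by (auto simp: level_def)
    have n: "norm (snd z) > 0" using zs by (auto simp: slit_dom_def)
    define w where "w = (fst z, (1 / norm (snd z)) *\<^sub>R snd z)"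
    have w: "w \<in> ?K" using zB n by (simp add: w_def)
    then have ws: "w \<in> slit_dom c" using Ks by blast
    have "(fst w, norm (snd z) *\<^sub>R snd w) = z" using n by (simp add: w_def)
    then have "r = norm (snd z) * Fc c w" using Fc_scale[OF c ws n] zr by simp
    moreover have "m \<le> Fc c w" "Fc c w \<le> M" using z1(2)[OF w] z2(2)[OF w] by (simp_all add: m_def M_def)
    ultimately have "norm (snd z) * m \<le> r" "r \<le> norm (snd z) * M"
      using n by (simp_all add: mult_left_mono)
    then have "norm (snd z) \<le> r / m" "r / M \<le> norm (snd z)" using pos by (simp_all add: field_simps)
    then show "z \<in> {z \<in> ?C. Fc c z = r}" using zB zr by (cases z) simp
  next
    fix z assume "z \<in> {z \<in> ?C. Fc c z = r}"
    then show "z \<in> {z \<in> level r c. fst z \<in> B}" using Cs by (auto simp: level_def)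
  qed
  have cC: "continuous_on ?C (Fc c)" using ct Cs continuous_on_subset by blast
  have "closed (?C \<inter> Fc c -` {r})"
    by (rule continuous_closed_preimage[OF cC compact_imp_closed[OF C]]) simp
  then have "compact (?C \<inter> (?C \<inter> Fc c -` {r}))" using C compact_Int_closed by blast
  moreover have "?C \<inter> (?C \<inter> Fc c -` {r}) = {z \<in> ?C. Fc c z = r}" by auto
  ultimately show ?thesis unfolding eq by simp
qed auto

lemma level_cover:
  assumes r: "r > 0"
  obtains Q where "finite Q" "\<And>q. q \<in> Q \<Longrightarrow> fst q \<in> A \<and> compact (snd q) \<and> snd q \<subseteq> level r (fst q)"
    "\<And>d w. d \<in> A \<Longrightarrow> w \<in> level r d \<Longrightarrow> \<exists>q\<in>Q. w \<in> overlap d (fst q) \<times> (- {0}) \<and> TT d (fst q) w \<in> snd q"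
proof -
  obtain P where P: "finite P" "\<And>q. q \<in> P \<Longrightarrow> fst q \<in> A \<and> compact (snd q) \<and> snd q \<subseteq> snd (fst q) ` fst (fst q)"
    "\<And>p. p \<in> topspace X \<Longrightarrow> \<exists>q\<in>P. p \<in> fst (fst q) \<and> snd (fst q) p \<in> snd q"
    by (rule finite_compact_cover) blast
  define h where "h = (\<lambda>q :: 'a chart \<times> (real^2) set. (fst q, {z \<in> level r (fst q). fst z \<in> snd q}))"
  show ?thesis
  proof
    show "finite (h ` P)" using P by simp
    show "fst q \<in> A \<and> compact (snd q) \<and> snd q \<subseteq> level r (fst q)" if q: "q \<in> h ` P" for q
    proof -
      obtain q' where q': "q' \<in> P" "q = h q'" using q by blast
      have "compact {z \<in> level r (fst q'). fst z \<in> snd q'}"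
        using P(2)[OF q'(1)] by (intro level_compact r) auto
      then show ?thesis using P(2)[OF q'(1)] unfolding q'(2) h_def by simp
    qed
    fix d and w assume d: "d \<in> A" and w: "w \<in> level r d"
    then have ws: "w \<in> slit_dom d" and wr: "Fc d w = r" by (auto simp: level_def)
    obtain p y where p: "p \<in> fst d" "y \<noteq> 0" "w = (snd d p, y)" by (rule slit_cases[OF ws])
    have "p \<in> topspace X" using p chart_subset[OF d] by blast
    then obtain q where q: "q \<in> P" "p \<in> fst (fst q)" "snd (fst q) p \<in> snd q" using P(3) by blast
    have qA: "fst q \<in> A" using P(2)[OF q(1)] by simp
    have wo: "w \<in> overlap d (fst q) \<times> (- {0})" unfolding overlap_def using p q by simp
    have "TT d (fst q) w \<in> level r (fst q)"
      using subsetD[OF overlap_slit TT_slit[OF d qA wo]] scalar_TT[OF Fc_scalar d qA wo] wr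
      by (simp add: level_def)
    moreover have "fst (TT d (fst q) w) \<in> snd q" unfolding p(3) TT_eq[OF d p(1)] using q by simp
    ultimately have "TT d (fst q) w \<in> snd (h q)" by (simp add: h_def)
    then have "w \<in> overlap d (fst (h q)) \<times> (- {0}) \<and> TT d (fst (h q)) w \<in> snd (h q)"
      using wo by (simp add: h_def)
    then show "\<exists>q\<in>h ` P. w \<in> overlap d (fst q) \<times> (- {0}) \<and> TT d (fst q) w \<in> snd q"
      using q(1) by blast
  qed
qed

lemma scalar_attains_sup:
  assumes g: "scalar g" and r: "r > 0" and d0: "d0 \<in> A" "z0 \<in> level r d0"
  obtains c z where "c \<in> A" "z \<in> level r c" "\<And>d w. d \<in> A \<Longrightarrow> w \<in> level r d \<Longrightarrow> g d w \<le> g c z"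
proof -
  obtain Q where Q: "finite Q" "\<And>q. q \<in> Q \<Longrightarrow> fst q \<in> A \<and> compact (snd q) \<and> snd q \<subseteq> level r (fst q)"
    "\<And>d w. d \<in> A \<Longrightarrow> w \<in> level r d \<Longrightarrow> \<exists>q\<in>Q. w \<in> overlap d (fst q) \<times> (- {0}) \<and> TT d (fst q) w \<in> snd q"
    by (rule level_cover[OF r]) blast
  define V where "V = (\<Union>q\<in>Q. g (fst q) ` snd q)"
  have "compact V"
    unfolding V_def
  proof (intro compact_UN Q(1) compact_continuous_image)
    fix q assume q: "q \<in> Q"
    show "compact (snd q)" using Q(2)[OF q] by simp
    have "snd q \<subseteq> slit_dom (fst q)" using Q(2)[OF q] by (auto simp: level_def)
    then show "continuous_on (snd q) (g (fst q))"
      using smooth_on_continuous[OF scalar_smooth[OF g]] Q(2)[OF q] continuous_on_subset by blast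
  qed
  have V: "g d w \<in> V" if dw: "d \<in> A" "w \<in> level r d" for d w
  proof -
    obtain q where q: "q \<in> Q" "w \<in> overlap d (fst q) \<times> (- {0})" "TT d (fst q) w \<in> snd q" using Q(3)[OF dw] by blast
    have "g (fst q) (TT d (fst q) w) = g d w" by (rule scalar_TT[OF g dw(1) _ q(2)]) (use Q(2)[OF q(1)] in simp)
    moreover have "g (fst q) (TT d (fst q) w) \<in> g (fst q) ` snd q" using q(3) by (rule imageI)
    ultimately have "g d w \<in> g (fst q) ` snd q" by simp
    then show ?thesis unfolding V_def using q(1) by blast
  qed
  have "V \<noteq> {}" using V[OF d0] by blast
  then obtain m where m: "m \<in> V" "\<And>v. v \<in> V \<Longrightarrow> v \<le> m" using compact_attains_sup[OF \<open>compact V\<close>] by blast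
  obtain q z where q: "q \<in> Q" "z \<in> snd q" "m = g (fst q) z" using m(1) by (auto simp: V_def)
  show ?thesis
  proof
    show "fst q \<in> A" using Q(2)[OF q(1)] by simp
    show "z \<in> level r (fst q)" using Q(2)[OF q(1)] q(2) by blast
    show "g d w \<le> g (fst q) z" if "d \<in> A" "w \<in> level r d" for d w using m(2) V[OF that] q(3) by simp
  qed
qed

text \<open>
  A vector annihilating \<open>F\<close> is the velocity of a curve within the level set: rescale the
  fibre coordinate of the straight line so that \<open>F\<close> keeps the value \<open>r\<close>. As \<open>F\<close> is constant to first order
  along the line, the scaling factor has derivative \<open>0\<close>, and the velocity does not change.
\<close>

lemma level_max_critical:
  fixes f :: "coords \<Rightarrow> real"
  assumes c: "c \<in> A" and z: "z \<in> level r c" and g: "smooth_on (slit_dom c) f"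
    and max: "\<And>w. w \<in> level r c \<Longrightarrow> f w \<le> f z" and v: "fd (Fc c) z v = 0"
  shows "fd f z v = 0"
proof -
  have zs: "z \<in> slit_dom c" and zr: "Fc c z = r" using z by (auto simp: level_def)
  have r: "r > 0" using Fc_pos[OF c zs] zr by simp
  \<comment> \<open>The factor that brings the point of the straight line back to the level \<open>r\<close>.\<close>
  define q where "q t = r * inverse (Fc c (z + t *\<^sub>R v))" for t
  define \<gamma> where "\<gamma> t = (fst (z + t *\<^sub>R v), q t *\<^sub>R snd (z + t *\<^sub>R v))" for t
  have l: "((\<lambda>t. z + t *\<^sub>R v) has_derivative (\<lambda>t. t *\<^sub>R v)) (at 0)" by (auto intro!: derivative_eq_intros)
  have dF: "Fc c differentiable (at (z + 0 *\<^sub>R v))" using smooth_onD[OF Fc_smooth[OF c] zs] by simp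
  have "((\<lambda>t. Fc c (z + t *\<^sub>R v)) has_derivative (\<lambda>t. fd (Fc c) z (t *\<^sub>R v))) (at 0)"
    using has_derivative_compose[OF l fd_works[OF dF]] by simp
  moreover have "fd (Fc c) z (t *\<^sub>R v) = 0" for t
    using linear_scale[OF fd_linear, of "Fc c" z t v] dF v by simp
  ultimately have "((\<lambda>t. Fc c (z + t *\<^sub>R v)) has_derivative (\<lambda>t. 0)) (at 0)" by simp
  then have dq: "(q has_derivative (\<lambda>t. 0)) (at 0)"
    unfolding q_def using r zr
    by (auto intro!: derivative_eq_intros)
  have q0: "q 0 = 1" using r zr by (simp add: q_def)
  have l1: "((\<lambda>t. fst (z + t *\<^sub>R v)) has_derivative (\<lambda>t. fst (t *\<^sub>R v))) (at 0)"
    by (rule has_derivative_fst[OF l])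
  have l2: "((\<lambda>t. q t *\<^sub>R snd (z + t *\<^sub>R v)) has_derivative (\<lambda>t. q 0 *\<^sub>R snd (t *\<^sub>R v) + 0 *\<^sub>R snd (z + 0 *\<^sub>R v))) (at 0)"
    by (rule has_derivative_scaleR[OF dq has_derivative_snd[OF l]])
  have d\<gamma>: "(\<gamma> has_derivative (\<lambda>t. t *\<^sub>R v)) (at 0)"
    unfolding \<gamma>_def using has_derivative_Pair[OF l1 l2] q0 by (simp add: scaleR_prod_def)
  have \<gamma>0: "\<gamma> 0 = z" by (simp add: \<gamma>_def q0)
  have dfz: "f differentiable (at (\<gamma> 0))" unfolding \<gamma>0 by (rule smooth_onD[OF g zs])
  have "((\<lambda>t. f (\<gamma> t)) has_derivative (\<lambda>t. fd f z (t *\<^sub>R v))) (at 0)"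
    using has_derivative_compose[OF d\<gamma> fd_works[OF dfz]] by (simp add: \<gamma>0)
  then have D: "((\<lambda>t. f (\<gamma> t)) has_real_derivative fd f z v) (at 0)"
    using linear_scale[OF fd_linear[OF dfz]] \<gamma>0
    by (simp add: has_field_derivative_def mult_commute_abs)
  have "continuous_on UNIV (\<lambda>t. z + t *\<^sub>R v)" by (intro continuous_intros)
  then have "open {t. z + t *\<^sub>R v \<in> slit_dom c}"
    using open_vimage[OF slit_open[OF c], of "\<lambda>t. z + t *\<^sub>R v"] by (simp add: vimage_def)
  moreover have "0 \<in> {t. z + t *\<^sub>R v \<in> slit_dom c}" using zs by simp
  ultimately obtain e where e: "e > 0" "ball 0 e \<subseteq> {t. z + t *\<^sub>R v \<in> slit_dom c}"
    using open_contains_ball by blast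
  have "f (\<gamma> t) \<le> f (\<gamma> 0)" if "\<bar>0 - t\<bar> < e" for t
  proof -
    have s: "z + t *\<^sub>R v \<in> slit_dom c" using e(2) that by auto
    have Fp: "Fc c (z + t *\<^sub>R v) > 0" by (rule Fc_pos[OF c s])
    have qp: "q t > 0" using Fp r by (simp add: q_def)
    have "\<gamma> t \<in> slit_dom c"
      using s qp unfolding \<gamma>_def slit_dom_def by (simp add: mem_Times_iff del: fst_add snd_add)
    moreover have "Fc c (\<gamma> t) = r" unfolding \<gamma>_def using Fc_scale[OF c s qp] Fp by (simp add: q_def)
    ultimately show ?thesis unfolding \<gamma>0 by (intro max) (simp add: level_def)
  qed
  then show ?thesis using DERIV_local_max[OF D e(1)] by blast
qed

text \<open>
  Both the maximum and the minimum of \<open>g\<close> are attained at critical points, where \<open>g = 0\<close> by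
  assumption. So \<open>g\<close> vanishes on the whole level set, every point is a maximum, and the derivative
  of \<open>g\<close> along \<open>Z\<close> vanishes as well.
\<close>

lemma maximum_principle:
  assumes g: "scalar g" and r: "r > 0"
    and tangent: "\<And>c z. c \<in> A \<Longrightarrow> z \<in> level r c \<Longrightarrow> fd (Fc c) z (Z c z) = 0"
    and crit: "\<And>c z. c \<in> A \<Longrightarrow> z \<in> level r c \<Longrightarrow> along (Z c) (g c) z = 0 \<Longrightarrow> g c z = 0"
    and d: "d \<in> A" "w \<in> level r d"
  shows "g d w = 0" and "along (Z d) (g d) w = 0"
proof -
  have le: "f d w \<le> 0" if f: "scalar f" 
    and cr: "\<And>c z. c \<in> A \<Longrightarrow> z \<in> level r c \<Longrightarrow> fd (f c) z (Z c z) = 0 \<Longrightarrow> f c z = 0"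
    and d: "d \<in> A" "w \<in> level r d" for f d w
  proof -
    obtain c z where c: "c \<in> A" "z \<in> level r c" and m: "\<And>d w. d \<in> A \<Longrightarrow> w \<in> level r d \<Longrightarrow> f d w \<le> f c z"
      by (rule scalar_attains_sup[OF f r d]) blast
    have "fd (f c) z (Z c z) = 0"
      by (rule level_max_critical[OF c scalar_smooth[OF f c(1)] m[OF c(1)] tangent[OF c]])
    then show ?thesis using m[OF d] cr[OF c] by simp
  qed
  have z0: "g d w = 0" if d: "d \<in> A" "w \<in> level r d" for d w
  proof -
    have "g d w \<le> 0" by (rule le[OF g _ d]) (use crit in \<open>simp add: along_def\<close>)
    moreover have "- g d w \<le> 0"
    proof (rule le[OF scalar_minus[OF g] _ d])
      fix c z assume c: "c \<in> A" "z \<in> level r c" and 0: "fd (\<lambda>z. - g c z) z (Z c z) = 0"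
      have zs: "z \<in> slit_dom c" using c by (simp add: level_def)
      have "fd (\<lambda>z. - g c z) z (Z c z) = - fd (g c) z (Z c z)"
        by (rule fd_bounded_linear[OF bounded_linear_minus[OF bounded_linear_ident] smooth_onD[OF scalar_smooth[OF g c(1)] zs]])
      then have "along (Z c) (g c) z = 0" using 0 by (simp add: along_def)
      then show "- g c z = 0" using crit[OF c] by simp
    qed
    ultimately show ?thesis by simp
  qed
  show "g d w = 0" by (rule z0[OF d])
  show "along (Z d) (g d) w = 0"
    unfolding along_def
    by (rule level_max_critical[OF d scalar_smooth[OF g d(1)] _ tangent[OF d]]) (simp add: z0 d)
qed

end


section \<open>Ordinary differential equations\<close>

lemma indefinite_integral_bound:
  fixes g :: "real \<Rightarrow> 'a::euclidean_space"
  assumes e: "e > 0" and g: "continuous_on {-e..e} g" and B: "\<And>s. s \<in> {-e..e} \<Longrightarrow> norm (g s) \<le> B"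
    and t: "t \<in> {-e..e}"
  shows "norm (integral {-e..t} g - integral {-e..0} g) \<le> B * e"
proof -
  have B0: "B \<ge> 0" by (rule order_trans[OF norm_ge_zero B[of 0]]) (use e in simp)
  have "norm (integral {-e..t} g - integral {-e..0} g) \<le> B * norm (t - 0)"
  proof (rule differentiable_bound[of "{-e..e}" _ "\<lambda>x h. h *\<^sub>R g x"])
    show "((\<lambda>u. integral {-e..u} g) has_derivative (\<lambda>h. h *\<^sub>R g x)) (at x within {-e..e})"
      if "x \<in> {-e..e}" for x
      using integral_has_vector_derivative[OF g that] by (simp add: has_vector_derivative_def)
    show "onorm (\<lambda>h. h *\<^sub>R g x) \<le> B" if "x \<in> {-e..e}" for x
      by (rule onorm_le) (use B[OF that] in \<open>simp add: mult.commute[of B] mult_left_mono\<close>)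
  qed (use t e in auto)
  also have "\<dots> \<le> B * e" using t B0 by (intro mult_left_mono) auto
  finally show ?thesis .
qed

text \<open>
  Banach's fixed point theorem for the Picard operator on bounded continuous functions on
  the real line. The integrals start at \<open>-e\<close>, so that no integral over a reversed interval occurs, and the
  time is clamped to \<open>[-e, e]\<close>, so that the operator acts on functions defined everywhere.
\<close>

lemma picard_local:
  fixes f :: "'a::euclidean_space \<Rightarrow> 'a"
  assumes r: "r > 0" and f: "continuous_on (cball q r) f"
    and M: "\<And>x. x \<in> cball q r \<Longrightarrow> norm (f x) \<le> M"
    and L: "\<And>x y. x \<in> cball q r \<Longrightarrow> y \<in> cball q r \<Longrightarrow> norm (f x - f y) \<le> L * norm (x - y)"
    and e: "e > 0" "M * e \<le> r" "L * e \<le> 1 / 2"  and L0: "L \<ge> 0"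
  shows "\<exists>\<phi>. \<phi> 0 = q \<and> (\<forall>t. \<bar>t\<bar> < e \<longrightarrow> \<phi> t \<in> cball q r \<and> (\<phi> has_vector_derivative f (\<phi> t)) (at t))"
proof -
  define cl where "cl t = max (- e) (min e t)" for t :: real
  have cl: "cl t \<in> {-e..e}" for t using e by (auto simp: cl_def)
  have cl_id: "cl t = t" if "t \<in> {-e..e}" for t using that by (auto simp: cl_def)
  have clc: "continuous_on UNIV cl" unfolding cl_def by (intro continuous_intros)
  let ?C = "PiC UNIV (\<lambda>_. cball q r) :: (real \<Rightarrow>\<^sub>C 'a) set"
  define G where "G \<phi> t = q + (integral {-e..cl t} (\<lambda>s. f (apply_bcontfun \<phi> s)) - integral {-e..0} (\<lambda>s. f (apply_bcontfun \<phi> s)))" for \<phi> t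
  have in_ball: "apply_bcontfun \<phi> s \<in> cball q r" if "\<phi> \<in> ?C" for \<phi> s using that by (simp add: mem_PiC_iff Pi_iff)
  have fc: "continuous_on T (\<lambda>s. f (apply_bcontfun \<phi> s))" if "\<phi> \<in> ?C" for \<phi> T
    by (rule continuous_on_compose2[OF f]) (use in_ball[OF that] in \<open>auto simp del: mem_cball\<close>)
  have G_in: "G \<phi> t \<in> cball q r" if "\<phi> \<in> ?C" for \<phi> t
  proof -
    have "norm (integral {-e..cl t} (\<lambda>s. f (apply_bcontfun \<phi> s)) - integral {-e..0} (\<lambda>s. f (apply_bcontfun \<phi> s))) \<le> M * e"
      by (rule indefinite_integral_bound[OF e(1) fc[OF that] _ cl]) (rule M[OF in_ball[OF that]])
    also have "\<dots> \<le> r" by (rule e)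
    finally show ?thesis by (simp add: G_def dist_norm norm_minus_commute)
  qed
  have Gc: "continuous_on UNIV (G \<phi>)" if "\<phi> \<in> ?C" for \<phi>
  proof -
    have "continuous_on {-e..e} (\<lambda>u. integral {-e..u} (\<lambda>s. f (apply_bcontfun \<phi> s)))"
      using integral_has_vector_derivative[OF fc[OF that]] 
      by (meson has_vector_derivative_continuous continuous_on_eq_continuous_within)
    then have "continuous_on UNIV (\<lambda>t. integral {-e..cl t} (\<lambda>s. f (apply_bcontfun \<phi> s)))"
      using continuous_on_compose2[OF _ clc, of "{-e..e}"] cl by (simp add: image_subset_iff)
    then show ?thesis unfolding G_def by (intro continuous_intros)
  qed
  have Gb: "G \<phi> \<in> bcontfun" if "\<phi> \<in> ?C" for \<phi>
  proof (rule bcontfun_normI[OF Gc[OF that]])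
    fix t
    have "norm (G \<phi> t) \<le> norm q + norm (G \<phi> t - q)" using norm_triangle_sub by blast
    then show "norm (G \<phi> t) \<le> norm q + r" using G_in[OF that, of t] by (simp add: dist_norm norm_minus_commute)
  qed
  define P where "P \<phi> = Bcontfun (G \<phi>)" for \<phi>
  have P: "apply_bcontfun (P \<phi>) = G \<phi>" if "\<phi> \<in> ?C" for \<phi>
    unfolding P_def using Gb[OF that] by (rule Bcontfun_inverse)
  have "\<exists>!\<phi>\<in>?C. P \<phi> = \<phi>"
  proof (rule Banach_fix[where c = "1/2"])
    show "complete ?C" by (simp add: complete_eq_closed closed_PiC)
    have "const_bcontfun q \<in> ?C" using r by (simp add: mem_PiC_iff Pi_iff const_bcontfun.rep_eq)
    then show "?C \<noteq> {}" by blast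
    show "P ` ?C \<subseteq> ?C" using G_in by (auto simp: mem_PiC_iff P simp del: mem_cball)
    show "\<And>x y. x \<in> ?C \<Longrightarrow> y \<in> ?C \<Longrightarrow> dist (P x) (P y) \<le> 1 / 2 * dist x y"
    proof -
      fix \<phi> \<psi> assume \<phi>: "\<phi> \<in> ?C" and \<psi>: "\<psi> \<in> ?C"
      let ?h = "\<lambda>s. f (apply_bcontfun \<phi> s) - f (apply_bcontfun \<psi> s)"
      show "dist (P \<phi>) (P \<psi>) \<le> 1 / 2 * dist \<phi> \<psi>"
      proof (rule dist_bound)
        fix t
        have int: "(\<lambda>s. f (apply_bcontfun \<theta> s)) integrable_on {-e..u}" if "\<theta> \<in> ?C" for \<theta> u
          by (rule integrable_continuous_real[OF fc[OF that]])
        have "norm (integral {-e..cl t} ?h - integral {-e..0} ?h) \<le> (L * dist \<phi> \<psi>) * e"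
        proof (rule indefinite_integral_bound[OF e(1) _ _ cl])
          show "continuous_on {-e..e} ?h" by (intro continuous_intros fc \<phi> \<psi>)
          fix s
          have "norm (?h s) \<le> L * norm (apply_bcontfun \<phi> s - apply_bcontfun \<psi> s)"
            by (rule L[OF in_ball[OF \<phi>] in_ball[OF \<psi>]])
          also have "\<dots> \<le> L * dist \<phi> \<psi>"
            using dist_bounded[of \<phi> s \<psi>] L0 by (intro mult_left_mono) (simp_all add: dist_norm)
          finally show "norm (?h s) \<le> L * dist \<phi> \<psi>" .
        qed
        also have "\<dots> = (L * e) * dist \<phi> \<psi>" by simp
        also have "\<dots> \<le> 1 / 2 * dist \<phi> \<psi>" by (intro mult_right_mono e) simp
        finally show "dist (apply_bcontfun (P \<phi>) t) (apply_bcontfun (P \<psi>) t) \<le> 1 / 2 * dist \<phi> \<psi>"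
          unfolding P[OF \<phi>] P[OF \<psi>]
          by (simp add: G_def dist_norm integral_diff[OF int[OF \<phi>] int[OF \<psi>]] algebra_simps)
      qed
    qed
  qed auto
  then obtain \<phi> where \<phi>: "\<phi> \<in> ?C" "P \<phi> = \<phi>" by blast
  have eq: "apply_bcontfun \<phi> t = G \<phi> t" for t using P[OF \<phi>(1)] \<phi>(2) by simp
  show ?thesis
  proof (intro exI[of _ "apply_bcontfun \<phi>"] conjI allI impI)
    show "apply_bcontfun \<phi> 0 = q" unfolding eq using e by (simp add: G_def cl_def)
    fix t assume t: "\<bar>t\<bar> < e"
    show "apply_bcontfun \<phi> t \<in> cball q r" by (rule in_ball[OF \<phi>(1)])
    have ti: "t \<in> {-e<..<e}" using t by auto
    have "((\<lambda>u. integral {-e..u} (\<lambda>s. f (apply_bcontfun \<phi> s))) has_vector_derivative f (apply_bcontfun \<phi> t)) (at t within {-e..e})"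
      by (rule integral_has_vector_derivative[OF fc[OF \<phi>(1)]]) (use t in auto)
    then have "((\<lambda>u. integral {-e..u} (\<lambda>s. f (apply_bcontfun \<phi> s))) has_vector_derivative f (apply_bcontfun \<phi> t)) (at t)"
      using ti at_within_interior[of t "{-e..e}"] by (simp add: interior_atLeastAtMost_real)
    then have "((\<lambda>u. q + (integral {-e..u} (\<lambda>s. f (apply_bcontfun \<phi> s)) - integral {-e..0} (\<lambda>s. f (apply_bcontfun \<phi> s)))) has_vector_derivative f (apply_bcontfun \<phi> t)) (at t)"
      by (auto intro!: derivative_eq_intros)
    then show "(apply_bcontfun \<phi> has_vector_derivative f (apply_bcontfun \<phi> t)) (at t)"
    proof (rule has_vector_derivative_transform_within_open[OF _ _ ti])
      show "q + (integral {-e..u} (\<lambda>s. f (apply_bcontfun \<phi> s)) - integral {-e..0} (\<lambda>s. f (apply_bcontfun \<phi> s))) = apply_bcontfun \<phi> u"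
        if "u \<in> {-e<..<e}" for u
        using that cl_id[of u] by (subst eq) (simp add: G_def)
    qed simp
  qed
qed

text \<open>
  A compact neighbourhood of \<open>Q\<close> provides common bounds for \<open>f\<close> and its derivative, and these
  bounds alone determine the existence time.
\<close>

lemma uniform_local_flow:
  fixes f :: "'a::euclidean_space \<Rightarrow> 'a"
  assumes U: "open U" and Q: "compact Q" "Q \<subseteq> U" and f: "smooth_on U f"
  obtains e where "e > 0"
    "\<And>q. q \<in> Q \<Longrightarrow> \<exists>\<phi>. \<phi> 0 = q \<and> (\<forall>t. \<bar>t\<bar> < e \<longrightarrow> \<phi> t \<in> U \<and> (\<phi> has_vector_derivative f (\<phi> t)) (at t))"
proof -
  obtain r where r: "r > 0" "(\<Union>x\<in>Q. cball x r) \<subseteq> U"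
    using compact_subset_open_imp_cball_epsilon_subset[OF Q(1) U Q(2)] .
  define K where "K = {x + y | x y. x \<in> Q \<and> y \<in> cball (0::'a) r}"
  have K: "compact K" unfolding K_def by (intro compact_sums Q compact_cball)
  have KQ: "cball q r \<subseteq> K" if "q \<in> Q" for q
  proof
    fix x assume "x \<in> cball q r"
    then have "x = q + (x - q)" "x - q \<in> cball 0 r" by (auto simp: dist_norm norm_minus_commute)
    then show "x \<in> K" using that unfolding K_def by blast
  qed
  have KU: "K \<subseteq> U"
  proof
    fix x assume "x \<in> K"
    then obtain q y where "q \<in> Q" "y \<in> cball 0 r" "x = q + y" by (auto simp: K_def)
    then have "x \<in> cball q r" by (simp add: dist_norm)
    then show "x \<in> U" using \<open>q \<in> Q\<close> r(2) by blast
  qed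
  have fK: "continuous_on K f" using smooth_on_continuous[OF smooth_on_subset[OF f KU]] .
  have bounded_above: "\<exists>M>0. \<forall>x\<in>K. norm (h x) \<le> M" if "continuous_on K h" for h :: "'a \<Rightarrow> 'b::real_normed_vector"
  proof -
    have "bounded (h ` K)" using compact_imp_bounded[OF compact_continuous_image[OF that K]] .
    then show ?thesis unfolding bounded_pos by (auto simp: image_iff)
  qed
  obtain M where M: "M > 0" "\<And>x. x \<in> K \<Longrightarrow> norm (f x) \<le> M" using bounded_above[OF fK] by blast
  have "continuous_on K (\<lambda>x. \<Sum>b\<in>Basis. norm (fd f x b))"
    by (intro continuous_intros smooth_on_continuous[OF smooth_on_subset[OF smooth_on_fd[OF f] KU]])
  then obtain L where L: "L > 0" "\<And>x. x \<in> K \<Longrightarrow> norm (\<Sum>b\<in>Basis. norm (fd f x b)) \<le> L" using bounded_above by blast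
  have on: "onorm (fd f x) \<le> L" if x: "x \<in> K" for x
  proof (rule onorm_le)
    fix v
    have "norm (fd f x v) \<le> (\<Sum>b\<in>Basis. norm ((v \<bullet> b) *\<^sub>R fd f x b))"
      using fd_expand[OF smooth_onD[OF f subsetD[OF KU x]], of v] norm_sum by metis
    also have "\<dots> \<le> (\<Sum>b\<in>Basis. norm v * norm (fd f x b))"
      by (intro sum_mono) (auto intro!: mult_right_mono simp: Basis_le_norm)
    also have "\<dots> = (\<Sum>b\<in>Basis. norm (fd f x b)) * norm v" by (simp add: sum_distrib_left[symmetric])
    also have "\<dots> \<le> L * norm v" using L(2)[OF x] by (intro mult_right_mono) auto
    finally show "norm (fd f x v) \<le> L * norm v" .
  qed
  \<comment> \<open>The first bound keeps the solution in the ball, the second makes the Picard operator a contraction.\<close>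
  define e where "e = min (r / M) (1 / (2 * L))"
  have e: "e > 0" "M * e \<le> r" "L * e \<le> 1 / 2"
    using r M(1) L(1) by (auto simp: e_def min_def field_simps)
  show ?thesis
  proof
    show "e > 0" by (rule e)
    fix q assume q: "q \<in> Q"
    have sub: "x \<in> K" if "x \<in> cball q r" for x using KQ[OF q] that by blast
    have "\<exists>\<phi>. \<phi> 0 = q \<and> (\<forall>t. \<bar>t\<bar> < e \<longrightarrow> \<phi> t \<in> cball q r \<and> (\<phi> has_vector_derivative f (\<phi> t)) (at t))"
    proof (rule picard_local[OF r(1) _ M(2)[OF sub] _ e])
      show "continuous_on (cball q r) f" using continuous_on_subset[OF fK KQ[OF q]] .
      show "norm (f x - f y) \<le> L * norm (x - y)" if "x \<in> cball q r" "y \<in> cball q r" for x y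
      proof (rule differentiable_bound[of "cball q r" f "\<lambda>x. fd f x"])
        show "(f has_derivative fd f x) (at x within cball q r)" if "x \<in> cball q r" for x
          using fd_works[OF smooth_onD[OF f subsetD[OF KU sub[OF that]]]] by (rule has_derivative_at_withinI)
      qed (use that on sub in auto)
    qed (use L in auto)
    then show "\<exists>\<phi>. \<phi> 0 = q \<and> (\<forall>t. \<bar>t\<bar> < e \<longrightarrow> \<phi> t \<in> U \<and> (\<phi> has_vector_derivative f (\<phi> t)) (at t))"
      using sub KU by blast
  qed
qed

text \<open>
  The Wronskian of \<open>f\<close> and \<open>sin (c (t - a))\<close>, taken over half a period, would have to be
  nonincreasing, while its end values are \<open>- c f(a) < 0\<close> and \<open>c f(b) > 0\<close>.
\<close>

lemma sturm_positive:
  fixes f f1 \<kappa> :: "real \<Rightarrow> real"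
  assumes c: "c > 0" and b: "b = a + pi / c"
    and f: "\<And>t. t \<in> {a..b} \<Longrightarrow> (f has_real_derivative f1 t) (at t)"
    and f1: "\<And>t. t \<in> {a..b} \<Longrightarrow> (f1 has_real_derivative - \<kappa> t * f t) (at t)"
    and \<kappa>: "\<And>t. t \<in> {a..b} \<Longrightarrow> c\<^sup>2 \<le> \<kappa> t"
    and pos: "\<And>t. t \<in> {a..b} \<Longrightarrow> f t > 0"
  shows False
proof -
  have ab: "a \<le> b" using b c by simp
  define W where "W t = f1 t * sin (c * (t - a)) - f t * (c * cos (c * (t - a)))" for t
  have W: "(W has_real_derivative (c\<^sup>2 - \<kappa> t) * f t * sin (c * (t - a))) (at t)" if "t \<in> {a..b}" for t
    unfolding W_def
    by (rule derivative_eq_intros f[OF that] f1[OF that] refl)+ (simp add: power2_eq_square algebra_simps)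
  have "(c\<^sup>2 - \<kappa> t) * f t * sin (c * (t - a)) \<le> 0" if "t \<in> {a..b}" for t
  proof -
    have "c * (t - a) \<le> c * (pi / c)" using that b c by (intro mult_left_mono) auto
    then have "sin (c * (t - a)) \<ge> 0" using that c by (intro sin_ge_zero) auto
    moreover have "(c\<^sup>2 - \<kappa> t) * f t \<le> 0" using \<kappa>[OF that] pos[OF that] by (simp add: mult_nonpos_nonneg)
    ultimately show ?thesis by (simp add: mult_nonpos_nonneg)
  qed
  then have "W b \<le> W a" using W by (intro DERIV_nonpos_imp_nonincreasing[OF ab]) auto
  then have "f b * c \<le> - (f a * c)" using b c by (simp add: W_def)
  moreover have "f b * c > 0" "f a * c > 0" using pos ab c by auto
  ultimately show False by simp
qed

lemma sturm_zero:
  fixes f f1 \<kappa> :: "real \<Rightarrow> real"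
  assumes c: "c > 0" and b: "b = a + pi / c"
    and f: "\<And>t. t \<in> {a..b} \<Longrightarrow> (f has_real_derivative f1 t) (at t)"
    and f1: "\<And>t. t \<in> {a..b} \<Longrightarrow> (f1 has_real_derivative - \<kappa> t * f t) (at t)"
    and \<kappa>: "\<And>t. t \<in> {a..b} \<Longrightarrow> c\<^sup>2 \<le> \<kappa> t"
  shows "\<exists>t\<in>{a..b}. f t = 0"
proof (rule ccontr)
  assume nz: "\<not> (\<exists>t\<in>{a..b}. f t = 0)"
  have cont: "continuous_on {a..b} f" using f DERIV_isCont continuous_at_imp_continuous_on by blast
  have conn: "connected (f ` {a..b})" using connected_continuous_image[OF cont] by simp
  have "(\<forall>t\<in>{a..b}. f t > 0) \<or> (\<forall>t\<in>{a..b}. f t < 0)"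
  proof (rule ccontr)
    assume "\<not> ?thesis"
    then obtain s t where "s \<in> {a..b}" "t \<in> {a..b}" "f s \<le> 0" "f t \<ge> 0" by (auto simp: not_less)
    then have "0 \<in> f ` {a..b}" using connectedD_interval[OF conn, of "f s" "f t" 0] by blast
    then show False using nz by auto
  qed
  then show False
  proof
    assume "\<forall>t\<in>{a..b}. f t > 0"
    then show False using sturm_positive[OF c b f f1 \<kappa>] by blast
  next
    assume n: "\<forall>t\<in>{a..b}. f t < 0"
    show False
    proof (rule sturm_positive[OF c b _ _ \<kappa>])
      show "((\<lambda>t. - f t) has_real_derivative - f1 t) (at t)" if "t \<in> {a..b}" for t
        using f[OF that] by (rule DERIV_minus)
      show "((\<lambda>t. - f1 t) has_real_derivative - \<kappa> t * (- f t)) (at t)" if "t \<in> {a..b}" for t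
        using DERIV_minus[OF f1[OF that]] by simp
      show "- f t > 0" if "t \<in> {a..b}" for t using n that by auto
    qed
  qed
qed


section \<open>The Berwald frame in charts\<close>

locale berwald_surface = finsler_surface X A F for X :: "'a topology" and A F +
  fixes K I :: "'a tvec \<Rightarrow> real" and H :: "'a vfield"
  assumes K_smooth: "smooth_fun A K"
    and frame: "berwald_frame A F K H I"
    and V_ricci: "\<forall>c\<in>A. \<forall>z\<in>slit_dom c.
      lie A (almost_tangent H) (ricci_scalar F K) c z = - I (tvec A c z) * ricci_scalar F K (tvec A c z)"
begin

abbreviation "V \<equiv> almost_tangent H"
abbreviation "S \<equiv> geodesic_spray A F"
definition "\<rho> c z = ricci_scalar F K (tvec A c z)"
definition "Ic c z = I (tvec A c z)"
definition "Kc c z = K (tvec A c z)"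
abbreviation "J c \<equiv> along (S c) (Ic c)"
abbreviation "a c z \<equiv> fst (H c z)"

lemma H_field: "vector_field A H" and I_smooth: "smooth_fun A I" and H_horizontal: "horizontal A S H"
  using frame unfolding berwald_frame_def Let_def by blast+

lemma V_field: "vector_field A V" by (rule vector_field_almost_tangent[OF H_field])

lemma Ic_scalar: "scalar Ic" using scalar_smooth_fun[OF I_smooth] by (simp add: Ic_def[abs_def])

lemma Kc_scalar: "scalar Kc" using scalar_smooth_fun[OF K_smooth] by (simp add: Kc_def[abs_def])

lemma \<rho>_eq: "\<rho> = (\<lambda>c z. Kc c z * (Fc c z * Fc c z))"
  by (simp add: fun_eq_iff \<rho>_def ricci_scalar_def Kc_def Fc_def power2_eq_square)

lemma \<rho>_scalar: "scalar \<rho>" unfolding \<rho>_eq by (intro scalar_mult Kc_scalar Fc_scalar)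

lemma S_smooth: "c \<in> A \<Longrightarrow> smooth_on (slit_dom c) (S c)"
  using finsler_chart.S_smooth[OF finsler_chart] .

lemma lie_along: "lie A Z f c z = along (Z c) (\<lambda>w. f (tvec A c w)) z"
  by (simp add: lie_def along_def)

lemma frame_at:
  assumes "c \<in> A" "z \<in> slit_dom c"
  shows "fd (Fc c) z (V c z) = 0"
    and "fd (H c) z (S c z) - fd (S c) z (H c z) = \<rho> c z *\<^sub>R V c z"
    and "fd (S c) z (V c z) - fd (V c) z (S c z) = H c z"
    and "fd (V c) z (H c z) - fd (H c) z (V c z) = S c z + Ic c z *\<^sub>R H c z + J c z *\<^sub>R V c z"
    and "along (V c) (\<rho> c) z = - Ic c z * \<rho> c z"
proof -
  have *: "lie A V F c z = 0 \<and> bracket S H c z = ricci_scalar F K (tvec A c z) *\<^sub>R V c z \<and> bracket V S c z = H c z \<and>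
     bracket H V c z = S c z + I (tvec A c z) *\<^sub>R H c z + lie A S I c z *\<^sub>R V c z"
    using frame assms unfolding berwald_frame_def Let_def by blast
  show "fd (Fc c) z (V c z) = 0" using * by (simp add: lie_def Fc_def[abs_def])
  show "fd (H c) z (S c z) - fd (S c) z (H c z) = \<rho> c z *\<^sub>R V c z" using * by (simp add: bracket_def \<rho>_def)
  show "fd (S c) z (V c z) - fd (V c) z (S c z) = H c z" using * by (simp add: bracket_def)
  show "fd (V c) z (H c z) - fd (H c) z (V c z) = S c z + Ic c z *\<^sub>R H c z + J c z *\<^sub>R V c z"
    using * by (simp add: bracket_def lie_along Ic_def[abs_def])
  show "along (V c) (\<rho> c) z = - Ic c z * \<rho> c z"
    using bspec[OF bspec[OF V_ricci assms(1)] assms(2)] by (simp add: lie_along \<rho>_def[abs_def] Ic_def)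
qed

lemma relations:
  assumes c: "c \<in> A" and O: "open W" "W \<subseteq> slit_dom c"
  shows "berwald_relations W (S c) (H c) (V c) (\<rho> c) (Ic c)"
proof
  show "open W" by (rule O)
  show "smooth_on W (S c)" by (rule smooth_on_subset[OF S_smooth[OF c] O(2)])
  show "smooth_on W (H c)" by (rule smooth_on_subset[OF vector_field_smooth[OF H_field c] O(2)])
  show "smooth_on W (V c)" by (rule smooth_on_subset[OF vector_field_smooth[OF V_field c] O(2)])
  show "smooth_on W (\<rho> c)" by (rule smooth_on_subset[OF scalar_smooth[OF \<rho>_scalar c] O(2)])
  show "smooth_on W (Ic c)" by (rule smooth_on_subset[OF scalar_smooth[OF Ic_scalar c] O(2)])
qed (use O frame_at[OF c] in blast)+

lemma a_diffble: "c \<in> A \<Longrightarrow> z \<in> slit_dom c \<Longrightarrow> a c differentiable (at z)"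
  by (rule smooth_onD[OF smooth_on_fst[OF slit_open vector_field_smooth[OF H_field]]])

lemma fd_V:
  assumes "c \<in> A" "z \<in> slit_dom c"
  shows "fd (V c) z v = (0, fd (a c) z v)"
proof -
  have "(V c has_derivative (\<lambda>v. (0, fd (a c) z v))) (at z)"
    unfolding almost_tangent_def
    by (intro has_derivative_Pair has_derivative_const fd_works a_diffble assms)
  then show ?thesis by (simp only: fd_eqI)
qed

lemma V_eq: "V c z = (0, a c z)" by (simp add: almost_tangent_def)

lemma S_eq: "S c z = (snd z, (- 2) *\<^sub>R spray_coeff A F c z)" by (simp add: geodesic_spray_def)

lemma fst_fd_H: "c \<in> A \<Longrightarrow> z \<in> slit_dom c \<Longrightarrow> fst (fd (H c) z v) = fd (a c) z v"
  using fd_bounded_linear[OF bounded_linear_fst smooth_onD[OF vector_field_smooth[OF H_field]]] by simp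

text \<open>
  The horizontal projector, written out in coordinates: only the first components of a field
  enter, and the fibre components are those of the nonlinear connection.
\<close>

lemma H_eq:
  assumes c: "c \<in> A" and z: "z \<in> slit_dom c"
  shows "H c z = (a c z, - fd (spray_coeff A F c) z (0, a c z))"
proof -
  obtain Z where Z: "vector_field A Z" "\<forall>c\<in>A. \<forall>z\<in>slit_dom c. H c z = horizontal_projector S Z c z"
    using H_horizontal unfolding horizontal_def by blast
  have HZ: "H c z = horizontal_projector S Z c z" using Z(2) c z by blast
  have dZ: "Z c differentiable (at z)" using smooth_onD[OF vector_field_smooth[OF Z(1) c] z] .
  have "(almost_tangent Z c has_derivative (\<lambda>v. (0, fst (fd (Z c) z v)))) (at z)"
    unfolding almost_tangent_def
    by (intro has_derivative_Pair has_derivative_const has_derivative_fst fd_works dZ)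
  then have JZ: "fd (almost_tangent Z c) z = (\<lambda>v. (0, fst (fd (Z c) z v)))" by (rule fd_eqI)
  have JZe: "almost_tangent Z c z = (0, fst (Z c z))" by (simp add: almost_tangent_def)
  note fdS = finsler_chart.fd_S[OF finsler_chart[OF c] z]
  have "horizontal_projector S Z c z = (fst (Z c z), - fd (spray_coeff A F c) z (0, fst (Z c z)))"
    by (simp add: horizontal_projector_def fn_bracket_def bracket_def JZ JZe fdS
        almost_tangent_def[of "\<lambda>c z. fd (S c) z (Z c z) - fd (Z c) z (S c z)"]
        almost_tangent_def[of "bracket Z S"] prod_eq_iff scaleR_2[symmetric] algebra_simps)
  then show ?thesis unfolding HZ by simp
qed

text \<open>
  The projection of \<open>H\<close> to the surface is parallel along geodesics.
\<close>

lemma S_a: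
  assumes c: "c \<in> A" and z: "z \<in> slit_dom c"
  shows "fd (a c) z (S c z) = (\<chi> i. - (\<Sum>j\<in>UNIV. nonlinear_conn A F c i j z * a c z $ j))"
proof -
  note fdS = finsler_chart.fd_S[OF finsler_chart[OF c] z]
  have "snd (fd (S c) z (V c z) - fd (V c) z (S c z)) = snd (H c z)" using frame_at(3)[OF c z] by simp
  then have "- (2 *\<^sub>R fd (spray_coeff A F c) z (0, a c z)) - fd (a c) z (S c z) = - fd (spray_coeff A F c) z (0, a c z)"
    unfolding fd_V[OF c z] fdS V_eq by (subst (asm) H_eq[OF c z]) simp
  then have "fd (a c) z (S c z) = - fd (spray_coeff A F c) z (0, a c z)"
    by (simp add: scaleR_2 algebra_simps)
  then show ?thesis unfolding finsler_chart.fd_spray_vertical[OF finsler_chart[OF c] z]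
    by (simp add: vec_eq_iff)
qed

text \<open>
  The first components of the relation for \<open>[H, V]\<close>. For \<open>I = 0\<close> they say that \<open>V\<close> rotates \<open>y\<close> and
  the projection of \<open>H\<close> into each other.
\<close>

lemma V_a:
  assumes c: "c \<in> A" and z: "z \<in> slit_dom c"
  shows "fd (a c) z (V c z) = - (snd z + Ic c z *\<^sub>R a c z)"
proof -
  have "fst (fd (V c) z (H c z) - fd (H c) z (V c z)) = fst (S c z + Ic c z *\<^sub>R H c z + J c z *\<^sub>R V c z)"
    using frame_at(4)[OF c z] by simp
  then have "- fd (a c) z (V c z) = snd z + Ic c z *\<^sub>R a c z"
    unfolding fst_diff fst_add fst_scaleR fst_fd_H[OF c z] fd_V[OF c z] by (simp add: V_eq S_eq)
  then show ?thesis by (simp add: minus_equation_iff[of "fd (a c) z (V c z)"])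
qed

lemma fd_L_V: assumes c: "c \<in> A" and z: "z \<in> slit_dom c" shows "fd (F2 A F c) z (0, a c z) = 0"
  using fd_F2[OF c z, of "V c z"] frame_at(1)[OF c z] by (simp add: V_eq)

lemma fd_L_C: assumes c: "c \<in> A" and z: "z \<in> slit_dom c" shows "fd (F2 A F c) z (0, snd z) = 2 * (Fc c z)\<^sup>2"
  using euler[OF finsler_chart.U_conic[OF finsler_chart[OF c]] z finsler_chart.L_smooth[OF finsler_chart[OF c]]
      finsler_chart.L_homogeneous[OF finsler_chart[OF c]]] by (simp add: F2_eq)

text \<open>
  The differential of \<open>F\<^sup>2\<close> in the fibre vanishes on the projection of \<open>H\<close> and is positive on
  \<open>y\<close>. If the projection were zero, then \<open>V\<close> would be zero too, contrary to \<open>V_a\<close>.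
\<close>

lemma independent:
  assumes c: "c \<in> A" and z: "z \<in> slit_dom c" 
  shows "snd z + t *\<^sub>R a c z \<noteq> 0" and "a c z \<noteq> 0"
proof -
  show ind: "snd z + t *\<^sub>R a c z \<noteq> 0" for t
  proof
    assume 0: "snd z + t *\<^sub>R a c z = 0"
    have lin: "linear (fd (F2 A F c) z)"
      by (rule fd_linear[OF smooth_onD[OF finsler_chart.L_smooth[OF finsler_chart[OF c]] z]])
    have e: "fd (F2 A F c) z ((0, snd z) + t *\<^sub>R (0, a c z)) = 2 * (Fc c z)\<^sup>2"
      unfolding linear_add[OF lin] linear_scale[OF lin] fd_L_V[OF c z] fd_L_C[OF c z] by simp
    have z0: "(0, snd z) + t *\<^sub>R (0, a c z) = 0" using 0 by (simp add: zero_prod_def)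
    show False using e Fc_pos[OF c z] unfolding z0 linear_0[OF lin] by simp
  qed
  show "a c z \<noteq> 0"
  proof
    assume "a c z = 0"
    then have "V c z = 0" by (simp add: V_eq zero_prod_def)
    then have "fd (a c) z (V c z) = 0" using linear_0[OF fd_linear[OF a_diffble[OF c z]]] by simp
    then show False using ind[of "Ic c z"] unfolding V_a[OF c z] neg_equal_0_iff_equal by (rule notE[rotated])
  qed
qed

lemma along_TT:
  fixes f :: "coords \<Rightarrow> real"
  assumes "vector_field A Z" "c \<in> A" "d \<in> A" "z \<in> overlap c d \<times> (- {0})" and f: "smooth_on (slit_dom d) f"
    and eq: "\<And>w. w \<in> overlap c d \<times> (- {0}) \<Longrightarrow> g w = f (TT c d w)"
  shows "along (Z d) f (TT c d z) = along (Z c) g z"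
  unfolding along_def vector_field_TT[OF assms(1-4)]
  by (rule fd_TT[OF assms(2-4) smooth_onD[OF f subsetD[OF overlap_slit TT_slit[OF assms(2-4)]]] eq])

text \<open>
  Let \<open>\<delta>\<close> be the difference of the sprays of two charts. All other terms in the bracket
  relations are chart independent. Therefore \<open>[H, V] = S + I H + S(I) V\<close> yields
  \<open>\<delta> = l V\<close> with \<open>l = - \<delta>(I)\<close>, and \<open>[S, H] = \<rho> V\<close> yields \<open>[\<delta>, H] = 0\<close>. The surface components of
  \<open>[l V, H]\<close> are those of \<open>- l (S + I H)\<close>, and \<open>y\<close> and the projection of \<open>H\<close> are independent; so \<open>l = 0\<close>.
\<close>

lemma spray_field: "vector_field A S"
  unfolding vector_field_def
proof (intro conjI ballI)
  fix c d and z :: coords assume c: "c \<in> A" and d: "d \<in> A" and z: "z \<in> overlap c d \<times> (- {0})"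
  let ?O = "overlap c d \<times> (- {0}) :: coords set"
  define T where "T = TT c d"
  have O: "open ?O" by (rule overlap_slit_open[OF c d])
  interpret c: berwald_relations ?O "S c" "H c" "V c" "\<rho> c" "Ic c" by (rule relations[OF c O overlap_slit])
  interpret d: berwald_relations "slit_dom d" "S d" "H d" "V d" "\<rho> d" "Ic d"
    by (rule relations[OF d slit_open[OF d]]) simp
  have Tin: "T w \<in> slit_dom d" if "w \<in> ?O" for w
    unfolding T_def by (rule subsetD[OF overlap_slit TT_slit[OF c d that]])
  have pull: "smooth_on ?O (\<lambda>w. f (T w))" if "smooth_on (slit_dom d) f" for f :: "coords \<Rightarrow> real"
    unfolding T_def
    by (rule smooth_on_compose[OF O slit_open[OF d] image_subsetI[OF Tin[unfolded T_def]] TT_smooth[OF c d] that])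
  have nat: "along (Z d) f (T w) = along (Z c) g w"
    if "vector_field A Z" "w \<in> ?O" "smooth_on (slit_dom d) f" "\<And>w. w \<in> ?O \<Longrightarrow> g w = f (T w)" for Z w and f g :: "coords \<Rightarrow> real"
    unfolding T_def by (rule along_TT[OF that(1) c d that(2,3)]) (use that(4) in \<open>simp add: T_def\<close>)
  \<comment> \<open>\<open>\<delta> f\<close> is the derivative of \<open>f\<close> along the difference of the two sprays.\<close>
  define \<delta> where "\<delta> f w = along (S d) f (T w) - along (S c) (\<lambda>w. f (T w)) w" for f :: "coords \<Rightarrow> real" and w
  define l where "l w = - \<delta> (Ic d) w" for w
  have I_T: "Ic d (T w) = Ic c w" if "w \<in> ?O" for w unfolding T_def by (rule scalar_TT[OF Ic_scalar c d that])
  have \<rho>_T: "\<rho> d (T w) = \<rho> c w" if "w \<in> ?O" for w unfolding T_def by (rule scalar_TT[OF \<rho>_scalar c d that])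
  have J_T: "J c w = along (S c) (\<lambda>w. Ic d (T w)) w" if "w \<in> ?O" for w
    by (rule along_cong[OF O that c.smooth(5)]) (simp add: I_T)
  have \<delta>: "\<delta> f w = l w * along (V d) f (T w)" if f: "smooth_on (slit_dom d) f" and w: "w \<in> ?O" for f w
  proof -
    let ?f = "\<lambda>w. f (T w)"
    note h = nat[OF H_field w f] and v = nat[OF V_field w f]
    have "along (H d) (along (V d) f) (T w) = along (H c) (along (V c) ?f) w"
      by (rule nat[OF H_field w d.along_frame_smooth(3)[OF f]]) (rule nat[OF V_field _ f, symmetric], auto)
    moreover have "along (V d) (along (H d) f) (T w) = along (V c) (along (H c) ?f) w"
      by (rule nat[OF V_field w d.along_frame_smooth(2)[OF f]]) (rule nat[OF H_field _ f, symmetric], auto)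
    moreover have "along (H d) f (T w) = along (H c) ?f w" by (rule h) simp
    moreover have "along (V d) f (T w) = along (V c) ?f w" by (rule v) simp
    ultimately show ?thesis
      using d.commute_H_V[OF f Tin[OF w]] c.commute_H_V[OF pull[OF f] w] I_T[OF w] J_T[OF w]
      by (simp add: \<delta>_def l_def algebra_simps)
  qed
  have l0: "l w = 0" if w: "w \<in> ?O" for w
  proof -
    have ls: "smooth_on ?O l"
      unfolding l_def \<delta>_def
      by (intro smooth_on_minus smooth_on_diff O pull d.along_frame_smooth c.along_frame_smooth d.smooth)
    have "l w * (snd (T w) + Ic d (T w) *\<^sub>R a d (T w)) $ i = 0" for i
    proof -
      define f where "f = (\<lambda>w::coords. fst w $ i)"
      have bl: "bounded_linear f"
        unfolding f_def by (rule bounded_linear_compose[OF bounded_linear_vec_nth bounded_linear_fst])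
      have f: "smooth_on (slit_dom d) f"
        by (rule smooth_on_linear[OF slit_open[OF d] bl smooth_on_ident[OF slit_open[OF d]]])
      have fdf: "along Z f x = fst (Z x) $ i" for Z x
        unfolding along_def using fd_bounded_linear[OF bl, of "\<lambda>x. x" x] by (simp add: f_def)
      let ?f = "\<lambda>w. f (T w)"
      have Vf: "along (V d) f x = 0" for x by (simp add: fdf V_eq)
      have "\<delta> (along (H d) f) w = along (H d) (along (S d) f) (T w) - along (H c) (along (S c) ?f) w"
      proof -
        have "along (S d) (along (H d) f) (T w) = along (H d) (along (S d) f) (T w)"
          using d.commute_S_H[OF f Tin[OF w]] by (simp add: Vf)
        moreover have "along (S c) (\<lambda>w. along (H d) f (T w)) w = along (S c) (along (H c) ?f) w"
          by (rule along_cong[OF O w pull[OF d.along_frame_smooth(2)[OF f]]]) (rule nat[OF H_field _ f], auto)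
        moreover have "along (V c) ?f w = 0" using nat[OF V_field w f, of ?f] by (simp add: Vf)
        ultimately show ?thesis using c.commute_S_H[OF pull[OF f] w] by (simp add: \<delta>_def)
      qed
      also have "along (H d) (along (S d) f) (T w) = along (H c) (\<lambda>w. along (S d) f (T w)) w"
        by (rule nat[OF H_field w d.along_frame_smooth(1)[OF f]]) simp
      also have "along (H c) (\<lambda>w. along (S d) f (T w)) w = along (H c) (along (S c) ?f) w"
        by (rule along_cong[OF O w pull[OF d.along_frame_smooth(1)[OF f]]]) (use \<delta>[OF f] in \<open>simp add: \<delta>_def Vf\<close>)
      finally have "l w * along (V d) (along (H d) f) (T w) = 0"
        unfolding \<delta>[OF d.along_frame_smooth(2)[OF f] w] by simp
      moreover have "along (H d) (along (V d) f) (T w) = 0"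
        using along_cong[OF slit_open[OF d] Tin[OF w] d.along_frame_smooth(3)[OF f], of "\<lambda>x. 0" "H d"] by (simp add: Vf) (simp add: along_def)
      ultimately have "l w * (along (S d) f (T w) + Ic d (T w) * along (H d) f (T w)) = 0"
        using d.commute_H_V[OF f Tin[OF w]] by (simp add: Vf) algebra
      then show ?thesis by (simp add: fdf S_eq)
    qed
    then have "l w *\<^sub>R (snd (T w) + Ic d (T w) *\<^sub>R a d (T w)) = 0" by (simp add: vec_eq_iff)
    then show ?thesis using independent(1)[OF d Tin[OF w]] by simp
  qed
  have "S d (T z) = fd T z (S c z)"
  proof (rule euclidean_eqI)
    fix b :: coords assume "b \<in> Basis"
    define f where "f = (\<lambda>w::coords. w \<bullet> b)"
    have bl: "bounded_linear f" unfolding f_def by (rule bounded_linear_inner_left)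
    have f: "smooth_on (slit_dom d) f"
      by (rule smooth_on_linear[OF slit_open[OF d] bl smooth_on_ident[OF slit_open[OF d]]])
    have "along (S d) f (T z) = S d (T z) \<bullet> b"
      unfolding along_def using fd_bounded_linear[OF bl, of "\<lambda>x. x"] by (simp add: f_def)
    moreover have "along (S c) (\<lambda>w. f (T w)) z = fd T z (S c z) \<bullet> b"
      unfolding along_def T_def
      using fd_bounded_linear[OF bl smooth_onD[OF TT_smooth[OF c d] z], of "S c z"] by (simp add: f_def)
    moreover have "\<delta> f z = 0" using \<delta>[OF f z] l0[OF z] by simp
    ultimately show "S d (T z) \<bullet> b = fd T z (S c z) \<bullet> b" by (simp add: \<delta>_def)
  qed
  then show "S d (TT c d z) = fd (TT c d) z (S c z)" by (simp add: T_def)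
qed (rule S_smooth)

section \<open>The Landsberg scalar vanishes\<close>

lemma slit_relations: "c \<in> A \<Longrightarrow> berwald_relations (slit_dom c) (S c) (H c) (V c) (\<rho> c) (Ic c)"
  by (rule relations[OF _ slit_open]) auto

lemma J_scalar: "scalar J" by (rule scalar_along[OF spray_field Ic_scalar])

lemma S_J: assumes c: "c \<in> A" and z: "z \<in> slit_dom c" shows "along (S c) (J c) z = 0"
proof -
  have "V c z \<noteq> 0" using independent(2)[OF c z] by (simp add: V_eq zero_prod_def)
  from berwald_relations.bianchi[OF slit_relations[OF c] z this]
  show ?thesis using frame_at(5)[OF c z] by simp
qed

text \<open>
  The maximum principle for \<open>I J\<close>, whose derivative along \<open>S\<close> is \<open>J\<^sup>2\<close>.
\<close>

lemma landsberg: assumes c: "c \<in> A" and z: "z \<in> slit_dom c" shows "J c z = 0"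
proof -
  have D: "along (S c) (\<lambda>z. Ic c z * J c z) z = J c z * J c z" if "c \<in> A" "z \<in> slit_dom c" for c z
    using along_mult[OF smooth_onD[OF scalar_smooth[OF Ic_scalar that(1)] that(2)]
        smooth_onD[OF scalar_smooth[OF J_scalar that(1)] that(2)], of "S c"] S_J[OF that] by simp
  have "along (S c) (\<lambda>z. Ic c z * J c z) z = 0"
  proof (rule maximum_principle(2)[of "\<lambda>c z. Ic c z * J c z" "Fc c z" S])
    show "scalar (\<lambda>c z. Ic c z * J c z)" by (rule scalar_mult[OF Ic_scalar J_scalar])
    show "Fc c z > 0" by (rule Fc_pos[OF c z])
    show "c \<in> A" by (rule c)
    show "z \<in> level (Fc c z) c" using z by (simp add: level_def)
    fix d w assume "d \<in> A" "w \<in> level (Fc c z) d"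
    then have dw: "d \<in> A" "w \<in> slit_dom d" by (simp_all add: level_def)
    show "fd (Fc d) w (S d w) = 0" by (rule spray_F[OF dw])
    show "Ic d w * J d w = 0" if "along (S d) (\<lambda>z. Ic d z * J d z) w = 0" using that D[OF dw] by simp
  qed
  then show ?thesis using D[OF c z] by simp
qed

lemma K_nonzero:
  assumes nf: "nonflat X A K" and d: "d \<in> A" and w: "w \<in> slit_dom d"
  shows "Kc d w \<noteq> 0"
proof -
  obtain q y where q: "q \<in> fst d" "y \<noteq> 0" "w = (snd d q, y)" by (rule slit_cases[OF w])
  show ?thesis using nf tvec_tangent(2)[OF d q(1,2)] by (simp add: nonflat_def Kc_def q(3))
qed

lemma \<rho>_level: "w \<in> level 1 d \<Longrightarrow> \<rho> d w = Kc d w"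
  by (simp add: \<rho>_eq level_def)

definition "VI c = along (V c) (Ic c)"
definition "HI c = along (H c) (Ic c)"

lemma VI_scalar: "scalar VI" using scalar_along[OF V_field Ic_scalar] by (simp add: VI_def[abs_def])
lemma HI_scalar: "scalar HI" using scalar_along[OF H_field Ic_scalar] by (simp add: HI_def[abs_def])

lemma S_VI: "c \<in> A \<Longrightarrow> z \<in> slit_dom c \<Longrightarrow> along (S c) (VI c) z = - HI c z"
  unfolding VI_def HI_def
  by (rule berwald_relations.landsberg_derivatives(1)[OF slit_relations landsberg])

lemma S_HI: "c \<in> A \<Longrightarrow> z \<in> slit_dom c \<Longrightarrow> along (S c) (HI c) z = \<rho> c z * VI c z"
  unfolding VI_def HI_def
  by (rule berwald_relations.landsberg_derivatives(2)[OF slit_relations landsberg])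

end


section \<open>Long geodesics\<close>

lemma has_vector_derivative_shift:
  "((\<lambda>s. f (s - t0)) has_vector_derivative v) (at t) \<longleftrightarrow> (f has_vector_derivative v) (at (t - t0 :: real))"
proof -
  have *: "((\<lambda>s. g (s + r)) has_vector_derivative v) (at t)" if "(g has_vector_derivative v) (at (t + r))" for g r t
  proof -
    have l: "((\<lambda>s. s + r) has_derivative (\<lambda>s. s)) (at t)" by (auto intro!: derivative_eq_intros)
    show ?thesis
      using has_derivative_compose[OF l, of g "\<lambda>h. h *\<^sub>R v"] that by (simp add: has_vector_derivative_def)
  qed
  show ?thesis using *[of f t "- t0"] *[of "\<lambda>s. f (s - t0)" "t - t0" t0] by auto
qed

lemma has_vector_derivative_continuous_on:
  assumes "\<And>s. s \<in> T \<Longrightarrow> (f has_vector_derivative f' s) (at s)"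
  shows "continuous_on T f"
  by (intro continuous_at_imp_continuous_on ballI has_vector_derivative_continuous[OF assms])

lemma has_vector_derivative_glue:
  assumes "(f has_vector_derivative v) (at t0)" "(g has_vector_derivative v) (at t0)" "f t0 = g (t0 :: real)"
  shows "((\<lambda>t. if t \<le> t0 then f t else g t) has_vector_derivative v) (at t0)"
proof -
  have "((\<lambda>x. if x \<in> {..t0} then f x else g x) has_vector_derivative (if t0 \<in> {..t0} then v else v)) (at t0 within UNIV)"
    by (rule has_vector_derivative_If_within_closures[where T = "{t0..}"])
      (use assms in \<open>auto intro: has_vector_derivative_at_within\<close>)
  then show ?thesis by simp
qed

lemma velocity_cong:
  assumes "open W" "t \<in> W" "\<And>s. s \<in> W \<Longrightarrow> \<eta> s = \<eta>' s"
  shows "velocity c \<eta> t = velocity c \<eta>' t"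
proof -
  have "eventually (\<lambda>s. s \<in> W) (nhds t)" using assms(1,2) by (rule eventually_nhds_in_open)
  then have "eventually (\<lambda>s. s \<in> UNIV \<longrightarrow> snd c (\<eta> s) = snd c (\<eta>' s)) (nhds t)"
    by eventually_elim (simp add: assms(3))
  from vector_derivative_cong_eq[OF this refl refl UNIV_I] show ?thesis
    using assms(2,3) by (simp add: velocity_def)
qed

lemma velocity_shift: "velocity c (\<lambda>s. \<eta> (s - t0)) t = velocity c \<eta> (t - t0)"
  by (simp add: velocity_def vector_derivative_def has_vector_derivative_shift[of "\<lambda>s. snd c (\<eta> s)"])

lemma fst_velocity: "fst (velocity c \<eta> t) = snd c (\<eta> t)" by (simp add: velocity_def)

context berwald_surface
begin

definition geodesic_in :: "'a chart \<Rightarrow> (real \<Rightarrow> 'a) \<Rightarrow> real \<Rightarrow> bool" where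
  "geodesic_in c \<eta> t \<longleftrightarrow> (velocity c \<eta> has_vector_derivative S c (velocity c \<eta> t)) (at t) \<and>
    Fc c (velocity c \<eta> t) = 1"

lemma unit_geodesic_iff:
  "unit_geodesic X A F T \<eta> \<longleftrightarrow> open T \<and> is_interval T \<and> continuous_map (top_of_set T) X \<eta> \<and>
     (\<forall>c\<in>A. \<forall>t\<in>T. \<eta> t \<in> fst c \<longrightarrow> geodesic_in c \<eta> t)"
  by (simp add: unit_geodesic_def geodesic_in_def Fc_def)

lemma geodesic_in_cong:
  assumes "open W" "t \<in> W" "\<And>s. s \<in> W \<Longrightarrow> \<eta> s = \<eta>' s" "geodesic_in c \<eta> t"
  shows "geodesic_in c \<eta>' t"
proof -
  have v: "velocity c \<eta> s = velocity c \<eta>' s" if "s \<in> W" for s by (rule velocity_cong[OF assms(1) that assms(3)])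
  have d: "(velocity c \<eta> has_vector_derivative S c (velocity c \<eta>' t)) (at t)" and F1: "Fc c (velocity c \<eta>' t) = 1"
    using assms(4) unfolding geodesic_in_def v[OF assms(2)] by blast+
  have "(velocity c \<eta>' has_vector_derivative S c (velocity c \<eta>' t)) (at t)"
    by (rule has_vector_derivative_transform_within_open[where f = "velocity c \<eta>", OF d assms(1,2) v])
  then show ?thesis unfolding geodesic_in_def using F1 by (rule conjI)
qed

lemma geodesic_in_shift: "geodesic_in c (\<lambda>s. \<eta> (s - t0)) t \<longleftrightarrow> geodesic_in c \<eta> (t - t0)"
  unfolding geodesic_in_def velocity_shift
  using has_vector_derivative_shift[of "velocity c \<eta>" t0] by (simp add: velocity_shift[abs_def])

lemma velocity_slit:
  assumes "c \<in> A" "\<eta> t \<in> fst c" "geodesic_in c \<eta> t"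
  shows "velocity c \<eta> t \<in> slit_dom c" and "velocity c \<eta> t \<in> level 1 c"
proof -
  have "snd (velocity c \<eta> t) \<noteq> 0"
  proof
    assume "snd (velocity c \<eta> t) = 0"
    then have "velocity c \<eta> t = (snd c (\<eta> t), 0)" by (simp add: velocity_def)
    then have "Fc c (velocity c \<eta> t) = 0" using Fc_zero[OF assms(1)] assms(2) by simp
    then show False using assms(3) by (simp add: geodesic_in_def)
  qed
  then show 1: "velocity c \<eta> t \<in> slit_dom c" using assms(2) by (simp add: slit_dom_def velocity_def)
  then show "velocity c \<eta> t \<in> level 1 c" using assms(3) by (simp add: level_def geodesic_in_def)
qed

lemma geodesic_in_base:
  assumes "geodesic_in c \<eta> t"
  shows "((\<lambda>s. snd c (\<eta> s)) has_vector_derivative snd (velocity c \<eta> t)) (at t)"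
proof -
  have "(velocity c \<eta> has_derivative (\<lambda>h. h *\<^sub>R S c (velocity c \<eta> t))) (at t)"
    using assms by (simp add: geodesic_in_def has_vector_derivative_def)
  from has_derivative_fst[OF this] show ?thesis
    by (simp add: has_vector_derivative_def fst_velocity S_eq)
qed

text \<open>
  The velocity of a curve transforms as a tangent vector, and the spray as a vector field, so
  the geodesic equation carries over.
\<close>

lemma geodesic_in_chart_change:
  assumes d: "d \<in> A" and c: "c \<in> A" and T: "open T" "\<And>s. s \<in> T \<Longrightarrow> \<eta> s \<in> fst d \<and> geodesic_in d \<eta> s"
    and t: "t \<in> T" "\<eta> t \<in> fst c"
  shows "geodesic_in c \<eta> t" and "velocity c \<eta> t = TT d c (velocity d \<eta> t)"
proof -
  let ?g = "\<lambda>s. snd d (\<eta> s)"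
  have base: "(?g has_vector_derivative snd (velocity d \<eta> s)) (at s)" if "s \<in> T" for s
    using geodesic_in_base T(2)[OF that] by blast
  have cont: "continuous_on T ?g"
    by (rule has_vector_derivative_continuous_on[OF base])
  define W where "W = {s \<in> T. ?g s \<in> overlap d c}"
  have W: "open W"
    using continuous_open_preimage[OF cont T(1) overlap_open[OF d c]] by (simp add: W_def vimage_def Int_def)
  have mem: "\<eta> s \<in> fst c" if "s \<in> W" for s
  proof -
    obtain q where q: "q \<in> fst d" "q \<in> fst c" "snd d (\<eta> s) = snd d q" using \<open>s \<in> W\<close> by (auto simp: W_def overlap_def)
    have "\<eta> s = q" using inj_onD[OF chart_inj[OF d] q(3)] T(2)[of s] \<open>s \<in> W\<close> q(1) by (simp add: W_def)
    then show ?thesis using q by simp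
  qed
  have WT: "s \<in> T" if "s \<in> W" for s using that by (simp add: W_def)
  have tW: "t \<in> W" using t T(2)[OF t(1)] by (simp add: W_def overlap_def)
  have slit: "velocity d \<eta> s \<in> overlap d c \<times> (- {0})" if "s \<in> W" for s
    using velocity_slit(1)[OF d] T(2)[OF WT[OF that]] that
    by (simp add: W_def slit_dom_def mem_Times_iff fst_velocity)
  have vel: "velocity c \<eta> s = TT d c (velocity d \<eta> s)" if s: "s \<in> W" for s
  proof -
    let ?v = "fd (transition d c) (snd d (\<eta> s)) (snd (velocity d \<eta> s))"
    have x: "snd d (\<eta> s) \<in> overlap d c" using s by (simp add: W_def)
    have dt: "transition d c differentiable (at (?g s))" by (rule smooth_onD[OF transition_smooth[OF d c] x])
    have "((\<lambda>r. transition d c (?g r)) has_derivative (\<lambda>h. fd (transition d c) (?g s) (h *\<^sub>R snd (velocity d \<eta> s)))) (at s)"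
      using base[OF WT[OF s]] unfolding has_vector_derivative_def
      by (rule has_derivative_compose[where f = ?g and g = "transition d c", OF _ fd_works[OF dt]])
    then have "((\<lambda>r. transition d c (?g r)) has_vector_derivative ?v) (at s)"
      by (simp add: has_vector_derivative_def linear_scale[OF fd_linear[OF dt]])
    then have "((\<lambda>r. snd c (\<eta> r)) has_vector_derivative ?v) (at s)"
    proof (rule has_vector_derivative_transform_within_open[OF _ W s])
      show "transition d c (?g r) = snd c (\<eta> r)" if "r \<in> W" for r
        using transition_eq[OF d] T(2)[OF WT[OF that]] by simp
    qed
    then have "velocity c \<eta> s = (snd c (\<eta> s), ?v)" by (simp add: velocity_def vector_derivative_at)
    also have "\<dots> = TT d c (velocity d \<eta> s)"
      using TT_eq[OF d, of "\<eta> s" c "snd (velocity d \<eta> s)"] T(2)[OF WT[OF s]] by (simp add: velocity_def)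
    finally show ?thesis .
  qed
  show "velocity c \<eta> t = TT d c (velocity d \<eta> t)" by (rule vel[OF tW])
  have dT: "TT d c differentiable (at (velocity d \<eta> t))" by (rule smooth_onD[OF TT_smooth[OF d c] slit[OF tW]])
  have "(velocity d \<eta> has_derivative (\<lambda>h. h *\<^sub>R S d (velocity d \<eta> t))) (at t)"
    using T(2)[OF t(1)] by (simp add: geodesic_in_def has_vector_derivative_def)
  from has_derivative_compose[OF this fd_works[OF dT]]
  have "((\<lambda>s. TT d c (velocity d \<eta> s)) has_vector_derivative S c (TT d c (velocity d \<eta> t))) (at t)"
    by (simp add: has_vector_derivative_def linear_scale[OF fd_linear[OF dT]] vector_field_TT[OF spray_field d c slit[OF tW]])
  then have "((\<lambda>s. TT d c (velocity d \<eta> s)) has_vector_derivative S c (velocity c \<eta> t)) (at t)"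
    unfolding vel[OF tW] .
  from has_vector_derivative_transform_within_open[where f = "\<lambda>s. TT d c (velocity d \<eta> s)", OF this W tW vel[symmetric]]
  have "(velocity c \<eta> has_vector_derivative S c (velocity c \<eta> t)) (at t)" .
  moreover have "Fc c (velocity c \<eta> t) = 1"
    using scalar_TT[OF Fc_scalar d c slit[OF tW]] T(2)[OF t(1)] vel[OF tW] by (simp add: geodesic_in_def)
  ultimately show "geodesic_in c \<eta> t" by (simp add: geodesic_in_def)
qed

text \<open>
  An integral curve of the spray is the velocity of its projection, because the surface
  components of the spray at \<open>(x, y)\<close> are \<open>y\<close>; its speed is constant, because \<open>S(F) = 0\<close>.
\<close>

lemma geodesic_of_flow:
  assumes d: "d \<in> A" and e: "e > 0"
    and \<phi>: "\<And>t. \<bar>t\<bar> < e \<Longrightarrow> \<phi> t \<in> slit_dom d \<and> (\<phi> has_vector_derivative S d (\<phi> t)) (at t)"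
    and 1: "Fc d (\<phi> 0) = 1"
  shows "\<exists>\<eta>. unit_geodesic X A F {-e<..<e} \<eta> \<and>
    (\<forall>t. \<bar>t\<bar> < e \<longrightarrow> \<eta> t \<in> fst d \<and> velocity d \<eta> t = \<phi> t \<and> geodesic_in d \<eta> t)"
proof -
  let ?T = "{-e<..<e}"
  define \<eta> where "\<eta> t = inv_into (fst d) (snd d) (fst (\<phi> t))" for t
  have in_T: "t \<in> ?T \<longleftrightarrow> \<bar>t\<bar> < e" for t by auto
  have x: "fst (\<phi> t) \<in> snd d ` fst d" if "t \<in> ?T" for t
    using \<phi>[of t] that unfolding in_T slit_dom_def mem_Times_iff by blast
  have \<eta>: "\<eta> t \<in> fst d" "snd d (\<eta> t) = fst (\<phi> t)" if "t \<in> ?T" for t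
    unfolding \<eta>_def by (rule inv_into_into[OF x[OF that]], rule f_inv_into_f[OF x[OF that]])
  have d\<phi>: "(\<phi> has_derivative (\<lambda>h. h *\<^sub>R S d (\<phi> t))) (at t)" if "t \<in> ?T" for t
    using \<phi>[of t] that unfolding in_T has_vector_derivative_def by blast
  have base: "((\<lambda>s. snd d (\<eta> s)) has_vector_derivative snd (\<phi> t)) (at t)" if "t \<in> ?T" for t
  proof (rule has_vector_derivative_transform_within_open[OF _ _ that])
    show "((\<lambda>s. fst (\<phi> s)) has_vector_derivative snd (\<phi> t)) (at t)"
      using has_derivative_fst[OF d\<phi>[OF that]] by (simp add: has_vector_derivative_def S_eq)
  qed (simp_all add: \<eta>(2))
  have vel: "velocity d \<eta> t = \<phi> t" if "t \<in> ?T" for t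
    using vector_derivative_at[OF base[OF that]] \<eta>(2)[OF that] by (simp add: velocity_def)
  have "((\<lambda>s. Fc d (\<phi> s)) has_vector_derivative 0) (at t within ?T)" if "t \<in> ?T" for t
  proof -
    have s: "\<phi> t \<in> slit_dom d" using \<phi>[of t] that unfolding in_T by blast
    have dF: "Fc d differentiable (at (\<phi> t))" by (rule smooth_onD[OF Fc_smooth[OF d] s])
    have "((\<lambda>s. Fc d (\<phi> s)) has_derivative (\<lambda>h. 0)) (at t)"
      using has_derivative_compose[OF d\<phi>[OF that] fd_works[OF dF]] spray_F[OF d s]
      by (simp add: linear_scale[OF fd_linear[OF dF]])
    then show ?thesis by (simp add: has_vector_derivative_def has_derivative_at_withinI)
  qed
  then obtain k where "\<And>t. t \<in> ?T \<Longrightarrow> Fc d (\<phi> t) = k"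
    using has_vector_derivative_zero_constant[of ?T "\<lambda>s. Fc d (\<phi> s)"] convex_real_interval by blast
  then have F1: "Fc d (\<phi> t) = 1" if "t \<in> ?T" for t using 1 e that by (metis greaterThanLessThan_iff neg_less_0_iff_less)
  have geo: "geodesic_in d \<eta> t" if "t \<in> ?T" for t
    unfolding geodesic_in_def vel[OF that]
    using has_vector_derivative_transform_within_open[OF _ _ that vel[symmetric]] \<phi>[of t] F1[OF that] that in_T by simp
  have res: "\<eta> t \<in> fst d \<and> velocity d \<eta> t = \<phi> t \<and> geodesic_in d \<eta> t" if "\<bar>t\<bar> < e" for t
    using \<eta>(1) vel geo that in_T by blast
  have "continuous_map (top_of_set ?T) X \<eta>"
    unfolding continuous_map_alt topspace_euclidean_subtopology
  proof (intro conjI allI impI)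
    show "\<eta> \<in> ?T \<rightarrow> topspace X" using \<eta>(1) chart_subset[OF d] by blast
    fix W assume W: "openin X W"
    have o: "open (snd d ` (W \<inter> fst d))"
      by (rule chart_open_image[OF d openin_Int[OF W chart(1)[OF d]]]) simp
    have "continuous_on ?T (\<lambda>s. snd d (\<eta> s))"
      by (rule has_vector_derivative_continuous_on[OF base])
    from continuous_open_preimage[OF this _ o]
    have "open (?T \<inter> (\<lambda>s. snd d (\<eta> s)) -` (snd d ` (W \<inter> fst d)))" by simp
    moreover have "?T \<inter> (\<lambda>s. snd d (\<eta> s)) -` (snd d ` (W \<inter> fst d)) = \<eta> -` W \<inter> ?T"
      using \<eta>(1) inj_onD[OF chart_inj[OF d]] by fastforce
    ultimately show "openin (top_of_set ?T) (\<eta> -` W \<inter> ?T)" by (simp add: openin_open_eq)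
  qed
  moreover have "geodesic_in c \<eta> t" if "c \<in> A" "t \<in> ?T" "\<eta> t \<in> fst c" for c t
    by (rule geodesic_in_chart_change(1)[where \<eta> = \<eta>, OF d that(1) _ _ that(2,3)]) (use \<eta>(1) geo in auto)
  ultimately have "unit_geodesic X A F ?T \<eta>"
    unfolding unit_geodesic_iff by (simp add: is_interval_oo)
  then show ?thesis using res by blast
qed

text \<open>
  The unit sphere bundle is covered by finitely many compact sets inside charts, each with a
  common existence time for the flow of the spray.
\<close>

lemma uniform_geodesics:
  obtains e where "e > 0" "\<And>c z. c \<in> A \<Longrightarrow> z \<in> level 1 c \<Longrightarrow>
    \<exists>\<eta>. unit_geodesic X A F {-e<..<e} \<eta> \<and> \<eta> 0 \<in> fst c \<and> velocity c \<eta> 0 = z"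
proof -
  obtain Q where Q: "finite Q" "\<And>q. q \<in> Q \<Longrightarrow> fst q \<in> A \<and> compact (snd q) \<and> snd q \<subseteq> level 1 (fst q)"
    "\<And>d w. d \<in> A \<Longrightarrow> w \<in> level 1 d \<Longrightarrow> \<exists>q\<in>Q. w \<in> overlap d (fst q) \<times> (- {0}) \<and> TT d (fst q) w \<in> snd q"
    by (rule level_cover[of 1]) (simp, blast)
  have "\<exists>e>0. \<forall>w\<in>snd q. \<exists>\<phi>. \<phi> 0 = w \<and> (\<forall>t. \<bar>t\<bar> < e \<longrightarrow> \<phi> t \<in> slit_dom (fst q) \<and>
      (\<phi> has_vector_derivative S (fst q) (\<phi> t)) (at t))" if q: "q \<in> Q" for q
  proof -
    have qA: "fst q \<in> A" "compact (snd q)" "snd q \<subseteq> slit_dom (fst q)" using Q(2)[OF q] by (auto simp: level_def)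
    obtain e where "e > 0" "\<And>w. w \<in> snd q \<Longrightarrow> \<exists>\<phi>. \<phi> 0 = w \<and> (\<forall>t. \<bar>t\<bar> < e \<longrightarrow> \<phi> t \<in> slit_dom (fst q) \<and>
      (\<phi> has_vector_derivative S (fst q) (\<phi> t)) (at t))"
      by (rule uniform_local_flow[OF slit_open[OF qA(1)] qA(2,3) S_smooth[OF qA(1)]]) blast
    then show ?thesis by blast
  qed
  then have "\<forall>q\<in>Q. \<exists>e. e > 0 \<and> (\<forall>w\<in>snd q. \<exists>\<phi>. \<phi> 0 = w \<and> (\<forall>t. \<bar>t\<bar> < e \<longrightarrow> \<phi> t \<in> slit_dom (fst q) \<and>
      (\<phi> has_vector_derivative S (fst q) (\<phi> t)) (at t)))" by blast
  from bchoice[OF this] obtain \<epsilon> where \<epsilon>: "\<And>q. q \<in> Q \<Longrightarrow> \<epsilon> q > (0::real)"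
    "\<And>q w. q \<in> Q \<Longrightarrow> w \<in> snd q \<Longrightarrow> \<exists>\<phi>. \<phi> 0 = w \<and> (\<forall>t. \<bar>t\<bar> < \<epsilon> q \<longrightarrow> \<phi> t \<in> slit_dom (fst q) \<and>
      (\<phi> has_vector_derivative S (fst q) (\<phi> t)) (at t))" by blast
  define e where "e = Min (insert 1 (\<epsilon> ` Q))"
  have e: "e > 0" unfolding e_def using Q(1) \<epsilon>(1) by (subst Min_gr_iff) auto
  have le: "e \<le> \<epsilon> q" if "q \<in> Q" for q unfolding e_def using Q(1) that by (intro Min_le) auto
  show ?thesis
  proof
    show "e > 0" by (rule e)
    fix c z assume c: "c \<in> A" and z: "z \<in> level 1 c"
    obtain q where q: "q \<in> Q" "z \<in> overlap c (fst q) \<times> (- {0})" "TT c (fst q) z \<in> snd q" using Q(3)[OF c z] by blast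
    have d: "fst q \<in> A" using Q(2)[OF q(1)] by simp
    obtain \<phi> where \<phi>: "\<phi> 0 = TT c (fst q) z" "\<And>t. \<bar>t\<bar> < \<epsilon> q \<Longrightarrow> \<phi> t \<in> slit_dom (fst q) \<and>
      (\<phi> has_vector_derivative S (fst q) (\<phi> t)) (at t)" using \<epsilon>(2)[OF q(1,3)] by blast
    have F1: "Fc (fst q) (\<phi> 0) = 1"
      using scalar_TT[OF Fc_scalar c d q(2)] z unfolding \<phi>(1) by (simp add: level_def)
    have \<phi>e: "\<phi> t \<in> slit_dom (fst q) \<and> (\<phi> has_vector_derivative S (fst q) (\<phi> t)) (at t)" if "\<bar>t\<bar> < e" for t
      using \<phi>(2)[of t] le[OF q(1)] that by simp
    obtain \<eta> where \<eta>: "unit_geodesic X A F {-e<..<e} \<eta>"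
       "\<And>t. \<bar>t\<bar> < e \<Longrightarrow> \<eta> t \<in> fst (fst q) \<and> velocity (fst q) \<eta> t = \<phi> t \<and> geodesic_in (fst q) \<eta> t"
      using geodesic_of_flow[OF d e \<phi>e F1] by blast
    have z0: "\<eta> 0 \<in> fst (fst q)" "velocity (fst q) \<eta> 0 = TT c (fst q) z" using \<eta>(2)[of 0] e \<phi>(1) by simp_all
    have "fst z \<in> snd c ` (fst c \<inter> fst (fst q))" using q(2) unfolding overlap_def mem_Times_iff by blast
    then obtain x where x: "x \<in> fst c" "x \<in> fst (fst q)" "fst z = snd c x" by blast
    have "snd (fst q) (\<eta> 0) = snd (fst q) x"
      using fst_velocity[of "fst q" \<eta> 0] z0(2) TT_eq[OF c x(1), of "fst q" "snd z"] x(3) by (metis fst_conv prod.collapse)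
    then have "\<eta> 0 = x" using inj_onD[OF chart_inj[OF d]] z0(1) x(2) by blast
    then have in_c: "\<eta> 0 \<in> fst c" using x by simp
    have "velocity c \<eta> 0 = TT (fst q) c (velocity (fst q) \<eta> 0)"
      by (rule geodesic_in_chart_change(2)[of "fst q" c "{-e<..<e}"]) (use d c e \<eta>(2) in_c in auto)
    also have "\<dots> = z" unfolding z0(2) by (rule TT_inverse[OF c d]) (use q(2) in auto)
    finally show "\<exists>\<eta>. unit_geodesic X A F {-e<..<e} \<eta> \<and> \<eta> 0 \<in> fst c \<and> velocity c \<eta> 0 = z"
      using \<eta>(1) in_c by blast
  qed
qed

lemma unit_geodesic_shift:
  assumes "unit_geodesic X A F {\<alpha><..<b} \<eta>"
  shows "unit_geodesic X A F {\<alpha> + t0<..<b + t0} (\<lambda>s. \<eta> (s - t0))"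
proof -
  have "continuous_map (top_of_set {\<alpha> + t0<..<b + t0}) (top_of_set {\<alpha><..<b}) (\<lambda>s. s - t0)"
    by (auto simp: continuous_map_in_subtopology intro!: continuous_intros)
  from continuous_map_compose[OF this, of X \<eta>] assms show ?thesis
    unfolding unit_geodesic_iff by (auto simp: geodesic_in_shift o_def is_interval_oo)
qed

text \<open>
  Both one-sided derivatives exist at the joint and agree, first for the position and then for
  the velocity, since the two geodesics have the same velocity there.
\<close>

lemma unit_geodesic_glue:
  assumes \<eta>1: "unit_geodesic X A F {\<alpha><..<b} \<eta>1" and \<eta>2: "unit_geodesic X A F {l<..<r} \<eta>2"
    and t0: "\<alpha> < t0" "t0 < b" "l < t0" "t0 < r"
    and c: "c \<in> A" "\<eta>1 t0 \<in> fst c" "\<eta>2 t0 \<in> fst c" "velocity c \<eta>1 t0 = velocity c \<eta>2 t0"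
  shows "unit_geodesic X A F {\<alpha><..<r} (\<lambda>t. if t \<le> t0 then \<eta>1 t else \<eta>2 t)" (is "unit_geodesic X A F ?T ?\<eta>")
proof -
  have eq: "\<eta>1 t0 = \<eta>2 t0"
    using inj_onD[OF chart_inj[OF c(1)] _ c(2,3)] arg_cong[OF c(4), of fst] by (simp add: fst_velocity)
  have cont: "continuous_map (top_of_set ?T) X ?\<eta>"
  proof (rule continuous_map_cases_le)
    show "continuous_map (subtopology (top_of_set ?T) {x \<in> topspace (top_of_set ?T). x \<le> t0}) X \<eta>1"
      using \<eta>1 t0 unfolding unit_geodesic_iff subtopology_subtopology
      by (elim conjE continuous_map_from_subtopology_mono) auto
    show "continuous_map (subtopology (top_of_set ?T) {x \<in> topspace (top_of_set ?T). t0 \<le> x}) X \<eta>2"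
      using \<eta>2 t0 unfolding unit_geodesic_iff subtopology_subtopology
      by (elim conjE continuous_map_from_subtopology_mono) auto
  qed (use eq in \<open>auto intro: continuous_map_from_subtopology\<close>)
  have g1: "geodesic_in d \<eta>1 t" if "d \<in> A" "t \<in> {\<alpha><..<b}" "\<eta>1 t \<in> fst d" for d t
    using \<eta>1 that unfolding unit_geodesic_iff by blast
  have g2: "geodesic_in d \<eta>2 t" if "d \<in> A" "t \<in> {l<..<r}" "\<eta>2 t \<in> fst d" for d t
    using \<eta>2 that unfolding unit_geodesic_iff by blast
  have "geodesic_in d ?\<eta> t" if d: "d \<in> A" and t: "t \<in> ?T" and \<eta>t: "?\<eta> t \<in> fst d" for d t
  proof -
    consider "t < t0" | "t > t0" | "t = t0" by linarith
    then show ?thesis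
    proof cases
      case 1
      show ?thesis
        by (rule geodesic_in_cong[of "{\<alpha><..<t0}" t \<eta>1]) (use 1 t t0 \<eta>t g1[OF d] in auto)
    next
      case 2
      show ?thesis
        by (rule geodesic_in_cong[of "{t0<..<r}" t \<eta>2]) (use 2 t t0 \<eta>t g2[OF d] in auto)
    next
      case 3
      have in_d: "\<eta>1 t0 \<in> fst d" "\<eta>2 t0 \<in> fst d" using \<eta>t 3 eq by auto
      have open_c: "\<exists>W. open W \<and> t0 \<in> W \<and> W \<subseteq> {lo<..<hi} \<and> (\<forall>s\<in>W. \<eta> s \<in> fst c)"
        if "unit_geodesic X A F {lo<..<hi} \<eta>" "lo < t0" "t0 < hi" "\<eta> t0 \<in> fst c" for \<eta> lo hi
      proof -
        have "continuous_map (top_of_set {lo<..<hi}) X \<eta>" using that(1) unfolding unit_geodesic_iff by blast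
        from openin_continuous_map_preimage[OF this chart(1)[OF c(1)]]
        have "open {s \<in> {lo<..<hi}. \<eta> s \<in> fst c}" by (simp add: openin_open_eq)
        then show ?thesis using that by (intro exI[of _ "{s \<in> {lo<..<hi}. \<eta> s \<in> fst c}"]) auto
      qed
      obtain W1 where W1: "open W1" "t0 \<in> W1" "W1 \<subseteq> {\<alpha><..<b}" "\<And>s. s \<in> W1 \<Longrightarrow> \<eta>1 s \<in> fst c"
        using open_c[OF \<eta>1 t0(1,2) c(2)] by blast
      obtain W2 where W2: "open W2" "t0 \<in> W2" "W2 \<subseteq> {l<..<r}" "\<And>s. s \<in> W2 \<Longrightarrow> \<eta>2 s \<in> fst c"
        using open_c[OF \<eta>2 t0(3,4) c(3)] by blast
      have v1: "velocity d \<eta>1 t0 = TT c d (velocity c \<eta>1 t0)"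
        by (rule geodesic_in_chart_change(2)[where \<eta> = \<eta>1, OF c(1) d W1(1) _ W1(2) in_d(1)]) (use W1 g1[OF c(1)] in blast)
      have v2: "velocity d \<eta>2 t0 = TT c d (velocity c \<eta>2 t0)"
        by (rule geodesic_in_chart_change(2)[where \<eta> = \<eta>2, OF c(1) d W2(1) _ W2(2) in_d(2)]) (use W2 g2[OF c(1)] in blast)
      have vd: "velocity d \<eta>1 t0 = velocity d \<eta>2 t0" using v1 v2 c(4) by simp
      have G1: "geodesic_in d \<eta>1 t0" using g1[OF d] t0 in_d by simp
      have G2: "geodesic_in d \<eta>2 t0" using g2[OF d] t0 in_d by simp
      have "((\<lambda>s. if s \<le> t0 then snd d (\<eta>1 s) else snd d (\<eta>2 s)) has_vector_derivative snd (velocity d \<eta>1 t0)) (at t0)"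
        by (rule has_vector_derivative_glue) (use geodesic_in_base[OF G1] geodesic_in_base[OF G2] vd eq in simp_all)
      then have "((\<lambda>s. snd d (?\<eta> s)) has_vector_derivative snd (velocity d \<eta>1 t0)) (at t0)"
        by (simp add: if_distrib[of "snd d"])
      then have vt0: "velocity d ?\<eta> t0 = velocity d \<eta>1 t0"
        by (simp add: velocity_def vector_derivative_at)
      have vel: "velocity d ?\<eta> s = (if s \<le> t0 then velocity d \<eta>1 s else velocity d \<eta>2 s)" for s
      proof -
        consider "s < t0" | "s > t0" | "s = t0" by linarith
        then show ?thesis
        proof cases
          case 1 then show ?thesis using velocity_cong[of "{..<t0}" s ?\<eta> \<eta>1] by simp
        next
          case 2 then show ?thesis using velocity_cong[of "{t0<..}" s ?\<eta> \<eta>2] by simp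
        next
          case 3 then show ?thesis using vt0 by simp
        qed
      qed
      have "((\<lambda>s. if s \<le> t0 then velocity d \<eta>1 s else velocity d \<eta>2 s) has_vector_derivative S d (velocity d \<eta>1 t0)) (at t0)"
        by (rule has_vector_derivative_glue) (use G1 G2 vd in \<open>simp_all add: geodesic_in_def\<close>)
      then have "(velocity d ?\<eta> has_vector_derivative S d (velocity d ?\<eta> t0)) (at t0)"
        unfolding vel[abs_def] by simp
      then show ?thesis using G1 vt0 unfolding 3 by (simp add: geodesic_in_def)
    qed
  qed
  then show ?thesis unfolding unit_geodesic_iff using cont by (simp add: is_interval_oo)
qed

text \<open>
  With the uniform existence time \<open>e\<close>, a geodesic is prolonged by \<open>e / 2\<close> beyond its end by
  restarting it at time \<open>e / 2\<close> before the end.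
\<close>

lemma long_geodesic:
  assumes c: "c \<in> A" and z: "z \<in> level 1 c"
  obtains e \<eta> where "e > 0" "unit_geodesic X A F {-e<..<R} \<eta>" "\<eta> 0 \<in> fst c" "velocity c \<eta> 0 = z"
proof -
  obtain e where e: "e > 0" and local: "\<And>c z. c \<in> A \<Longrightarrow> z \<in> level 1 c \<Longrightarrow>
    \<exists>\<eta>. unit_geodesic X A F {-e<..<e} \<eta> \<and> \<eta> 0 \<in> fst c \<and> velocity c \<eta> 0 = z"
    by (rule uniform_geodesics) blast
  have long: "\<exists>\<eta>. unit_geodesic X A F {-e<..<e + n * (e / 2)} \<eta> \<and> \<eta> 0 \<in> fst c \<and> velocity c \<eta> 0 = z" for n :: nat
  proof (induction n)
    case 0
    then show ?case using local[OF c z] by simp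
  next
    case (Suc n)
    then obtain \<eta>1 where \<eta>1: "unit_geodesic X A F {-e<..<e + n * (e / 2)} \<eta>1" "\<eta>1 0 \<in> fst c" "velocity c \<eta>1 0 = z" by blast
    \<comment> \<open>A time inside the interval of \<open>\<eta>1\<close>, at distance \<open>e / 2\<close> from its end.\<close>
    define t0 where "t0 = Suc n * (e / 2)"
    have t0: "-e < t0" "t0 < e + n * (e / 2)" "0 < t0"
      using e mult_nonneg_nonneg[of e "real n"] by (simp_all add: t0_def algebra_simps add_nonneg_pos add_pos_nonneg)
    have "\<eta>1 t0 \<in> topspace X"
      using \<eta>1(1) t0 unfolding unit_geodesic_iff continuous_map_def by auto
    then obtain d where d: "d \<in> A" "\<eta>1 t0 \<in> fst d" using chart_cover by blast
    have "geodesic_in d \<eta>1 t0" using \<eta>1(1) d t0 unfolding unit_geodesic_iff by simp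
    then have lev: "velocity d \<eta>1 t0 \<in> level 1 d" by (rule velocity_slit(2)[where \<eta> = \<eta>1, OF d])
    obtain \<eta>2 where \<eta>2: "unit_geodesic X A F {-e<..<e} \<eta>2" "\<eta>2 0 \<in> fst d" "velocity d \<eta>2 0 = velocity d \<eta>1 t0"
      using local[OF d(1) lev] by blast
    let ?\<eta>2 = "\<lambda>s. \<eta>2 (s - t0)"
    let ?\<eta> = "\<lambda>t. if t \<le> t0 then \<eta>1 t else ?\<eta>2 t"
    have "unit_geodesic X A F {-e<..<e + t0} ?\<eta>"
      by (rule unit_geodesic_glue[OF \<eta>1(1) unit_geodesic_shift[OF \<eta>2(1)] t0(1,2) _ _ d])
        (use e \<eta>2 in \<open>simp_all add: velocity_shift\<close>)
    moreover have "velocity c ?\<eta> 0 = velocity c \<eta>1 0"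
      by (rule velocity_cong[of "{..<t0}"]) (use t0 in auto)
    ultimately show ?case using \<eta>1 t0 by (intro exI[of _ ?\<eta>]) (simp add: t0_def)
  qed
  obtain n :: nat where n: "R / (e / 2) < n" using reals_Archimedean2 by blast
  then have "R < e + n * (e / 2)" using e by (simp add: field_simps)
  moreover obtain \<eta> where \<eta>: "unit_geodesic X A F {-e<..<e + n * (e / 2)} \<eta>" "\<eta> 0 \<in> fst c" "velocity c \<eta> 0 = z"
    using long by blast
  ultimately have "unit_geodesic X A F {-e<..<R} \<eta>"
    unfolding unit_geodesic_iff
    by (auto simp: is_interval_oo elim!: continuous_map_from_subtopology_mono)
  then show ?thesis using that e \<eta> by blast
qed

end


section \<open>Jacobi fields from the main scalar\<close>

context berwald_surface
begin

text \<open>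
  The value of a function on the slit tangent bundle at the velocity of a curve, read off in any
  chart around the point of the curve.
\<close>

definition along_curve :: "('a chart \<Rightarrow> coords \<Rightarrow> real) \<Rightarrow> (real \<Rightarrow> 'a) \<Rightarrow> real \<Rightarrow> real" where
  "along_curve g \<eta> t = (let c = (SOME c. c \<in> A \<and> \<eta> t \<in> fst c) in g c (velocity c \<eta> t))"

lemma geodesic_chart_open:
  assumes \<eta>: "unit_geodesic X A F T \<eta>" and c: "c \<in> A"
  shows "open {s \<in> T. \<eta> s \<in> fst c}"
proof -
  have "continuous_map (top_of_set T) X \<eta>" "open T" using \<eta> unfolding unit_geodesic_iff by blast+
  from openin_continuous_map_preimage[OF this(1) chart(1)[OF c]] this(2) show ?thesis
    by (simp add: openin_open_eq)
qed

lemma geodesic_at: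
  assumes \<eta>: "unit_geodesic X A F T \<eta>" and t: "t \<in> T" and c: "c \<in> A" "\<eta> t \<in> fst c"
  shows "geodesic_in c \<eta> t" and "velocity c \<eta> t \<in> slit_dom c" and "velocity c \<eta> t \<in> level 1 c"
    and "(velocity c \<eta> has_vector_derivative S c (velocity c \<eta> t)) (at t)"
proof -
  show g: "geodesic_in c \<eta> t" using \<eta> t c unfolding unit_geodesic_iff by blast
  show "velocity c \<eta> t \<in> slit_dom c" "velocity c \<eta> t \<in> level 1 c" by (rule velocity_slit[OF c(1), of \<eta> t, OF c(2) g])+
  show "(velocity c \<eta> has_vector_derivative S c (velocity c \<eta> t)) (at t)" using g by (simp add: geodesic_in_def)
qed

lemma geodesic_velocity_change:
  assumes \<eta>: "unit_geodesic X A F T \<eta>" and t: "t \<in> T" and c: "c \<in> A" "\<eta> t \<in> fst c" and d: "d \<in> A" "\<eta> t \<in> fst d"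
  shows "velocity d \<eta> t = TT c d (velocity c \<eta> t)" and "velocity c \<eta> t \<in> overlap c d \<times> (- {0})"
proof -
  show "velocity d \<eta> t = TT c d (velocity c \<eta> t)"
  proof (rule geodesic_in_chart_change(2)[where \<eta> = \<eta>, OF c(1) d(1) geodesic_chart_open[OF \<eta> c(1)] _ _ d(2)])
    show "\<eta> s \<in> fst c \<and> geodesic_in c \<eta> s" if "s \<in> {s \<in> T. \<eta> s \<in> fst c}" for s
      using geodesic_at(1)[OF \<eta> _ c(1)] that by blast
    show "t \<in> {s \<in> T. \<eta> s \<in> fst c}" using t c by blast
  qed
  show "velocity c \<eta> t \<in> overlap c d \<times> (- {0})"
    using geodesic_at(2)[OF \<eta> t c] c d by (auto simp: velocity_def slit_dom_def overlap_def)
qed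

lemma along_curve_eq:
  assumes g: "scalar g" and \<eta>: "unit_geodesic X A F T \<eta>" and t: "t \<in> T" and c: "c \<in> A" "\<eta> t \<in> fst c"
  shows "along_curve g \<eta> t = g c (velocity c \<eta> t)"
proof -
  define d where "d = (SOME d. d \<in> A \<and> \<eta> t \<in> fst d)"
  have d: "d \<in> A" "\<eta> t \<in> fst d" unfolding d_def using someI[of "\<lambda>d. d \<in> A \<and> \<eta> t \<in> fst d" c] c by blast+
  show ?thesis
    using scalar_TT[OF g c(1) d(1) geodesic_velocity_change(2)[OF \<eta> t c d]] geodesic_velocity_change(1)[OF \<eta> t c d]
    by (simp add: along_curve_def d_def[symmetric])
qed

lemma chart_at:
  assumes \<eta>: "unit_geodesic X A F T \<eta>" and t: "t \<in> T"
  obtains c where "c \<in> A" "\<eta> t \<in> fst c"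
proof -
  have "\<eta> t \<in> topspace X" using \<eta> t unfolding unit_geodesic_iff continuous_map_def by auto
  then show ?thesis using chart_cover that by blast
qed

lemma velocity_compose_derivative:
  fixes h :: "coords \<Rightarrow> 'b::real_normed_vector"
  assumes \<eta>: "unit_geodesic X A F T \<eta>" and t: "t \<in> T" and c: "c \<in> A" "\<eta> t \<in> fst c"
    and h: "h differentiable (at (velocity c \<eta> t))"
  shows "((\<lambda>s. h (velocity c \<eta> s)) has_vector_derivative along (S c) h (velocity c \<eta> t)) (at t)"
proof -
  have "(velocity c \<eta> has_derivative (\<lambda>r. r *\<^sub>R S c (velocity c \<eta> t))) (at t)"
    using geodesic_at(4)[OF \<eta> t c] by (simp add: has_vector_derivative_def)
  from has_derivative_compose[OF this fd_works[OF h]] show ?thesis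
    by (simp add: has_vector_derivative_def along_def linear_scale[OF fd_linear[OF h]])
qed

lemma along_curve_derivative:
  assumes g: "scalar g" and \<eta>: "unit_geodesic X A F T \<eta>" and t: "t \<in> T"
  shows "(along_curve g \<eta> has_real_derivative along_curve (\<lambda>c. along (S c) (g c)) \<eta> t) (at t)"
proof -
  obtain c where c: "c \<in> A" "\<eta> t \<in> fst c" by (rule chart_at[OF \<eta> t])
  have dg: "g c differentiable (at (velocity c \<eta> t))"
    by (rule smooth_onD[OF scalar_smooth[OF g c(1)] geodesic_at(2)[OF \<eta> t c]])
  have "(along_curve g \<eta> has_vector_derivative along (S c) (g c) (velocity c \<eta> t)) (at t)"
  proof (rule has_vector_derivative_transform_within_open[OF velocity_compose_derivative[OF \<eta> t c dg] geodesic_chart_open[OF \<eta> c(1)]])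
    show "t \<in> {s \<in> T. \<eta> s \<in> fst c}" using t c by simp
    show "g c (velocity c \<eta> s) = along_curve g \<eta> s" if "s \<in> {s \<in> T. \<eta> s \<in> fst c}" for s
      using along_curve_eq[OF g \<eta> _ c(1), of s] that by simp
  qed
  then show ?thesis
    using along_curve_eq[OF scalar_along[OF spray_field g] \<eta> t c]
    by (simp add: has_real_derivative_iff_has_vector_derivative)
qed

lemma along_curve_VI:
  assumes \<eta>: "unit_geodesic X A F T \<eta>" and t: "t \<in> T"
  shows "(along_curve VI \<eta> has_real_derivative - along_curve HI \<eta> t) (at t)"
proof -
  obtain d where d: "d \<in> A" "\<eta> t \<in> fst d" by (rule chart_at[OF \<eta> t])
  show ?thesis
    using along_curve_derivative[OF VI_scalar \<eta> t] along_curve_eq[OF scalar_along[OF spray_field VI_scalar] \<eta> t d]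
      along_curve_eq[OF HI_scalar \<eta> t d] S_VI[OF d(1) geodesic_at(2)[OF \<eta> t d]] by simp
qed

lemma along_curve_HI:
  assumes \<eta>: "unit_geodesic X A F T \<eta>" and t: "t \<in> T"
  shows "(along_curve HI \<eta> has_real_derivative along_curve Kc \<eta> t * along_curve VI \<eta> t) (at t)"
proof -
  obtain d where d: "d \<in> A" "\<eta> t \<in> fst d" by (rule chart_at[OF \<eta> t])
  show ?thesis
    using along_curve_derivative[OF HI_scalar \<eta> t] along_curve_eq[OF scalar_along[OF spray_field HI_scalar] \<eta> t d]
      along_curve_eq[OF VI_scalar \<eta> t d] along_curve_eq[OF Kc_scalar \<eta> t d] S_HI[OF d(1) geodesic_at(2)[OF \<eta> t d]]
      \<rho>_level[OF geodesic_at(3)[OF \<eta> t d]] by simp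
qed

text \<open>
  Bootstrapping: the derivative of the velocity is the spray at the velocity, which is
  as regular as the velocity itself.
\<close>

lemma velocity_smooth:
  assumes \<eta>: "unit_geodesic X A F T \<eta>" and c: "c \<in> A"
  shows "smooth_on {s \<in> T. \<eta> s \<in> fst c} (velocity c \<eta>)"
proof -
  let ?W = "{s \<in> T. \<eta> s \<in> fst c}"
  have W: "open ?W" by (rule geodesic_chart_open[OF \<eta> c])
  have D: "(velocity c \<eta> has_derivative (\<lambda>r. r *\<^sub>R S c (velocity c \<eta> s))) (at s)" if "s \<in> ?W" for s
    using geodesic_at(4)[OF \<eta> _ c, of s] that by (simp add: has_vector_derivative_def)
  have sub: "velocity c \<eta> ` ?W \<subseteq> slit_dom c" using geodesic_at(2)[OF \<eta> _ c] by blast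
  have "C_on k ?W (velocity c \<eta>)" for k
  proof (induction k)
    case 0
    show ?case
      unfolding C_on.simps by (rule has_vector_derivative_continuous_on) (use D in \<open>simp add: has_vector_derivative_def\<close>)
  next
    case (Suc k)
    have "C_on k ?W (\<lambda>s. fd (velocity c \<eta>) s v)" for v
    proof (rule C_on_cong[OF W])
      show "v *\<^sub>R S c (velocity c \<eta> s) = fd (velocity c \<eta>) s v" if "s \<in> ?W" for s
        unfolding fd_eqI[OF D[OF that]] ..
      have "C_on k (slit_dom c) (S c)" using S_smooth[OF c] by (simp add: smooth_on_def)
      then show "C_on k ?W (\<lambda>s. v *\<^sub>R S c (velocity c \<eta> s))"
        by (intro C_on_bilinear[OF bounded_bilinear_scaleR W C_on_const] C_on_compose[OF W slit_open[OF c] sub Suc.IH])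
    qed
    then show ?case using D unfolding C_on.simps differentiable_def by blast
  qed
  then show ?thesis by (simp add: smooth_on_def)
qed

text \<open>
  The projection of \<open>H\<close> is parallel along the geodesic, so only its coefficient is differentiated.
\<close>

lemma covariant_deriv_frame:
  assumes \<eta>: "unit_geodesic X A F T \<eta>" and t: "t \<in> T" and c: "c \<in> A" "\<eta> t \<in> fst c"
    and Y: "\<And>s. s \<in> T \<Longrightarrow> \<eta> s \<in> fst c \<Longrightarrow> Y s c = g s *\<^sub>R a c (velocity c \<eta> s)"
    and g: "(g has_real_derivative g') (at t)"
  shows "covariant_deriv A F \<eta> Y t c = g' *\<^sub>R a c (velocity c \<eta> t)"
proof -
  let ?z = "velocity c \<eta> t" and ?W = "{s \<in> T. \<eta> s \<in> fst c}"
  have z: "?z \<in> slit_dom c" by (rule geodesic_at(2)[OF \<eta> t c])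
  have ga: "((\<lambda>s. a c (velocity c \<eta> s)) has_vector_derivative along (S c) (a c) ?z) (at t)"
    by (rule velocity_compose_derivative[OF \<eta> t c a_diffble[OF c(1) z]])
  have "((\<lambda>s. g s *\<^sub>R a c (velocity c \<eta> s)) has_vector_derivative (g t *\<^sub>R along (S c) (a c) ?z + g' *\<^sub>R a c ?z)) (at t)"
    by (rule has_vector_derivative_scaleR[OF g ga])
  then have "((\<lambda>s. Y s c) has_vector_derivative (g t *\<^sub>R along (S c) (a c) ?z + g' *\<^sub>R a c ?z)) (at t)"
    by (rule has_vector_derivative_transform_within_open[OF _ geodesic_chart_open[OF \<eta> c(1)]]) (use t c Y in auto)
  then have vd: "vector_derivative (\<lambda>s. Y s c) (at t) = g t *\<^sub>R along (S c) (a c) ?z + g' *\<^sub>R a c ?z"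
    by (rule vector_derivative_at)
  have ref: "(\<Sum>j\<in>UNIV. \<Sum>k\<in>UNIV. chern_rund A F c i j k ?z * snd ?z $ j * Y t c $ k)
      = g t * (\<Sum>k\<in>UNIV. nonlinear_conn A F c i k ?z * a c ?z $ k)" for i
  proof -
    have "(\<Sum>j\<in>UNIV. \<Sum>k\<in>UNIV. chern_rund A F c i j k ?z * snd ?z $ j * Y t c $ k)
      = (\<Sum>k\<in>UNIV. \<Sum>j\<in>UNIV. chern_rund A F c i j k ?z * snd ?z $ j * Y t c $ k)" by (rule sum.swap)
    also have "\<dots> = (\<Sum>k\<in>UNIV. nonlinear_conn A F c i k ?z * Y t c $ k)"
      by (simp add: sum_distrib_right[symmetric] finsler_chart.chern_rund_reference[OF finsler_chart[OF c(1)] z])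
    also have "\<dots> = g t * (\<Sum>k\<in>UNIV. nonlinear_conn A F c i k ?z * a c ?z $ k)"
      using Y[OF t c(2)] by (simp add: sum_distrib_left mult.left_commute)
    finally show ?thesis .
  qed
  show ?thesis
    unfolding covariant_deriv_def vd ref along_def S_a[OF c(1) z]
    by (simp add: vec_eq_iff algebra_simps)
qed

text \<open>
  The normal field \<open>V(I)\<close> times the projection of \<open>H\<close>.
\<close>

definition main_scalar_field :: "(real \<Rightarrow> 'a) \<Rightarrow> real \<Rightarrow> 'a chart \<Rightarrow> real^2" where
  "main_scalar_field \<eta> t d =
    (if d \<in> A \<and> \<eta> t \<in> fst d then along_curve VI \<eta> t *\<^sub>R a d (velocity d \<eta> t) else 0)"

text \<open>
  Two covariant derivatives act on the coefficient only and produce \<open>- K V(I)\<close>. In the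
  curvature term, the projection of \<open>H\<close> is orthogonal to the unit velocity, which leaves \<open>K V(I)\<close>.
\<close>

lemma main_scalar_field_jacobi:
  assumes \<eta>: "unit_geodesic X A F T \<eta>"
  shows "jacobi_field A F K T \<eta> (main_scalar_field \<eta>)"
proof -
  let ?Y = "main_scalar_field \<eta>"
  have Yc: "?Y t c = along_curve VI \<eta> t *\<^sub>R a c (velocity c \<eta> t)" if "c \<in> A" "\<eta> t \<in> fst c" for c t
    using that by (simp add: main_scalar_field_def)
  have tangent: "?Y t \<in> tangent_space A (\<eta> t)" if t: "t \<in> T" for t
    unfolding tangent_space_def
  proof (intro CollectI conjI ballI impI allI)
    fix c d assume c: "c \<in> A" and d: "d \<in> A" and "\<eta> t \<in> fst c \<inter> fst d"
    then have cd: "\<eta> t \<in> fst c" "\<eta> t \<in> fst d" by auto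
    note ch = geodesic_velocity_change[OF \<eta> t c cd(1) d cd(2)]
    have dt: "transition c d differentiable (at (snd c (\<eta> t)))" by (rule transition_diffble[OF c d cd])
    have "a d (velocity d \<eta> t) = fd (transition c d) (snd c (\<eta> t)) (a c (velocity c \<eta> t))"
      unfolding ch(1) vector_field_TT[OF H_field c d ch(2)] fst_fd_TT[OF c d ch(2)] fst_velocity ..
    then show "?Y t d = fd (transition c d) (snd c (\<eta> t)) (?Y t c)"
      by (simp add: Yc[OF c cd(1)] Yc[OF d cd(2)] linear_scale[OF fd_linear[OF dt]])
  next
    fix c assume "\<not> (c \<in> A \<and> \<eta> t \<in> fst c)"
    then show "?Y t c = 0" unfolding main_scalar_field_def by (rule if_not_P)
  qed
  have smooth: "smooth_on {t \<in> T. \<eta> t \<in> fst c} (\<lambda>t. ?Y t c)" if c: "c \<in> A" for c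
  proof (rule smooth_on_cong[OF geodesic_chart_open[OF \<eta> c]])
    let ?W = "{t \<in> T. \<eta> t \<in> fst c}"
    have W: "open ?W" by (rule geodesic_chart_open[OF \<eta> c])
    have sub: "velocity c \<eta> ` ?W \<subseteq> slit_dom c" using geodesic_at(2)[OF \<eta> _ c] by blast
    show "smooth_on ?W (\<lambda>t. VI c (velocity c \<eta> t) *\<^sub>R a c (velocity c \<eta> t))"
      by (intro smooth_on_scaleR[OF W] smooth_on_compose[OF W slit_open[OF c] sub velocity_smooth[OF \<eta> c]]
          scalar_smooth[OF VI_scalar c] smooth_on_fst[OF slit_open[OF c] vector_field_smooth[OF H_field c]])
    show "VI c (velocity c \<eta> t) *\<^sub>R a c (velocity c \<eta> t) = ?Y t c" if "t \<in> ?W" for t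
      using that by (simp add: Yc[OF c] along_curve_eq[OF VI_scalar \<eta> _ c])
  qed
  have "covariant_deriv A F \<eta> (covariant_deriv A F \<eta> ?Y) t c + curvature_term A F K c (velocity c \<eta> t) (?Y t c) = 0"
    if t: "t \<in> T" and c: "c \<in> A" "\<eta> t \<in> fst c" for t c
  proof -
    let ?z = "velocity c \<eta> t"
    have z: "?z \<in> slit_dom c" by (rule geodesic_at(2)[OF \<eta> t c])
    have F1: "Fc c ?z = 1" using geodesic_at(3)[OF \<eta> t c] by (simp add: level_def)
    have dp: "(along_curve HI \<eta> has_real_derivative Kc c ?z * along_curve VI \<eta> t) (at t)"
      using along_curve_HI[OF \<eta> t] along_curve_eq[OF Kc_scalar \<eta> t c] by simp
    have D1: "covariant_deriv A F \<eta> ?Y s c = (- along_curve HI \<eta> s) *\<^sub>R a c (velocity c \<eta> s)"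
      if s: "s \<in> T" "\<eta> s \<in> fst c" for s
      by (rule covariant_deriv_frame[OF \<eta> s(1) c(1) s(2) _ along_curve_VI[OF \<eta> s(1)]]) (use Yc c in auto)
    have D2: "covariant_deriv A F \<eta> (covariant_deriv A F \<eta> ?Y) t c = (- (Kc c ?z * along_curve VI \<eta> t)) *\<^sub>R a c ?z"
      by (rule covariant_deriv_frame[where Y = "covariant_deriv A F \<eta> ?Y" and g = "\<lambda>s. - along_curve HI \<eta> s",
            OF \<eta> t c D1 DERIV_minus[OF dp]])
    let ?M = "metric A F c ?z"
    have "snd ?z \<bullet> (?M *v snd ?z) = 1"
      using finsler_chart.g_yy[OF finsler_chart[OF c(1)] z] F1 by (simp add: F2_eq)
    moreover have "a c ?z \<bullet> (?M *v snd ?z) = 0"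
    proof -
      have "fd (F2 A F c) ?z (0, a c ?z) = 2 * (a c ?z \<bullet> (?M *v snd ?z))"
        unfolding finsler_chart.metric_mult_y[OF finsler_chart[OF c(1)] z]
          fd_coords[OF smooth_onD[OF finsler_chart.L_smooth[OF finsler_chart[OF c(1)]] z]]
        by (simp add: inner_vec_def sum_2)
      then show ?thesis using fd_L_V[OF c(1) z] by simp
    qed
    ultimately have "curvature_term A F K c ?z (?Y t c) = (Kc c ?z * along_curve VI \<eta> t) *\<^sub>R a c ?z"
      by (simp add: curvature_term_def Let_def Yc[OF c] Kc_def)
    then show ?thesis unfolding D2 by simp
  qed
  then show ?thesis unfolding jacobi_field_def field_along_def using tangent smooth by blast
qed

text \<open>
  The coefficient of the Jacobi field satisfies the Jacobi equation with curvature bounded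
  below by \<open>\<omega>\<^sup>2 > 0\<close>, so it has a zero in every closed interval of length \<open>\<pi> / \<omega>\<close>. Two disjoint
  intervals yield conjugate points unless the coefficient is zero at the start.
\<close>

lemma VI_vanishes_of_positive:
  assumes nf: "nonflat X A K" and ncp: "without_conjugate_points X A F K"
    and c: "c \<in> A" and z: "z \<in> level 1 c" and pos: "Kc c z > 0"
  shows "VI c z = 0"
proof (rule ccontr)
  assume uz: "VI c z \<noteq> 0"
  \<comment> \<open>A lower bound for \<open>\<bar>K\<bar>\<close> is the maximum of \<open>- K\<^sup>2\<close>, since \<open>K\<close> may take both signs.\<close>
  have sq: "scalar (\<lambda>c z. - (Kc c z * Kc c z))" by (intro scalar_minus scalar_mult Kc_scalar)
  obtain d w where d: "d \<in> A" "w \<in> level 1 d" and mx: "\<And>d' w'. d' \<in> A \<Longrightarrow> w' \<in> level 1 d' \<Longrightarrow> - (Kc d' w' * Kc d' w') \<le> - (Kc d w * Kc d w)"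
    by (rule scalar_attains_sup[OF sq _ c z]) (simp, blast)
  define m where "m = \<bar>Kc d w\<bar>"
  have m: "m > 0" using K_nonzero[OF nf d(1), of w] d(2) by (simp add: m_def level_def)
  have K_ge: "Kc d' w' \<ge> m" if "d' \<in> A" "w' \<in> level 1 d'" "Kc d' w' > 0" for d' w'
  proof -
    have "m\<^sup>2 \<le> (Kc d' w')\<^sup>2" using mx[OF that(1,2)] by (simp add: m_def power2_eq_square)
    then show ?thesis using that(3) power2_le_imp_le[of m "Kc d' w'"] by simp
  qed
  define \<omega> where "\<omega> = sqrt m"
  have \<omega>: "\<omega> > 0" "\<omega>\<^sup>2 = m" using m by (simp_all add: \<omega>_def)
  define l where "l = pi / \<omega>"
  have l: "l > 0" using \<omega> by (simp add: l_def)
  obtain e \<eta> where e: "e > 0" and \<eta>: "unit_geodesic X A F {-e<..<2 * l + 2} \<eta>" and \<eta>0: "\<eta> 0 \<in> fst c" "velocity c \<eta> 0 = z"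
    by (rule long_geodesic[OF c z]) blast
  let ?T = "{-e<..<2 * l + 2}"
  let ?f = "along_curve VI \<eta>" and ?k = "along_curve Kc \<eta>"
  have T0: "0 \<in> ?T" using e l by simp
  have k_nz: "?k t \<noteq> 0" if t: "t \<in> ?T" for t
  proof -
    obtain d where d: "d \<in> A" "\<eta> t \<in> fst d" by (rule chart_at[OF \<eta> t])
    show ?thesis using along_curve_eq[OF Kc_scalar \<eta> t d] K_nonzero[OF nf d(1) geodesic_at(2)[OF \<eta> t d]] by simp
  qed
  have k0: "?k 0 > 0" using along_curve_eq[OF Kc_scalar \<eta> T0 c \<eta>0(1)] pos \<eta>0(2) by simp
  have "continuous_on ?T ?k"
    by (intro continuous_at_imp_continuous_on ballI DERIV_isCont[OF along_curve_derivative[OF Kc_scalar \<eta>]])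
  then have conn: "connected (?k ` ?T)" by (rule connected_continuous_image) simp
  have k_pos: "?k t > 0" if t: "t \<in> ?T" for t
  proof (rule ccontr)
    assume "\<not> ?k t > 0"
    then have "0 \<in> ?k ` ?T" using connectedD_interval[OF conn, of "?k t" "?k 0" 0] t T0 k0 by auto
    then show False using k_nz by auto
  qed
  have k_ge: "\<omega>\<^sup>2 \<le> ?k t" if t: "t \<in> ?T" for t
  proof -
    obtain d where d: "d \<in> A" "\<eta> t \<in> fst d" by (rule chart_at[OF \<eta> t])
    show ?thesis using k_pos[OF t] unfolding along_curve_eq[OF Kc_scalar \<eta> t d] \<omega>(2)
      by (rule K_ge[OF d(1) geodesic_at(3)[OF \<eta> t d]])
  qed
  have dp: "((\<lambda>t. - along_curve HI \<eta> t) has_real_derivative - ?k t * ?f t) (at t)" if t: "t \<in> ?T" for t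
    using DERIV_minus[OF along_curve_HI[OF \<eta> t]] by simp
  have zero: "\<exists>t\<in>{b..b + l}. ?f t = 0" if "b \<ge> 0" "b \<le> l + 1" for b
  proof (rule sturm_zero[OF \<omega>(1), of _ _ _ "\<lambda>t. - along_curve HI \<eta> t" ?k])
    show "b + l = b + pi / \<omega>" by (simp add: l_def)
  qed (use that e l along_curve_VI[OF \<eta>] dp k_ge in auto)
  obtain s where s: "s \<in> {0..l}" "?f s = 0" using zero[of 0] l by auto
  obtain t where t: "t \<in> {l + 1..2 * l + 1}" "?f t = 0" using zero[of "l + 1"] l by auto
  have sT: "s \<in> ?T" "t \<in> ?T" "s \<noteq> t" using s t e l by auto
  have "main_scalar_field \<eta> 0 c \<noteq> 0"
    using uz c \<eta>0 along_curve_eq[OF VI_scalar \<eta> T0 c \<eta>0(1)] independent(2)[OF c, of z] z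
    by (simp add: main_scalar_field_def level_def)
  then have "main_scalar_field \<eta> 0 \<noteq> (\<lambda>_. 0)" by auto
  moreover have "main_scalar_field \<eta> s = (\<lambda>_. 0)" "main_scalar_field \<eta> t = (\<lambda>_. 0)"
    using s(2) t(2) by (simp_all add: main_scalar_field_def fun_eq_iff)
  ultimately have "conjugate_along A F K ?T \<eta> s t"
    unfolding conjugate_along_def using main_scalar_field_jacobi[OF \<eta>] sT T0 by blast
  then show False using ncp \<eta> unfolding without_conjugate_points_def by blast
qed

end


section \<open>The main scalar vanishes\<close>

context berwald_surface
begin

text \<open>
  The maximum principle for \<open>V(I) H(I)\<close>, whose derivative along \<open>S\<close> is \<open>- H(I)\<^sup>2 + K V(I)\<^sup>2\<close> on
  unit vectors. Where \<open>K < 0\<close>, this derivative vanishes only if both terms do; where \<open>K > 0\<close>, the factor \<open>V(I)\<close> is already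
  known to be \<open>0\<close>.
\<close>

lemma VI_vanishes:
  assumes nf: "nonflat X A K" and ncp: "without_conjugate_points X A F K"
    and c: "c \<in> A" and z: "z \<in> level 1 c"
  shows "VI c z = 0"
proof -
  have D: "along (S d) (\<lambda>z. VI d z * HI d z) w = - (HI d w * HI d w) + Kc d w * (VI d w * VI d w)"
    if d: "d \<in> A" and w: "w \<in> level 1 d" for d w
  proof -
    have ws: "w \<in> slit_dom d" using w by (simp add: level_def)
    show ?thesis
      using along_mult[OF smooth_onD[OF scalar_smooth[OF VI_scalar d] ws] smooth_onD[OF scalar_smooth[OF HI_scalar d] ws], of "S d"]
        S_VI[OF d ws] S_HI[OF d ws] \<rho>_level[OF w] by simp
  qed
  have key: "VI d w = 0" if d: "d \<in> A" and w: "w \<in> level 1 d" and 0: "along (S d) (\<lambda>z. VI d z * HI d z) w = 0" for d w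
  proof (cases "Kc d w > 0")
    case True
    then show ?thesis by (rule VI_vanishes_of_positive[OF nf ncp d w])
  next
    case False
    then have K: "Kc d w < 0" using K_nonzero[OF nf d, of w] w by (simp add: level_def)
    have "Kc d w * (VI d w * VI d w) = HI d w * HI d w" using 0 D[OF d w] by simp
    then have "Kc d w * (VI d w * VI d w) \<ge> 0" by simp
    then show ?thesis using K by (auto simp: zero_le_mult_iff mult_le_0_iff)
  qed
  have "along (S c) (\<lambda>z. VI c z * HI c z) z = 0"
  proof (rule maximum_principle(2)[of "\<lambda>c z. VI c z * HI c z" 1 S])
    show "scalar (\<lambda>c z. VI c z * HI c z)" by (rule scalar_mult[OF VI_scalar HI_scalar])
    show "fd (Fc d) w (S d w) = 0" if "d \<in> A" "w \<in> level 1 d" for d w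
      using spray_F[OF that(1)] that(2) by (simp add: level_def)
    show "VI d w * HI d w = 0" if "d \<in> A" "w \<in> level 1 d" "along (S d) (\<lambda>z. VI d z * HI d z) w = 0" for d w
      using key[OF that] by simp
  qed (use c z in simp_all)
  then show ?thesis by (rule key[OF c z])
qed

text \<open>
  The maximum principle along the fibres for \<open>I \<rho>\<close>, whose derivative along \<open>V\<close> is \<open>- I\<^sup>2 \<rho>\<close> once
  \<open>V(I) = 0\<close>.
\<close>

lemma main_scalar_vanishes:
  assumes nf: "nonflat X A K" and ncp: "without_conjugate_points X A F K"
    and c: "c \<in> A" and z: "z \<in> level 1 c"
  shows "Ic c z = 0"
proof -
  have key: "Ic d w = 0" if d: "d \<in> A" and w: "w \<in> level 1 d" and 0: "along (V d) (\<lambda>z. Ic d z * \<rho> d z) w = 0" for d w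
  proof -
    have ws: "w \<in> slit_dom d" using w by (simp add: level_def)
    have "along (V d) (\<lambda>z. Ic d z * \<rho> d z) w = - (Ic d w * Ic d w) * \<rho> d w"
      using along_mult[OF smooth_onD[OF scalar_smooth[OF Ic_scalar d] ws] smooth_onD[OF scalar_smooth[OF \<rho>_scalar d] ws], of "V d"]
        frame_at(5)[OF d ws] VI_vanishes[OF nf ncp d w] by (simp add: VI_def)
    then show ?thesis using 0 \<rho>_level[OF w] K_nonzero[OF nf d ws] by simp
  qed
  have "along (V c) (\<lambda>z. Ic c z * \<rho> c z) z = 0"
  proof (rule maximum_principle(2)[of "\<lambda>c z. Ic c z * \<rho> c z" 1 V])
    show "scalar (\<lambda>c z. Ic c z * \<rho> c z)" by (rule scalar_mult[OF Ic_scalar \<rho>_scalar])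
    show "fd (Fc d) w (V d w) = 0" if "d \<in> A" "w \<in> level 1 d" for d w
      using frame_at(1)[OF that(1)] that(2) by (simp add: level_def)
    show "Ic d w * \<rho> d w = 0" if "d \<in> A" "w \<in> level 1 d" "along (V d) (\<lambda>z. Ic d z * \<rho> d z) w = 0" for d w
      using key[OF that] by simp
  qed (use c z in simp_all)
  then show ?thesis by (rule key[OF c z])
qed

section \<open>Vanishing main scalar means Riemannian\<close>

lemma frame_determinant:
  assumes c: "c \<in> A" and z: "z \<in> slit_dom c"
  shows "snd z $ 1 * a c z $ 2 - snd z $ 2 * a c z $ 1 \<noteq> 0"
proof
  assume D: "snd z $ 1 * a c z $ 2 - snd z $ 2 * a c z $ 1 = 0"
  let ?a = "a c z"
  have "?a $ 1 \<noteq> 0 \<or> ?a $ 2 \<noteq> 0" using independent(2)[OF c z] by (auto simp: vec_eq_iff forall_2)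
  then have "\<exists>t. snd z + t *\<^sub>R ?a = 0"
  proof
    assume "?a $ 1 \<noteq> 0"
    then show ?thesis using D by (intro exI[of _ "- snd z $ 1 / ?a $ 1"]) (auto simp: vec_eq_iff forall_2 field_simps)
  next
    assume "?a $ 2 \<noteq> 0"
    then show ?thesis using D by (intro exI[of _ "- snd z $ 2 / ?a $ 2"]) (auto simp: vec_eq_iff forall_2 field_simps)
  qed
  then show False using independent(1)[OF c z] by blast
qed

text \<open>
  The second identity is \<open>V(F) = 0\<close>. Its derivative along \<open>V\<close> gives the first one, by \<open>V_a\<close>.
\<close>

lemma g_H:
  assumes c: "c \<in> A" and z: "z \<in> slit_dom c"
  shows "(\<Sum>i\<in>UNIV. \<Sum>j\<in>UNIV. metric A F c z $ i $ j * a c z $ i * a c z $ j) = F2 A F c z"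
    and "(\<Sum>j\<in>UNIV. dy j (F2 A F c) z * a c z $ j) = 0"
proof -
  interpret fc: finsler_chart A F c by (rule finsler_chart[OF c])
  have E: "(\<Sum>j\<in>UNIV. dy j fc.L w * a c w $ j) = 0" if "w \<in> fc.U" for w
    using fd_L_V[OF c that] fd_coords[OF smooth_onD[OF fc.L_smooth that], of "(0, a c w)"] by (simp add: mult.commute)
  show "(\<Sum>j\<in>UNIV. dy j fc.L z * a c z $ j) = 0" by (rule E[OF z])
  have a_sm: "smooth_on fc.U (\<lambda>w. a c w $ j)" for j
    by (intro smooth_on_nth fc.U_open smooth_on_fst vector_field_smooth[OF H_field c])
  have dl: "dy j fc.L differentiable (at z)" for j by (rule smooth_onD[OF fc.L_partials_smooth(3) z])
  have da: "(\<lambda>w. a c w $ j) differentiable (at z)" for j by (rule smooth_onD[OF a_sm z])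
  have Va: "along (V c) (\<lambda>w. a c w $ j) z = - (snd z $ j + Ic c z * a c z $ j)" for j
    unfolding along_def fd_bounded_linear[OF bounded_linear_vec_nth a_diffble[OF c z]] V_a[OF c z] by simp
  have Vl: "along (V c) (dy j fc.L) z = (\<Sum>m\<in>UNIV. 2 * metric A F c z $ m $ j * a c z $ m)" for j
    unfolding along_def fd_coords[OF dl] by (simp add: V_eq fc.g_at mult.commute)
  have "along (V c) (\<lambda>w. \<Sum>j\<in>UNIV. dy j fc.L w * a c w $ j) z = along (V c) (\<lambda>w. 0) z"
    by (rule along_cong[OF fc.U_open z _ E]) (intro smooth_on_sum smooth_on_mult fc.L_partials_smooth a_sm fc.U_open)
  also have "\<dots> = 0" by (simp add: along_def)
  finally have "(\<Sum>j\<in>UNIV. along (V c) (dy j fc.L) z * a c z $ j + dy j fc.L z * along (V c) (\<lambda>w. a c w $ j) z) = 0"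
    using fd_sum[of UNIV "\<lambda>j w. dy j fc.L w * a c w $ j" z "V c z", OF differentiable_mult[OF dl da]]
    unfolding along_def fd_mult[OF dl da] by (simp add: algebra_simps)
  then show "(\<Sum>i\<in>UNIV. \<Sum>j\<in>UNIV. metric A F c z $ i $ j * a c z $ i * a c z $ j) = fc.L z"
    using E[OF z] fc.L_euler[OF z] unfolding Vl Va sum_2 by algebra
qed

text \<open>
  The symmetric matrix \<open>M\<close> of derivatives of \<open>g\<close> along \<open>V\<close> annihilates \<open>y\<close> by homogeneity. The
  derivative of \<open>g(a, a) = L\<close> along \<open>V\<close>, where \<open>V(a) = - y\<close>, shows that \<open>M(a, a) = 0\<close>. As \<open>y\<close> and \<open>a\<close> are
  independent, \<open>M = 0\<close>. The derivative of \<open>g\<close> in the direction \<open>y\<close> is \<open>0\<close> by homogeneity, and the two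
  directions span the fibre.
\<close>

lemma metric_fibre_derivative_level:
  assumes I0: "\<And>d w. d \<in> A \<Longrightarrow> w \<in> level 1 d \<Longrightarrow> Ic d w = 0"
    and c: "c \<in> A" and z: "z \<in> level 1 c"
  shows "dy k (\<lambda>w. metric A F c w $ i $ j) z = 0"
proof -
  interpret fc: finsler_chart A F c by (rule finsler_chart[OF c])
  have zs: "z \<in> fc.U" using z by (simp add: level_def)
  let ?a = "a c z" and ?y = "snd z"
  note D = frame_determinant[OF c zs]
  have a_sm: "smooth_on fc.U (\<lambda>w. a c w $ j)" for j
    by (intro smooth_on_nth fc.U_open smooth_on_fst vector_field_smooth[OF H_field c])
  define M where "M i j = along (V c) (fc.g i j) z" for i j
  have M: "M i j = ?a $ 1 * dy 1 (fc.g i j) z + ?a $ 2 * dy 2 (fc.g i j) z" for i j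
    unfolding M_def along_def fd_coords[OF smooth_onD[OF fc.g_smooth zs]] by (simp add: V_eq sum_2)
  have sym: "M 2 1 = M 1 2"
    unfolding M_def by (rule along_cong[OF fc.U_open zs fc.g_smooth fc.g_sym])
  have My: "?y $ 1 * M 1 l + ?y $ 2 * M 2 l = 0" for l
    using fc.y_dy_g[OF zs, of 1 l] fc.y_dy_g[OF zs, of 2 l] unfolding M sum_2 by algebra
  have da: "(\<lambda>w. a c w $ j) differentiable (at z)" for j by (rule smooth_onD[OF a_sm zs])
  have dg: "(fc.g i j) differentiable (at z)" for i j by (rule smooth_onD[OF fc.g_smooth zs])
  have Va: "along (V c) (\<lambda>w. a c w $ j) z = - ?y $ j" for j
    unfolding along_def fd_bounded_linear[OF bounded_linear_vec_nth a_diffble[OF c zs]] V_a[OF c zs]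
    using I0[OF c z] by simp
  have "along (V c) (\<lambda>w. \<Sum>i\<in>UNIV. \<Sum>j\<in>UNIV. fc.g i j w * a c w $ i * a c w $ j) z = along (V c) fc.L z"
    by (rule along_cong[OF fc.U_open zs _ g_H(1)[OF c]]) (intro smooth_on_sum smooth_on_mult fc.g_smooth a_sm fc.U_open)
  also have "\<dots> = 0" unfolding along_def using fd_L_V[OF c zs] by (simp add: V_eq)
  finally have V0: "along (V c) (\<lambda>w. \<Sum>i\<in>UNIV. \<Sum>j\<in>UNIV. fc.g i j w * a c w $ i * a c w $ j) z = 0" .
  have termwise: "fd (\<lambda>w. fc.g i j w * a c w $ i * a c w $ j) z (V c z) =
     M i j * ?a $ i * ?a $ j - fc.g i j z * ?y $ i * ?a $ j - fc.g i j z * ?a $ i * ?y $ j" for i j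
    using fd_mult[OF differentiable_mult[OF dg[of i j] da[of i]] da[of j], of "V c z"] fd_mult[OF dg[of i j] da[of i], of "V c z"]
      Va[of i] Va[of j] by (simp add: M_def along_def algebra_simps)
  have "along (V c) (\<lambda>w. \<Sum>i\<in>UNIV. \<Sum>j\<in>UNIV. fc.g i j w * a c w $ i * a c w $ j) z
    = (\<Sum>i\<in>UNIV. \<Sum>j\<in>UNIV. M i j * ?a $ i * ?a $ j - fc.g i j z * ?y $ i * ?a $ j - fc.g i j z * ?a $ i * ?y $ j)"
    unfolding along_def
    by (simp add: fd_sum termwise differentiable_sum differentiable_mult dg da)
  then have sum0: "(\<Sum>i\<in>UNIV. \<Sum>j\<in>UNIV. M i j * ?a $ i * ?a $ j - fc.g i j z * ?y $ i * ?a $ j - fc.g i j z * ?a $ i * ?y $ j) = 0"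
    using V0 by simp
  have gy: "2 * (?y $ 1 * fc.g 1 l z + ?y $ 2 * fc.g 2 l z) = dy l fc.L z" for l using fc.g_euler[OF zs, of l] by (simp add: sum_2)
  have gs: "fc.g 2 1 z = fc.g 1 2 z" by (rule fc.g_sym[OF zs])
  have Maa: "M 1 1 * (?a $ 1 * ?a $ 1) + 2 * (M 1 2 * (?a $ 1 * ?a $ 2)) + M 2 2 * (?a $ 2 * ?a $ 2) = 0"
    using sum0 gy[of 1] gy[of 2] g_H(2)[OF c zs] sym gs unfolding sum_2 by algebra
  have Mz: "M 1 1 = 0" "M 1 2 = 0" "M 2 2 = 0"
  proof -
    let ?D = "?y $ 1 * ?a $ 2 - ?y $ 2 * ?a $ 1"
    \<comment> \<open>\<open>M = \<mu> n n\<^sup>T\<close> with \<open>n\<close> orthogonal to \<open>y\<close>, and \<open>?D\<close> is the value of \<open>n\<close> on \<open>a\<close>, so \<open>M(a, a) = \<mu> ?D\<^sup>2\<close>.\<close>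
    have "?D * ?D * M 1 1 = 0" "?D * ?D * M 1 2 = 0" "?D * ?D * M 2 2 = 0"
      using Maa My[of 1] My[of 2] sym by algebra+
    then show "M 1 1 = 0" "M 1 2 = 0" "M 2 2 = 0" using D by simp_all
  qed
  then have M0: "M i j = 0" using sym exhaust_2[of i] exhaust_2[of j] by auto
  have C: "?y $ 1 * dy 1 (fc.g i j) z + ?y $ 2 * dy 2 (fc.g i j) z = 0"
    using euler_dy[OF fc.U_conic zs fc.g_smooth fc.g_homogeneous, of i j] by (simp add: sum_2)
  have "(?y $ 1 * ?a $ 2 - ?y $ 2 * ?a $ 1) * dy 1 (fc.g i j) z = 0" "(?y $ 1 * ?a $ 2 - ?y $ 2 * ?a $ 1) * dy 2 (fc.g i j) z = 0"
    using C M0 unfolding M by algebra+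
  then show ?thesis using D exhaust_2[of k] by auto
qed

text \<open>
  By homogeneity the fibre derivative of \<open>g\<close> vanishes off the unit vectors too. A fibre
  without the origin is connected, so \<open>g\<close> is constant on it, and \<open>F\<^sup>2 = g(y, y)\<close>.
\<close>

lemma riemannian_of_main_scalar:
  assumes I0: "\<And>d w. d \<in> A \<Longrightarrow> w \<in> level 1 d \<Longrightarrow> Ic d w = 0"
  shows "riemannian A F"
  unfolding riemannian_def
proof (intro ballI)
  fix c x assume c: "c \<in> A" and x: "x \<in> snd c ` fst c"
  interpret fc: finsler_chart A F c by (rule finsler_chart[OF c])
  have in_U: "(x, y) \<in> fc.U" if "y \<noteq> 0" for y using x that by (simp add: slit_dom_def)
  have vert: "fd (fc.g i j) (x, y) (0, b) = 0" if y: "y \<noteq> 0" for i j y b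
  proof -
    define t where "t = 1 / Fc c (x, y)"
    have t: "t > 0" using Fc_pos[OF c in_U[OF y]] by (simp add: t_def)
    have "(x, t *\<^sub>R y) \<in> level 1 c"
      using in_U[of "t *\<^sub>R y"] t y Fc_scale[OF c in_U[OF y] t] Fc_pos[OF c in_U[OF y]] by (simp add: level_def t_def)
    then have "dy k (fc.g i j) (x, t *\<^sub>R y) = 0" for k by (intro metric_fibre_derivative_level I0 c)
    then have "fd (fc.g i j) (x, t *\<^sub>R y) (0, t *\<^sub>R b) = 0"
      using fd_coords[OF smooth_onD[OF fc.g_smooth in_U[of "t *\<^sub>R y"]], of i j "(0, t *\<^sub>R b)"] t y by simp
    then show ?thesis
      using fd_fibre_homogeneous[OF fc.U_open fc.U_conic in_U[OF y] fc.g_smooth fc.g_homogeneous t, of i j 0 b] by simp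
  qed
  have const: "fc.g i j (x, y) = fc.g i j (x, axis 1 1)" if y: "y \<noteq> 0" for i j y
  proof -
    have "((\<lambda>y. fc.g i j (x, y)) has_derivative (\<lambda>h. 0)) (at y)" if y: "y \<in> - {0}" for y
    proof -
      have dg: "(fc.g i j) differentiable (at (x, y))" by (rule smooth_onD[OF fc.g_smooth in_U]) (use y in simp)
      have l: "((\<lambda>y. (x, y)) has_derivative (\<lambda>h. (0, h))) (at y)" by (auto intro!: derivative_eq_intros)
      show ?thesis using has_derivative_compose[OF l fd_works[OF dg]] vert y by simp
    qed
    moreover have "connected (- {0 :: real^2})" by (rule connected_punctured_universe) simp
    moreover have "open (- {0 :: real^2})" by auto
    ultimately show ?thesis
      using has_derivative_zero_unique_connected[of "- {0}" "\<lambda>y. fc.g i j (x, y)" "axis 1 1" y] y by (simp add: axis_eq_0_iff)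
  qed
  let ?M = "metric A F c (x, axis 1 1)"
  have ax: "(x, axis 1 1) \<in> fc.U" by (rule in_U) (simp add: axis_eq_0_iff)
  show "\<exists>a :: real^2^2. transpose a = a \<and> (\<forall>y. (F (tvec A c (x, y)))\<^sup>2 = y \<bullet> (a *v y))"
  proof (intro exI[of _ ?M] conjI allI)
    show "transpose ?M = ?M" using fc.g_sym[OF ax] by (simp add: transpose_def vec_eq_iff)
    fix y
    show "(F (tvec A c (x, y)))\<^sup>2 = y \<bullet> (?M *v y)"
    proof (cases "y = 0")
      case True
      then show ?thesis using Fc_zero[OF c x] by (simp add: Fc_def)
    next
      case False
      then have "metric A F c (x, y) = ?M" using const by (simp add: vec_eq_iff)
      then show ?thesis using fc.g_yy[OF in_U[OF False]] by (simp add: F2_def)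
    qed
  qed
qed

end

theorem theorem5p9:
  fixes X :: "'a topology" and A :: "'a chart set"
    and F K I :: "'a tvec \<Rightarrow> real" and H :: "'a vfield"
  assumes "smooth_surface X A" and "connected_space X" and "compact_space X"
    and "finsler X A F"
    and "genus X \<ge> 1"
    and "flag_curvature A F K"
    and "without_conjugate_points X A F K"
    and "nonflat X A K"
    and "berwald_frame A F K H I"
    and "\<forall>c\<in>A. \<forall>z\<in>slit_dom c.
      lie A (almost_tangent H) (ricci_scalar F K) c z =
      - I (tvec A c z) * ricci_scalar F K (tvec A c z)"
  shows "riemannian A F"
proof -
  interpret berwald_surface X A F K I H
  proof
    show "smooth_fun A K" using \<open>flag_curvature A F K\<close> by (simp add: flag_curvature_def)
  qed (fact assms)+
  show ?thesis
    using riemannian_of_main_scalar main_scalar_vanishes assms(7,8) by blast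
qed

end
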